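(* Let $(G,\mathcal B)$ be a Rota-Baxter Lie group of weight $-1$ with infinitesimal Rota-Baxter Lie algebra $(\mathfrak g,B=\mathcal B_{*e})$, let $\widetilde{\mathcal B}(a)=a\mathcal B(a^{-1})$ and $\widetilde B=\mathrm{id}-B$, and let $(G_+,G_-,\rho,\mu)$ be the matched pair of groups on $(G,\mathcal B)$. Let $\mathfrak g_+=\mathrm{Im}\,B$, $\mathfrak g_-=\mathrm{Im}\,\widetilde B$. Let $\rhd:\mathfrak g_+\times\mathfrak g_-\to\mathfrak g_-$ and $\blacktriangleright:\mathfrak g_-\times\mathfrak g_+\to\mathfrak g_+$ be given, for all $x,y\in\mathfrak g$, by $$B(x)\rhd\widetilde B(y)=\left.\frac{d}{dt}\right|_{t=0}\left.\frac{d}{ds}\right|_{s=0}\rho(\mathcal B(\exp(tx)))(\widetilde{\mathcal B}(\exp(sy))),$$ $$\widetilde B(x)\blacktriangleright B(y)=\left.\frac{d}{dt}\right|_{t=0}\left.\frac{d}{ds}\right|_{s=0}\mu(\widetilde{\mathcal B}(\exp(tx)))(\mathcal B(\exp(sy))).$$ Then $(\mathfrak g_+,\mathfrak g_-,\rhd,\blacktriangleright)$ is the matched pair of Lie algebras on $(\mathfrak g,B)$; that is, $B(x)\rhd\widetilde B(y)=\widetilde B([B(x),y])$ and $\widetilde B(x)\blacktriangleright B(y)=B([\widetilde B(x),y])$ for all $x,y\in\mathfrak g$.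
   Context: For a group $G$ and $a,b\in G$, $\mathrm{Ad}_a(b)=aba^{-1}$; $e$ is the identity. A Rota-Baxter operator of weight $-1$ on a group $G$ is a map $\mathcal B:G\to G$ with $\mathcal B(a)\mathcal B(b)=\mathcal B((\mathrm{Ad}_{\mathcal B(a)}(b))a)$ for all $a,b\in G$. If $G$ is a (real) Lie group and $\mathcal B$ is smooth, $(G,\mathcal B)$ is a Rota-Baxter Lie group of weight $-1$. Its infinitesimal Rota-Baxter Lie algebra is $(\mathfrak g,B)$, where $\mathfrak g$ is the Lie algebra of $G$ and $B(x)=\left.\frac{d}{dt}\right|_{t=0}\mathcal B(\exp(tx))$ is the tangent map of $\mathcal B$ at $e$; it is known that $B$ is a Rota-Baxter operator of weight $-1$ on $\mathfrak g$, i.e. $[B(x),B(y)]=B([B(x),y]+[x,B(y)]-[x,y])$. The matched pair of groups on $(G,\mathcal B)$ is $(G_+,G_-,\rho,\mu)$ with $G_+=\mathrm{Im}\,\mathcal B$, $G_-=\mathrm{Im}\,\widetilde{\mathcal B}$ and well-defined actions $\rho(\mathcal B(a))(\widetilde{\mathcal B}(b))=\widetilde{\mathcal B}(\mathrm{Ad}_{\mathcal B(a)}(b))$, $\mu(\widetilde{\mathcal B}(a))(\mathcal B(b))=\mathcal B(\mathrm{Ad}_{\widetilde{\mathcal B}(a)}(b))$. The matched pair of Lie algebras on a Rota-Baxter Lie algebra $(\mathfrak g,B)$ of weight $-1$ is $(\mathrm{Im}\,B,\mathrm{Im}\,\widetilde B,\rhd,\blacktriangleright)$ with $\widetilde B=\mathrm{id}-B$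 and the well-defined maps $B(x)\rhd\widetilde B(y)=\widetilde B([B(x),y])$, $\widetilde B(x)\blacktriangleright B(y)=B([\widetilde B(x),y])$. *)

theory Defs
  imports "HOL-Analysis.Analysis" "HOL-Algebra.Group"
begin

section \<open>Smooth manifolds\<close>

text \<open>
  All maps are total functions on the underlying types and are only used on the sets that are
  mentioned. On open subsets of a finite-dimensional space, being n times continuously
  differentiable is the same as having continuous iterated directional derivatives up to order n
  (which avoids the changing codomains of the higher Frechet derivatives).
\<close>

fun Ck_on :: "nat \<Rightarrow> 'a::real_normed_vector set \<Rightarrow> ('a \<Rightarrow> 'b::real_normed_vector) \<Rightarrow> bool" where
  "Ck_on 0 S f \<longleftrightarrow> continuous_on S f"
| "Ck_on (Suc n) S f \<longleftrightarrow>
     (\<forall>x\<in>S. f differentiable (at x)) \<and> (\<forall>v. Ck_on n S (\<lambda>x. frechet_derivative f (at x) v))"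

definition smooth_on :: "'a::real_normed_vector set \<Rightarrow> ('a \<Rightarrow> 'b::real_normed_vector) \<Rightarrow> bool" where
  "smooth_on S f \<longleftrightarrow> (\<forall>n. Ck_on n S f)"

text \<open>
  A chart is a pair of its domain and its coordinate map; values of the coordinate map outside
  the domain are irrelevant. The model space is a finite-dimensional normed space rather than
  a type of class \<open>euclidean_space\<close>, as the latter would exclude manifolds of dimension 0
  (such a space is automatically complete, so restricting it to class \<open>banach\<close> loses nothing).
\<close>

type_synonym ('p, 'e) chart = "'p set \<times> ('p \<Rightarrow> 'e)"

record ('p, 'e) manifold =
  base :: "'p topology"
  atlas :: "('p, 'e) chart set"

definition chart_inv :: "('p, 'e) chart \<Rightarrow> 'e \<Rightarrow> 'p" where
  "chart_inv c = inv_into (fst c) (snd c)"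

definition charts_at :: "('p, 'e) manifold \<Rightarrow> 'p \<Rightarrow> ('p, 'e) chart set" where
  "charts_at M p = {c \<in> atlas M. p \<in> fst c}"

definition smooth_manifold :: "('p, 'e::real_normed_vector) manifold \<Rightarrow> bool" where
  "smooth_manifold M \<longleftrightarrow>
     (\<exists>S :: 'e set. finite S \<and> span S = UNIV) \<and>
     Hausdorff_space (base M) \<and> second_countable (base M) \<and>
     (\<Union>c\<in>atlas M. fst c) = topspace (base M) \<and>
     (\<forall>c\<in>atlas M. openin (base M) (fst c) \<and> open (snd c ` fst c) \<and>
        homeomorphic_map (subtopology (base M) (fst c)) (top_of_set (snd c ` fst c)) (snd c)) \<and>
     (\<forall>c\<in>atlas M. \<forall>d\<in>atlas M. smooth_on (snd c ` (fst c \<inter> fst d)) (snd d \<circ> chart_inv c))"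

definition smooth_map ::
  "('p, 'e::real_normed_vector) manifold \<Rightarrow> ('q, 'f::real_normed_vector) manifold
     \<Rightarrow> ('p \<Rightarrow> 'q) \<Rightarrow> bool" where
  "smooth_map M N f \<longleftrightarrow>
     continuous_map (base M) (base N) f \<and>
     (\<forall>c\<in>atlas M. \<forall>d\<in>atlas N.
        smooth_on (snd c ` (fst c \<inter> f -` fst d)) (snd d \<circ> f \<circ> chart_inv c))"

definition prod_manifold ::
  "('p, 'e) manifold \<Rightarrow> ('q, 'f) manifold \<Rightarrow> ('p \<times> 'q, 'e \<times> 'f) manifold" where
  "prod_manifold M N =
     \<lparr> base = prod_topology (base M) (base N),
       atlas = {(fst c \<times> fst d, map_prod (snd c) (snd d)) |c d. c \<in> atlas M \<and> d \<in> atlas N} \<rparr>"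

definition real_line :: "(real, real) manifold" where
  "real_line = \<lparr> base = euclideanreal, atlas = {(UNIV, id)} \<rparr>"


section \<open>Tangent vectors\<close>

text \<open>
  A tangent vector at p is the family of its components in the charts of the atlas around p,
  subject to the usual transformation law. The family is 0 at all other arguments, so that
  equality of tangent vectors is equality of functions. Addition and scaling are pointwise.
\<close>

type_synonym ('p, 'e) tangent = "('p, 'e) chart \<Rightarrow> 'e"

definition tangent_space ::
  "('p, 'e::real_normed_vector) manifold \<Rightarrow> 'p \<Rightarrow> ('p, 'e) tangent set" where
  "tangent_space M p =
     {v. (\<forall>c. c \<notin> charts_at M p \<longrightarrow> v c = 0) \<and>
         (\<forall>c\<in>charts_at M p. \<forall>d\<in>charts_at M p.
            v d = frechet_derivative (snd d \<circ> chart_inv c) (at (snd c p)) (v c))}"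

text \<open>The choice of the chart at p is immaterial by the transformation law.\<close>

definition tangent_map ::
  "('p, 'e::real_normed_vector) manifold \<Rightarrow> ('q, 'f::real_normed_vector) manifold
     \<Rightarrow> ('p \<Rightarrow> 'q) \<Rightarrow> 'p \<Rightarrow> ('p, 'e) tangent \<Rightarrow> ('q, 'f) tangent" where
  "tangent_map M N f p v =
     (\<lambda>d. if d \<in> charts_at N (f p)
          then let c = (SOME c. c \<in> charts_at M p)
               in frechet_derivative (snd d \<circ> f \<circ> chart_inv c) (at (snd c p)) (v c)
          else 0)"

definition curve_velocity ::
  "('p, 'e::real_normed_vector) manifold \<Rightarrow> (real \<Rightarrow> 'p) \<Rightarrow> real \<Rightarrow> ('p, 'e) tangent" where
  "curve_velocity M \<gamma> t =
     (\<lambda>c. if c \<in> charts_at M (\<gamma> t) then vector_derivative (snd c \<circ> \<gamma>) (at t) else 0)"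

text \<open>
  \<open>d/dt d/ds \<Gamma> t s\<close> at \<open>s = t = 0\<close>, for a family of curves through a common point
  \<open>p = \<Gamma> t 0\<close>. The inner derivatives then form a curve in the fixed vector space
  \<open>tangent_space M p\<close>, whose derivative is taken componentwise; each component is a linear
  isomorphism onto the model space.
\<close>

definition iterated_velocity ::
  "('p, 'e::real_normed_vector) manifold \<Rightarrow> (real \<Rightarrow> real \<Rightarrow> 'p) \<Rightarrow> ('p, 'e) tangent" where
  "iterated_velocity M \<Gamma> =
     (\<lambda>c. vector_derivative (\<lambda>t. curve_velocity M (\<Gamma> t) 0 c) (at 0))"

text \<open>The Lie bracket of vector fields, \<open>[X, Y] = DY(X) - DX(Y)\<close> in coordinates.\<close>

definition vf_bracket ::
  "('p, 'e::real_normed_vector) manifold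
     \<Rightarrow> ('p \<Rightarrow> ('p, 'e) tangent) \<Rightarrow> ('p \<Rightarrow> ('p, 'e) tangent) \<Rightarrow> 'p \<Rightarrow> ('p, 'e) tangent" where
  "vf_bracket M X Y p =
     (\<lambda>c. if c \<in> charts_at M p
          then frechet_derivative (\<lambda>u. Y (chart_inv c u) c) (at (snd c p)) (X p c)
             - frechet_derivative (\<lambda>u. X (chart_inv c u) c) (at (snd c p)) (Y p c)
          else 0)"


section \<open>Lie groups and their Lie algebras\<close>

definition lie_group ::
  "('g, 'm) monoid_scheme \<Rightarrow> ('g, 'e::real_normed_vector) manifold \<Rightarrow> bool" where
  "lie_group G M \<longleftrightarrow>
     group G \<and> smooth_manifold M \<and> topspace (base M) = carrier G \<and>
     smooth_map (prod_manifold M M) M (\<lambda>(a, b). a \<otimes>\<^bsub>G\<^esub> b) \<and>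
     smooth_map M M (\<lambda>a. inv\<^bsub>G\<^esub> a)"

definition lie_alg ::
  "('g, 'm) monoid_scheme \<Rightarrow> ('g, 'e::real_normed_vector) manifold \<Rightarrow> ('g, 'e) tangent set" where
  "lie_alg G M = tangent_space M \<one>\<^bsub>G\<^esub>"

definition left_invariant_field ::
  "('g, 'm) monoid_scheme \<Rightarrow> ('g, 'e::real_normed_vector) manifold
     \<Rightarrow> ('g, 'e) tangent \<Rightarrow> 'g \<Rightarrow> ('g, 'e) tangent" where
  "left_invariant_field G M x g = tangent_map M M (\<lambda>h. g \<otimes>\<^bsub>G\<^esub> h) \<one>\<^bsub>G\<^esub> x"

definition lie_bracket ::
  "('g, 'm) monoid_scheme \<Rightarrow> ('g, 'e::real_normed_vector) manifold
     \<Rightarrow> ('g, 'e) tangent \<Rightarrow> ('g, 'e) tangent \<Rightarrow> ('g, 'e) tangent" where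
  "lie_bracket G M x y =
     vf_bracket M (left_invariant_field G M x) (left_invariant_field G M y) \<one>\<^bsub>G\<^esub>"

definition one_parameter_subgroup ::
  "('g, 'm) monoid_scheme \<Rightarrow> ('g, 'e::real_normed_vector) manifold \<Rightarrow> (real \<Rightarrow> 'g) \<Rightarrow> bool" where
  "one_parameter_subgroup G M \<gamma> \<longleftrightarrow>
     smooth_map real_line M \<gamma> \<and> (\<forall>s t. \<gamma> (s + t) = \<gamma> s \<otimes>\<^bsub>G\<^esub> \<gamma> t)"

definition lie_exp ::
  "('g, 'm) monoid_scheme \<Rightarrow> ('g, 'e::real_normed_vector) manifold \<Rightarrow> ('g, 'e) tangent \<Rightarrow> 'g" where
  "lie_exp G M x =
     (THE \<gamma>. one_parameter_subgroup G M \<gamma> \<and> curve_velocity M \<gamma> 0 = x) 1"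

definition exp_curve ::
  "('g, 'm) monoid_scheme \<Rightarrow> ('g, 'e::real_normed_vector) manifold
     \<Rightarrow> ('g, 'e) tangent \<Rightarrow> real \<Rightarrow> 'g" where
  "exp_curve G M x t = lie_exp G M (\<lambda>c. t *\<^sub>R x c)"


section \<open>Rota-Baxter groups of weight -1\<close>

definition Ad :: "('g, 'm) monoid_scheme \<Rightarrow> 'g \<Rightarrow> 'g \<Rightarrow> 'g" where
  "Ad G a b = a \<otimes>\<^bsub>G\<^esub> b \<otimes>\<^bsub>G\<^esub> inv\<^bsub>G\<^esub> a"

definition rota_baxter_operator :: "('g, 'm) monoid_scheme \<Rightarrow> ('g \<Rightarrow> 'g) \<Rightarrow> bool" where
  "rota_baxter_operator G \<B> \<longleftrightarrow>
     \<B> \<in> carrier G \<rightarrow> carrier G \<and>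
     (\<forall>a\<in>carrier G. \<forall>b\<in>carrier G. \<B> a \<otimes>\<^bsub>G\<^esub> \<B> b = \<B> (Ad G (\<B> a) b \<otimes>\<^bsub>G\<^esub> a))"

definition rota_baxter_lie_group ::
  "('g, 'm) monoid_scheme \<Rightarrow> ('g, 'e::real_normed_vector) manifold \<Rightarrow> ('g \<Rightarrow> 'g) \<Rightarrow> bool" where
  "rota_baxter_lie_group G M \<B> \<longleftrightarrow>
     lie_group G M \<and> rota_baxter_operator G \<B> \<and> smooth_map M M \<B>"

definition grp_tilde :: "('g, 'm) monoid_scheme \<Rightarrow> ('g \<Rightarrow> 'g) \<Rightarrow> 'g \<Rightarrow> 'g" where
  "grp_tilde G \<B> a = a \<otimes>\<^bsub>G\<^esub> \<B> (inv\<^bsub>G\<^esub> a)"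

text \<open>
  The actions of the matched pair of groups on \<open>\<B> ` carrier G\<close> and
  \<open>grp_tilde G \<B> ` carrier G\<close>: \<open>\<rho> (\<B> a) (\<B>~ b) = \<B>~ (Ad (\<B> a) b)\<close> and
  \<open>\<mu> (\<B>~ a) (\<B> b) = \<B> (Ad (\<B>~ a) b)\<close>. They are independent of the preimages, so the
  descriptions are proper on these sets.
\<close>

definition rb_rho :: "('g, 'm) monoid_scheme \<Rightarrow> ('g \<Rightarrow> 'g) \<Rightarrow> 'g \<Rightarrow> 'g \<Rightarrow> 'g" where
  "rb_rho G \<B> u v =
     (THE w. \<exists>a\<in>carrier G. \<exists>b\<in>carrier G.
        u = \<B> a \<and> v = grp_tilde G \<B> b \<and> w = grp_tilde G \<B> (Ad G (\<B> a) b))"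

definition rb_mu :: "('g, 'm) monoid_scheme \<Rightarrow> ('g \<Rightarrow> 'g) \<Rightarrow> 'g \<Rightarrow> 'g \<Rightarrow> 'g" where
  "rb_mu G \<B> v u =
     (THE w. \<exists>a\<in>carrier G. \<exists>b\<in>carrier G.
        v = grp_tilde G \<B> a \<and> u = \<B> b \<and> w = \<B> (Ad G (grp_tilde G \<B> a) b))"


section \<open>The infinitesimal objects\<close>

definition inf_rb ::
  "('g, 'm) monoid_scheme \<Rightarrow> ('g, 'e::real_normed_vector) manifold \<Rightarrow> ('g \<Rightarrow> 'g)
     \<Rightarrow> ('g, 'e) tangent \<Rightarrow> ('g, 'e) tangent" where
  "inf_rb G M \<B> = tangent_map M M \<B> \<one>\<^bsub>G\<^esub>"

definition alg_tilde ::
  "(('g, 'e::real_normed_vector) tangent \<Rightarrow> ('g, 'e) tangent)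
     \<Rightarrow> ('g, 'e) tangent \<Rightarrow> ('g, 'e) tangent" where
  "alg_tilde B x = (\<lambda>c. x c - B x c)"

text \<open>
  The maps obtained by differentiating \<open>\<rho>\<close> and \<open>\<mu>\<close>; as functions of \<open>B x\<close> and \<open>B~ y\<close>
  (respectively \<open>B~ x\<close> and \<open>B y\<close>) they are given by definite description over all preimages, so
  any equation about their values comprises the independence of the preimages.
\<close>

definition inf_rhd ::
  "('g, 'm) monoid_scheme \<Rightarrow> ('g, 'e::real_normed_vector) manifold \<Rightarrow> ('g \<Rightarrow> 'g)
     \<Rightarrow> ('g, 'e) tangent \<Rightarrow> ('g, 'e) tangent \<Rightarrow> ('g, 'e) tangent" where
  "inf_rhd G M \<B> u v =
     (THE w. \<exists>x\<in>lie_alg G M. \<exists>y\<in>lie_alg G M.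
        u = inf_rb G M \<B> x \<and> v = alg_tilde (inf_rb G M \<B>) y \<and>
        w = iterated_velocity M (\<lambda>t s.
              rb_rho G \<B> (\<B> (exp_curve G M x t)) (grp_tilde G \<B> (exp_curve G M y s))))"

definition inf_brhd ::
  "('g, 'm) monoid_scheme \<Rightarrow> ('g, 'e::real_normed_vector) manifold \<Rightarrow> ('g \<Rightarrow> 'g)
     \<Rightarrow> ('g, 'e) tangent \<Rightarrow> ('g, 'e) tangent \<Rightarrow> ('g, 'e) tangent" where
  "inf_brhd G M \<B> v u =
     (THE w. \<exists>x\<in>lie_alg G M. \<exists>y\<in>lie_alg G M.
        v = alg_tilde (inf_rb G M \<B>) x \<and> u = inf_rb G M \<B> y \<and>
        w = iterated_velocity M (\<lambda>t s.
              rb_mu G \<B> (grp_tilde G \<B> (exp_curve G M x t)) (\<B> (exp_curve G M y s))))"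

text \<open>
  The matched pair of Lie algebras on a Rota-Baxter Lie algebra with carrier \<open>\<gg>\<close>, bracket
  \<open>br\<close> and operator \<open>B\<close>.
\<close>

definition is_rb_lie_matched_pair ::
  "('g, 'e::real_normed_vector) tangent set
     \<Rightarrow> (('g, 'e) tangent \<Rightarrow> ('g, 'e) tangent \<Rightarrow> ('g, 'e) tangent)
     \<Rightarrow> (('g, 'e) tangent \<Rightarrow> ('g, 'e) tangent)
     \<Rightarrow> ('g, 'e) tangent set \<Rightarrow> ('g, 'e) tangent set
     \<Rightarrow> (('g, 'e) tangent \<Rightarrow> ('g, 'e) tangent \<Rightarrow> ('g, 'e) tangent)
     \<Rightarrow> (('g, 'e) tangent \<Rightarrow> ('g, 'e) tangent \<Rightarrow> ('g, 'e) tangent) \<Rightarrow> bool" where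
  "is_rb_lie_matched_pair \<gg> br B gp gm rhd brhd \<longleftrightarrow>
     gp = B ` \<gg> \<and> gm = alg_tilde B ` \<gg> \<and>
     rhd \<in> gp \<rightarrow> gm \<rightarrow> gm \<and> brhd \<in> gm \<rightarrow> gp \<rightarrow> gp \<and>
     (\<forall>x\<in>\<gg>. \<forall>y\<in>\<gg>. rhd (B x) (alg_tilde B y) = alg_tilde B (br (B x) y)) \<and>
     (\<forall>x\<in>\<gg>. \<forall>y\<in>\<gg>. brhd (alg_tilde B x) (B y) = B (br (alg_tilde B x) y))"

end

theory Submission
  imports Defs
begin

text \<open>
  Write \<open>B\<close> for the tangent map of \<open>\<B>\<close> at the identity and \<open>B~\<close> for that of \<open>\<B>~\<close>. As
  \<open>\<rho> (\<B> a) (\<B>~ b) = \<B>~ (Ad (\<B> a) b)\<close>, the inner derivative of the family that defines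
  \<open>B x \<rhd> B~ y\<close> is \<open>B~ (Ad (\<B> (exp (t x))) y)\<close>. Since \<open>t \<mapsto> \<B> (exp (t x))\<close> is a curve through the
  identity with velocity \<open>B x\<close>, and the derivative of the adjoint representation is the bracket, the
  outer derivative is \<open>B~ [B x, y]\<close>. Finally \<open>B~ = id - B\<close>, because \<open>\<B>~ a = a \<B> (a\<^sup>-\<^sup>1)\<close>, the derivative
  of a product at the identity is the sum of the derivatives, and that of the inversion is \<open>-id\<close>.

  The second action is an instance of the first: \<open>\<B>~\<close> is again a Rota-Baxter operator, with
  \<open>\<B>~~ = \<B>\<close>, and \<open>\<mu>\<close> is the map \<open>\<rho>\<close> of \<open>\<B>~\<close> (\<open>tilde_rota_baxter\<close>, \<open>rb_mu_eq_rho\<close>).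
  For this duality the argument is carried out for Rota-Baxter operators that are merely
  differentiable at every point, a property that passes from \<open>\<B>\<close> to \<open>\<B>~\<close> by the chain rule.

  Three points need work.

  First, independence of the preimages. The value \<open>B~ [B x, y]\<close> visibly depends on \<open>x\<close> only through
  \<open>B x\<close>. For \<open>y\<close> the group identity \<open>tilde_Ad\<close> is used: it writes \<open>\<B>~ (Ad (\<B> a) b)\<close> as an
  expression built by products, inversion and \<open>\<B>~\<close> from \<open>a\<close> and \<open>\<B>~ b\<close> alone. Hence for fixed \<open>a\<close>
  the velocity of \<open>s \<mapsto> \<B>~ (Ad (\<B> a) (exp (s y)))\<close> depends only on that of
  \<open>s \<mapsto> \<B>~ (exp (s y))\<close>, which is \<open>B~ y\<close> (\<open>bracket_action_well_defined\<close>). The same identity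
  gives the independence of preimages of \<open>\<rho>\<close> itself.

  Second, the exponential map is a definite description, so one-parameter subgroups have to be
  constructed and shown to be unique (\<open>exp_curve_one_parameter_subgroup\<close>). In a chart they are
  integral curves of left-invariant fields; Picard iteration gives a short integral curve, uniqueness
  makes it additive for small times, and \<open>\<gamma> (t / n) ^ n\<close> extends it to the real line.

  Third, the derivative of the adjoint representation is computed in a chart, where the bracket of
  left-invariant fields is a difference of second derivatives of the multiplication; the calculation
  uses the symmetry of second derivatives (\<open>conjugation_derivative\<close>).
\<close>

section \<open>Finite-dimensional normed spaces\<close>

text \<open>
  If coefficients are controlled by the norm, a convergent sequence in the span has Cauchy
  coefficients, and their limits give the limit of the sequence.
\<close>
lemma bounded_coefficients_imp_closed_span:
  fixes B :: "'e::banach set"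
  assumes "finite B" and C: "\<And>c b. b \<in> B \<Longrightarrow> \<bar>c b\<bar> \<le> C * norm (\<Sum>b\<in>B. c b *\<^sub>R b)"
  shows "closed (span B)"
  unfolding closed_sequential_limits
proof (intro allI impI, elim conjE)
  fix x l assume x: "\<forall>n. x n \<in> span B" and l: "x \<longlonglongrightarrow> l"
  have "\<forall>n. \<exists>c. x n = (\<Sum>b\<in>B. c b *\<^sub>R b)"
    using x span_finite[OF \<open>finite B\<close>] by auto
  then obtain c where c: "\<And>n. x n = (\<Sum>b\<in>B. c n b *\<^sub>R b)" by metis
  have "\<exists>L. (\<lambda>n. c n b) \<longlonglongrightarrow> L" if "b \<in> B" for b
  proof -
    have "Cauchy (\<lambda>n. c n b)"
    proof (rule metric_CauchyI)
      fix e :: real assume "e > 0"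
      have "e / (\<bar>C\<bar> + 1) > 0" using \<open>e > 0\<close> by simp
      then obtain N where N: "\<And>m n. m \<ge> N \<Longrightarrow> n \<ge> N \<Longrightarrow> dist (x m) (x n) < e / (\<bar>C\<bar> + 1)"
        using LIMSEQ_imp_Cauchy[OF l] unfolding Cauchy_def by metis
      have "dist (c m b) (c n b) < e" if "m \<ge> N" "n \<ge> N" for m n
      proof -
        have "\<bar>c m b - c n b\<bar> \<le> C * norm (x m - x n)"
          using C[OF \<open>b \<in> B\<close>, of "\<lambda>b. c m b - c n b"]
          by (simp add: c algebra_simps sum_subtractf)
        also have "\<dots> \<le> (\<bar>C\<bar> + 1) * norm (x m - x n)"
          by (intro mult_right_mono) auto
        also have "\<dots> < e"
          using N[OF that] by (simp add: dist_norm pos_less_divide_eq mult.commute)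
        finally show ?thesis by (simp add: dist_real_def)
      qed
      then show "\<exists>M. \<forall>m\<ge>M. \<forall>n\<ge>M. dist (c m b) (c n b) < e" by blast
    qed
    then show ?thesis using Cauchy_convergent convergent_def by blast
  qed
  then obtain L where L: "\<And>b. b \<in> B \<Longrightarrow> (\<lambda>n. c n b) \<longlonglongrightarrow> L b" by metis
  have "x \<longlonglongrightarrow> (\<Sum>b\<in>B. L b *\<^sub>R b)"
    unfolding c[abs_def] by (intro tendsto_sum tendsto_scaleR L tendsto_const)
  with l have l_eq: "l = (\<Sum>b\<in>B. L b *\<^sub>R b)" using LIMSEQ_unique by blast
  show "l \<in> span B" unfolding l_eq by (intro span_sum span_scale span_base)
qed

text \<open>
  Linear functionals on a finite-dimensional normed space are continuous. The induction over a basis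
  alternates with the closedness of spans: a new basis vector \<open>a\<close> has positive distance \<open>d\<close> from the
  closed span of the others, so its coefficient is at most the norm divided by \<open>d\<close>.
\<close>
lemma bounded_coefficients:
  fixes B :: "'e::banach set"
  assumes "finite B" "independent B"
  shows "\<exists>C. \<forall>c. \<forall>b\<in>B. \<bar>c b\<bar> \<le> C * norm (\<Sum>b\<in>B. c b *\<^sub>R b)"
  using assms
proof (induction B)
  case empty
  then show ?case by simp
next
  case (insert a B)
  have indep: "independent B" and a: "a \<notin> span B"
    using insert by (auto simp: independent_insert)
  then obtain C where C: "\<And>c b. b \<in> B \<Longrightarrow> \<bar>c b\<bar> \<le> C * norm (\<Sum>b\<in>B. c b *\<^sub>R b)"
    using insert.IH by blast
  define d where "d = infdist a (span B)"
  have "closed (span B)"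
    using bounded_coefficients_imp_closed_span[OF insert.hyps(1) C] .
  then have "d > 0"
    using a in_closed_iff_infdist_zero[of "span B" a] infdist_nonneg[of a "span B"] span_zero[of B]
    unfolding d_def by fastforce
  have ca: "\<bar>r\<bar> * d \<le> norm (r *\<^sub>R a + w)" if "w \<in> span B" for r w
  proof (cases "r = 0")
    case False
    have "- (1 / r) *\<^sub>R w \<in> span B" using that by (rule span_scale)
    then have "d \<le> dist a (- (1 / r) *\<^sub>R w)" unfolding d_def by (rule infdist_le)
    also have "\<dots> = norm (a + (1 / r) *\<^sub>R w)" by (simp add: dist_norm)
    finally have "\<bar>r\<bar> * d \<le> \<bar>r\<bar> * norm (a + (1 / r) *\<^sub>R w)" by (rule mult_left_mono) simp
    also have "\<dots> = norm (r *\<^sub>R (a + (1 / r) *\<^sub>R w))" by simp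
    also have "r *\<^sub>R (a + (1 / r) *\<^sub>R w) = r *\<^sub>R a + w" using False by (simp add: algebra_simps)
    finally show ?thesis .
  qed simp
  define K where "K = 1 / d + \<bar>C\<bar> * (1 + norm a / d)"
  show ?case
  proof (intro exI allI ballI)
    fix c b assume b: "b \<in> insert a B"
    let ?w = "\<Sum>b\<in>B. c b *\<^sub>R b"
    let ?v = "\<Sum>b\<in>insert a B. c b *\<^sub>R b"
    have v: "?v = c a *\<^sub>R a + ?w" using insert.hyps by simp
    have "?w \<in> span B" by (intro span_sum span_scale span_base)
    from ca[OF this, of "c a"] have 1: "\<bar>c a\<bar> \<le> norm ?v / d"
      unfolding v using \<open>d > 0\<close> by (simp add: pos_le_divide_eq)
    have "norm ?w = norm (?v - c a *\<^sub>R a)" unfolding v by simp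
    also have "\<dots> \<le> norm ?v + \<bar>c a\<bar> * norm a" by (metis norm_scaleR norm_triangle_ineq4)
    also have "\<dots> \<le> norm ?v + norm ?v / d * norm a" using 1 by (intro add_left_mono mult_right_mono) auto
    finally have 2: "norm ?w \<le> (1 + norm a / d) * norm ?v" by (simp add: algebra_simps)
    show "\<bar>c b\<bar> \<le> K * norm ?v"
    proof (cases "b = a")
      case True
      have "norm ?v / d \<le> K * norm ?v"
        unfolding K_def using \<open>d > 0\<close> by (simp add: algebra_simps)
      with 1 show ?thesis unfolding True by linarith
    next
      case False
      then have "\<bar>c b\<bar> \<le> C * norm ?w" using b C by blast
      also have "\<dots> \<le> \<bar>C\<bar> * norm ?w" by (intro mult_right_mono) auto
      also have "\<dots> \<le> \<bar>C\<bar> * ((1 + norm a / d) * norm ?v)" by (intro mult_left_mono 2) auto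
      also have "\<dots> \<le> K * norm ?v" unfolding K_def using \<open>d > 0\<close> by (simp add: algebra_simps)
      finally show ?thesis .
    qed
  qed
qed

text \<open>
  Model spaces carry no inner product and may have dimension 0, so that the class
  \<open>euclidean_space\<close> and its theory of linear maps do not apply to them.
\<close>
definition finite_dim :: "'e::real_normed_vector itself \<Rightarrow> bool" where
  "finite_dim _ \<longleftrightarrow> (\<exists>S :: 'e set. finite S \<and> span S = UNIV)"

lemma finite_dim_coordinates:
  assumes "finite_dim TYPE('e::banach)"
  obtains B :: "'e::banach set" and k :: "'e::banach \<Rightarrow> 'e \<Rightarrow> real"
  where "finite B" "\<And>b. b \<in> B \<Longrightarrow> bounded_linear (k b)" "\<And>v. (\<Sum>b\<in>B. k b v *\<^sub>R b) = v"
proof -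
  obtain S :: "'e set" where S: "finite S" "span S = UNIV"
    using assms unfolding finite_dim_def by auto
  obtain B where B: "B \<subseteq> S" "independent B" "S \<subseteq> span B"
    using maximal_independent_subset[of S] by blast
  have spB: "span B = UNIV" using span_minimal[OF B(3) subspace_span] S by blast
  have fin: "finite B" using B S finite_subset by blast
  define k where "k b v = representation B v b" for b v
  have rep: "(\<Sum>b\<in>B. k b v *\<^sub>R b) = v" for v
    unfolding k_def using B spB fin by (intro real_vector.sum_representation_eq) auto
  obtain C where C: "\<And>c b. b \<in> B \<Longrightarrow> \<bar>c b\<bar> \<le> C * norm (\<Sum>b\<in>B. c b *\<^sub>R b)"
    using bounded_coefficients[OF fin B(2)] by blast
  have "bounded_linear (k b)" if "b \<in> B" for b
  proof (rule bounded_linear_intro)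
    show "k b (x + y) = k b x + k b y" "k b (r *\<^sub>R x) = r *\<^sub>R k b x" for x y r
      unfolding k_def using B spB
      by (simp_all add: real_vector.representation_add real_vector.representation_scale)
    show "norm (k b x) \<le> norm x * C" for x
      using C[OF that, of "\<lambda>b. k b x"] by (simp add: rep mult.commute)
  qed
  then show ?thesis using that fin rep by blast
qed

lemma linear_expand:
  assumes rep: "\<And>v. (\<Sum>b\<in>B. k b v *\<^sub>R b) = v" and L: "linear L"
  shows "L v = (\<Sum>b\<in>B. k b v *\<^sub>R L b)"
  by (subst rep[symmetric, of v]) (simp add: linear_sum[OF L] linear_scale[OF L] o_def)

lemma bounded_linear_frechet:
  "f differentiable (at x) \<Longrightarrow> bounded_linear (frechet_derivative f (at x))"
  using frechet_derivative_works has_derivative_bounded_linear by blast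

lemma has_derivative_frechet:
  "f differentiable (at x) \<Longrightarrow> (f has_derivative frechet_derivative f (at x)) (at x)"
  by (simp add: frechet_derivative_works)

lemma frechetI: "(f has_derivative D) (at x) \<Longrightarrow> frechet_derivative f (at x) = D"
  by (metis frechet_derivative_at)

text \<open>
  The product rule for applying a curve of linear maps to a curve of vectors. In finite dimension it
  is enough that the curve of maps is differentiable pointwise, as the vector can be expanded in a
  basis.
\<close>
lemma has_vector_derivative_family_apply:
  fixes F :: "real \<Rightarrow> 'e::banach \<Rightarrow> 'b::real_normed_vector"
  assumes fd: "finite_dim TYPE('e)"
    and lin: "\<forall>\<^sub>F t in nhds t0. linear (F t)" and linF': "linear F'"
    and F: "\<And>v. ((\<lambda>t. F t v) has_vector_derivative F' v) (at t0)"
    and w: "(w has_vector_derivative w') (at t0)"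
  shows "((\<lambda>t. F t (w t)) has_vector_derivative F' (w t0) + F t0 w') (at t0)"
proof -
  obtain B :: "'e set" and k where B: "finite B" "\<And>b. b \<in> B \<Longrightarrow> bounded_linear (k b)"
      and rep: "\<And>v. (\<Sum>b\<in>B. k b v *\<^sub>R b) = v"
    using finite_dim_coordinates[OF fd] by metis
  note expand = linear_expand[OF rep]
  have "linear (F t0)" using lin by (rule eventually_nhds_x_imp_x)
  have "((\<lambda>t. \<Sum>b\<in>B. k b (w t) *\<^sub>R F t b) has_vector_derivative
        (\<Sum>b\<in>B. k b (w t0) *\<^sub>R F' b + k b w' *\<^sub>R F t0 b)) (at t0)"
    by (intro has_vector_derivative_sum has_vector_derivative_scaleR F
        bounded_linear.has_vector_derivative[OF B(2) w, THEN has_real_derivative_iff_has_vector_derivative[THEN iffD2]])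
  also have "(\<Sum>b\<in>B. k b (w t0) *\<^sub>R F' b + k b w' *\<^sub>R F t0 b) = F' (w t0) + F t0 w'"
    by (simp add: sum.distrib expand[OF linF', of "w t0"] expand[OF \<open>linear (F t0)\<close>, of w'])
  finally have *: "((\<lambda>t. \<Sum>b\<in>B. k b (w t) *\<^sub>R F t b) has_vector_derivative F' (w t0) + F t0 w') (at t0)" .
  obtain S where S: "open S" "t0 \<in> S" "\<And>t. t \<in> S \<Longrightarrow> linear (F t)"
    using lin unfolding eventually_nhds by blast
  show ?thesis
    using has_vector_derivative_transform_within_open[OF * S(1,2)] expand[OF S(3)] by metis
qed

section \<open>Calculus of iterated directional derivatives\<close>

lemma Ck_on_imp_continuous_on: "Ck_on n S f \<Longrightarrow> continuous_on S f"
  by (cases n) (auto intro: differentiable_imp_continuous_on simp: differentiable_on_def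
    intro!: continuous_at_imp_continuous_on differentiable_imp_continuous_within)

lemma Ck_on_SucD: "Ck_on (Suc n) S f \<Longrightarrow> Ck_on n S f"
proof (induction n arbitrary: f)
  case 0
  then show ?case using Ck_on_imp_continuous_on[of "Suc 0" S f] by simp
qed auto

lemma Ck_on_cong:
  assumes "open S" "Ck_on n S f" "\<And>x. x \<in> S \<Longrightarrow> f x = g x"
  shows "Ck_on n S g"
  using assms(2,3)
proof (induction n arbitrary: f g)
  case 0
  then show ?case using continuous_on_cong by force
next
  case (Suc n)
  have eq: "frechet_derivative f (at x) = frechet_derivative g (at x)" if "x \<in> S" for x
    using frechet_derivative_transform_within_open[OF _ assms(1) that, of f g] Suc.prems that by auto
  have "g differentiable at x" if "x \<in> S" for x
  proof -
    have "(f has_derivative frechet_derivative f (at x)) (at x)"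
      using Suc.prems(1) that by (auto intro: has_derivative_frechet)
    then have "(g has_derivative frechet_derivative f (at x)) (at x)"
      by (rule has_derivative_transform_within_open[OF _ assms(1) that]) (rule Suc.prems(2))
    then show ?thesis unfolding differentiable_def by blast
  qed
  moreover have "Ck_on n S (\<lambda>x. frechet_derivative g (at x) v)" for v
    using Suc.IH[of "\<lambda>x. frechet_derivative f (at x) v"] Suc.prems(1) eq by auto
  ultimately show ?case by simp
qed

lemma Ck_on_local:
  assumes "\<And>x. x \<in> S \<Longrightarrow> \<exists>T. open T \<and> x \<in> T \<and> Ck_on n T f"
  shows "Ck_on n S f"
  using assms
proof (induction n arbitrary: f)
  case 0
  then show ?case
    by (auto intro!: continuous_at_imp_continuous_on) (metis continuous_on_eq_continuous_at)
next
  case (Suc n)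
  then show ?case by simp (meson)
qed

lemma Ck_on_const: "Ck_on n S (\<lambda>x. c)"
proof (induction n arbitrary: c)
  case (Suc n)
  have "frechet_derivative (\<lambda>x. c) (at x) = (\<lambda>_. 0)" for x :: 'a
    by (intro frechetI) (auto intro: derivative_eq_intros)
  with Suc show ?case by simp
qed auto

lemma Ck_on_add:
  assumes "open S" "Ck_on n S f" "Ck_on n S g"
  shows "Ck_on n S (\<lambda>x. f x + g x)"
  using assms(2,3)
proof (induction n arbitrary: f g)
  case 0
  then show ?case by (simp add: continuous_on_add)
next
  case (Suc n)
  have "Ck_on n S (\<lambda>x. frechet_derivative (\<lambda>x. f x + g x) (at x) v)" for v
  proof (rule Ck_on_cong[OF assms(1) Suc.IH])
    show "Ck_on n S (\<lambda>x. frechet_derivative f (at x) v)" "Ck_on n S (\<lambda>x. frechet_derivative g (at x) v)"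
      using Suc.prems by auto
    show "frechet_derivative f (at x) v + frechet_derivative g (at x) v
        = frechet_derivative (\<lambda>x. f x + g x) (at x) v" if "x \<in> S" for x
      using Suc.prems that
      by (subst frechetI[where D = "\<lambda>v. frechet_derivative f (at x) v + frechet_derivative g (at x) v"])
        (auto intro!: has_derivative_add has_derivative_frechet)
  qed
  then show ?case using Suc.prems by (auto intro: differentiable_add)
qed

lemma Ck_on_sum:
  assumes "open S" "\<And>i. i \<in> I \<Longrightarrow> Ck_on n S (f i)"
  shows "Ck_on n S (\<lambda>x. \<Sum>i\<in>I. f i x)"
  using assms(2)
  by (induction I rule: infinite_finite_induct) (auto intro!: Ck_on_add Ck_on_const assms(1))

lemma Ck_on_scaleR:
  assumes "open S" "Ck_on n S f" "Ck_on n S g"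
  shows "Ck_on n S (\<lambda>x. f x *\<^sub>R g x)"
  using assms(2,3)
proof (induction n arbitrary: f g)
  case 0
  then show ?case by (simp add: continuous_on_scaleR)
next
  case (Suc n)
  let ?D = "\<lambda>x v. f x *\<^sub>R frechet_derivative g (at x) v + frechet_derivative f (at x) v *\<^sub>R g x"
  have D: "((\<lambda>x. f x *\<^sub>R g x) has_derivative ?D x) (at x)" if "x \<in> S" for x
    using Suc.prems that by (auto intro!: has_derivative_scaleR has_derivative_frechet)
  have "Ck_on n S (\<lambda>x. frechet_derivative (\<lambda>x. f x *\<^sub>R g x) (at x) v)" for v
  proof (rule Ck_on_cong[OF assms(1)])
    show "Ck_on n S (\<lambda>x. ?D x v)"
      using Suc.prems by (intro Ck_on_add Suc.IH assms(1)) (auto intro: Ck_on_SucD)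
    show "?D x v = frechet_derivative (\<lambda>x. f x *\<^sub>R g x) (at x) v" if "x \<in> S" for x
      by (simp add: frechetI[OF D[OF that]])
  qed
  moreover have "(\<lambda>x. f x *\<^sub>R g x) differentiable at x" if "x \<in> S" for x
    using D[OF that] differentiable_def by blast
  ultimately show ?case by simp
qed

lemma Ck_on_bounded_linear:
  assumes "open S" "bounded_linear L" "Ck_on n S f"
  shows "Ck_on n S (\<lambda>x. L (f x))"
  using assms(3)
proof (induction n arbitrary: f)
  case 0
  then show ?case by (simp add: bounded_linear.continuous_on[OF assms(2)])
next
  case (Suc n)
  have D: "((\<lambda>x. L (f x)) has_derivative (\<lambda>v. L (frechet_derivative f (at x) v))) (at x)" if "x \<in> S" for x
    using Suc.prems that by (auto intro!: bounded_linear.has_derivative[OF assms(2)] has_derivative_frechet)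
  have "Ck_on n S (\<lambda>x. frechet_derivative (\<lambda>x. L (f x)) (at x) v)" for v
  proof (rule Ck_on_cong[OF assms(1)])
    show "Ck_on n S (\<lambda>x. L (frechet_derivative f (at x) v))"
      using Suc.prems by (intro Suc.IH) auto
  qed (simp add: frechetI[OF D])
  moreover have "(\<lambda>x. L (f x)) differentiable at x" if "x \<in> S" for x
    using D[OF that] differentiable_def by blast
  ultimately show ?case by simp
qed

lemma Ck_on_compose_affine:
  assumes "open S" "bounded_linear L" "Ck_on n T f" "\<And>x. x \<in> S \<Longrightarrow> p + L x \<in> T"
  shows "Ck_on n S (\<lambda>x. f (p + L x))"
  using assms(3)
proof (induction n arbitrary: f)
  case 0
  then show ?case using assms(2,4)
    by (auto intro!: continuous_on_compose2[of T f] continuous_on_add continuous_on_const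
        bounded_linear.continuous_on[OF assms(2)] continuous_on_id)
next
  case (Suc n)
  have D: "((\<lambda>x. f (p + L x)) has_derivative (\<lambda>v. frechet_derivative f (at (p + L x)) (L v))) (at x)"
    if "x \<in> S" for x
  proof (rule has_derivative_compose[where f = "\<lambda>x. p + L x" and g = f and f' = L])
    show "((\<lambda>x. p + L x) has_derivative L) (at x)"
      using has_derivative_add[OF has_derivative_const bounded_linear_imp_has_derivative[OF assms(2)]] by simp
    show "(f has_derivative frechet_derivative f (at (p + L x))) (at (p + L x))"
      using Suc.prems assms(4)[OF that] by (auto intro!: has_derivative_frechet)
  qed
  have "Ck_on n S (\<lambda>x. frechet_derivative (\<lambda>x. f (p + L x)) (at x) v)" for v
  proof (rule Ck_on_cong[OF assms(1)])
    show "Ck_on n S (\<lambda>x. frechet_derivative f (at (p + L x)) (L v))"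
      using Suc.prems by (intro Suc.IH) auto
  qed (simp add: frechetI[OF D])
  moreover have "(\<lambda>x. f (p + L x)) differentiable at x" if "x \<in> S" for x
    using D[OF that] differentiable_def by blast
  ultimately show ?case by simp
qed

text \<open>
  Directional derivatives of \<open>g \<circ> f\<close> differentiate \<open>g\<close> in the varying direction \<open>f' x v\<close>. Expanding
  this direction in a basis reduces them to derivatives of \<open>g\<close> in fixed directions, to which the
  induction hypothesis applies.
\<close>
lemma Ck_on_compose:
  fixes f :: "'a::real_normed_vector \<Rightarrow> 'e::banach" and g :: "'e \<Rightarrow> 'b::real_normed_vector"
  assumes fd: "finite_dim TYPE('e)" and S: "open S" and "Ck_on n T g" "Ck_on n S f"
    and sub: "\<And>x. x \<in> S \<Longrightarrow> f x \<in> T"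
  shows "Ck_on n S (\<lambda>x. g (f x))"
  using assms(3,4)
proof (induction n arbitrary: g)
  case 0
  then show ?case using sub by (auto intro!: continuous_on_compose2[of T g])
next
  case (Suc n)
  obtain B :: "'e set" and k where B: "finite B" "\<And>b. b \<in> B \<Longrightarrow> bounded_linear (k b)"
      and rep: "\<And>v. (\<Sum>b\<in>B. k b v *\<^sub>R b) = v"
    using finite_dim_coordinates[OF fd] by metis
  note expand = linear_expand[OF rep]
  let ?f' = "\<lambda>x. frechet_derivative f (at x)"
  let ?g' = "\<lambda>y. frechet_derivative g (at y)"
  have g: "g differentiable at (f x)" if "x \<in> S" for x using Suc.prems that sub by auto
  have D: "((\<lambda>x. g (f x)) has_derivative (\<lambda>v. ?g' (f x) (?f' x v))) (at x)" if "x \<in> S" for x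
    by (rule has_derivative_compose[where f = f and g = g and f' = "?f' x"])
      (use Suc.prems that sub in \<open>auto intro!: has_derivative_frechet\<close>)
  have "Ck_on n S (\<lambda>x. frechet_derivative (\<lambda>x. g (f x)) (at x) v)" for v
  proof (rule Ck_on_cong[OF S])
    show "Ck_on n S (\<lambda>x. \<Sum>b\<in>B. k b (?f' x v) *\<^sub>R ?g' (f x) b)"
    proof (intro Ck_on_sum[OF S] Ck_on_scaleR[OF S])
      show "Ck_on n S (\<lambda>x. k b (?f' x v))" if "b \<in> B" for b
        by (rule Ck_on_bounded_linear[OF S B(2)[OF that]]) (use Suc.prems in auto)
      show "Ck_on n S (\<lambda>x. ?g' (f x) b)" for b
        by (rule Suc.IH) (use Suc.prems Ck_on_SucD[OF Suc.prems(2)] in auto)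
    qed
    show "(\<Sum>b\<in>B. k b (?f' x v) *\<^sub>R ?g' (f x) b) = frechet_derivative (\<lambda>x. g (f x)) (at x) v"
      if "x \<in> S" for x
      unfolding frechetI[OF D[OF that]]
      by (rule expand[OF bounded_linear.linear[OF bounded_linear_frechet[OF g[OF that]]], symmetric])
  qed
  moreover have "(\<lambda>x. g (f x)) differentiable at x" if "x \<in> S" for x
    using D[OF that] differentiable_def by blast
  ultimately show ?case by simp
qed

text \<open>
  Continuity of the partial derivatives along a basis bounds the operator norm of the derivative near
  \<open>u\<close>.
\<close>
lemma Ck_on_1_locally_Lipschitz:
  fixes f :: "'e::banach \<Rightarrow> 'b::real_normed_vector"
  assumes fd: "finite_dim TYPE('e)" and U: "open U" "u \<in> U" and f: "Ck_on 1 U f"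
  obtains r L where "r > 0" "L \<ge> 0" "cball u r \<subseteq> U"
    "\<And>x y. x \<in> cball u r \<Longrightarrow> y \<in> cball u r \<Longrightarrow> norm (f x - f y) \<le> L * norm (x - y)"
proof -
  obtain B :: "'e set" and k where B: "finite B" "\<And>b. b \<in> B \<Longrightarrow> bounded_linear (k b)"
      and rep: "\<And>v. (\<Sum>b\<in>B. k b v *\<^sub>R b) = v"
    using finite_dim_coordinates[OF fd] by metis
  note expand = linear_expand[OF rep]
  let ?f' = "\<lambda>x. frechet_derivative f (at x)"
  have diff: "f differentiable at x" if "x \<in> U" for x using f that by simp
  have "\<forall>\<^sub>F x in nhds u. norm (?f' x b) < norm (?f' u b) + 1" for b
  proof -
    have "isCont (\<lambda>x. ?f' x b) u" using f U by (simp add: continuous_on_eq_continuous_at)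
    then have "isCont (\<lambda>x. norm (?f' x b)) u" by (rule continuous_norm)
    from order_tendstoD(2)[OF this[unfolded isCont_def], of "norm (?f' u b) + 1"]
    show ?thesis by (simp add: eventually_nhds_conv_at)
  qed
  then have "\<forall>\<^sub>F x in nhds u. x \<in> U \<and> (\<forall>b\<in>B. norm (?f' x b) < norm (?f' u b) + 1)"
    using B(1) U by (simp add: eventually_conj_iff eventually_ball_finite_distrib eventually_nhds_in_open)
  then obtain d where d: "d > 0"
      "\<And>x. dist x u < d \<Longrightarrow> x \<in> U \<and> (\<forall>b\<in>B. norm (?f' x b) < norm (?f' u b) + 1)"
    unfolding eventually_nhds_metric by blast
  define L where "L = (\<Sum>b\<in>B. onorm (k b) * (norm (?f' u b) + 1))"
  have ball: "dist x u < d" if "x \<in> cball u (d / 2)" for x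
    using that d(1) by (simp add: dist_commute)
  have "L \<ge> 0" unfolding L_def by (intro sum_nonneg mult_nonneg_nonneg onorm_pos_le B) auto
  have on: "onorm (?f' x) \<le> L" if "x \<in> cball u (d / 2)" for x
  proof (rule onorm_bound[OF \<open>L \<ge> 0\<close>])
    fix v
    have lin: "linear (?f' x)"
      using bounded_linear.linear[OF bounded_linear_frechet] diff d(2) ball[OF that] by blast
    have "norm (?f' x v) = norm (\<Sum>b\<in>B. k b v *\<^sub>R ?f' x b)" using expand[OF lin, of v] by simp
    also have "\<dots> \<le> (\<Sum>b\<in>B. norm (k b v *\<^sub>R ?f' x b))" by (rule norm_sum)
    also have "\<dots> = (\<Sum>b\<in>B. \<bar>k b v\<bar> * norm (?f' x b))" by simp
    finally have "norm (?f' x v) \<le> \<dots>" .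
    also have "\<dots> \<le> (\<Sum>b\<in>B. (onorm (k b) * norm v) * (norm (?f' u b) + 1))"
    proof (intro sum_mono mult_mono)
      show "\<bar>k b v\<bar> \<le> onorm (k b) * norm v" if "b \<in> B" for b
        using onorm[OF B(2)[OF that], of v] by simp
      show "norm (?f' x b) \<le> norm (?f' u b) + 1" if "b \<in> B" for b
        using d(2)[OF ball[OF \<open>x \<in> cball u (d / 2)\<close>]] that by (meson less_imp_le)
      show "0 \<le> onorm (k b) * norm v" if "b \<in> B" for b
        using onorm_pos_le[OF B(2)[OF that]] by simp
    qed simp
    also have "\<dots> = L * norm v" unfolding L_def sum_distrib_right by (simp add: algebra_simps)
    finally show "norm (?f' x v) \<le> L * norm v" .
  qed
  have "norm (f x - f y) \<le> L * norm (x - y)" if "x \<in> cball u (d / 2)" "y \<in> cball u (d / 2)" for x y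
    using that on diff d(2) ball
    by (intro differentiable_bound[of "cball u (d / 2)" f ?f'])
      (auto intro!: has_derivative_at_withinI[OF has_derivative_frechet])
  moreover have "cball u (d / 2) \<subseteq> U" using d(2) ball by blast
  ultimately show ?thesis using that[of "d / 2" L] d(1) \<open>L \<ge> 0\<close> by simp
qed

lemma has_vector_derivative_along_line:
  assumes "f differentiable at (q + s *\<^sub>R v)"
  shows "((\<lambda>s. f (q + s *\<^sub>R v)) has_vector_derivative frechet_derivative f (at (q + s *\<^sub>R v)) v) (at s within S)"
proof -
  have "((\<lambda>s. q + s *\<^sub>R v) has_vector_derivative v) (at s)"
    unfolding has_vector_derivative_def by (auto intro!: derivative_eq_intros)
  from vector_derivative_diff_chain_within[OF this has_derivative_at_withinI[OF has_derivative_frechet[OF assms]]]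
  show ?thesis by (simp add: o_def has_vector_derivative_at_within)
qed

text \<open>
  Integrating the derivative in direction \<open>w\<close> recovers the increments of \<open>f\<close> along \<open>w\<close>; differentiating
  under this integral in direction \<open>v\<close>, and then at the upper limit of the integral, takes the two
  derivatives in the other order. As the argument works with integrals, it covers functions with values
  in any Banach space.
\<close>
lemma second_derivative_symmetric:
  fixes f :: "'a::real_normed_vector \<Rightarrow> 'b::banach"
  assumes U: "open U" "p \<in> U" and f: "Ck_on 2 U f"
  shows "frechet_derivative (\<lambda>x. frechet_derivative f (at x) v) (at p) w
       = frechet_derivative (\<lambda>x. frechet_derivative f (at x) w) (at p) v"
proof -
  let ?D = "\<lambda>v x. frechet_derivative f (at x) v"
  let ?E = "\<lambda>x. frechet_derivative (?D w) (at x) v"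
  have C2: "Ck_on (Suc (Suc 0)) U f" using f by (simp add: numeral_2_eq_2)
  have d1: "f differentiable at x" and d2: "?D v differentiable at x" if "x \<in> U" for x v
    using C2 that by auto
  have contE: "continuous_on U ?E" and contD: "continuous_on U (?D v)" for v
    using C2 Ck_on_imp_continuous_on[of "Suc 0" U "?D v"] by auto
  obtain r where r: "r > 0" "ball p r \<subseteq> U" using U open_contains_ball by blast
  define N where "N = norm v + norm w + 1"
  define d where "d = r / (2 * N)"
  have pos: "N > 0" unfolding N_def by (intro add_nonneg_pos add_nonneg_nonneg) auto
  then have "d > 0" unfolding d_def using r by simp
  have inU: "p + s *\<^sub>R v + t *\<^sub>R w \<in> U" if "\<bar>s\<bar> \<le> d" "\<bar>t\<bar> \<le> d" for s t
  proof -
    have "norm (s *\<^sub>R v + t *\<^sub>R w) \<le> \<bar>s\<bar> * norm v + \<bar>t\<bar> * norm w"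
      using norm_triangle_ineq[of "s *\<^sub>R v" "t *\<^sub>R w"] by simp
    also have "\<dots> \<le> d * norm v + d * norm w" using that by (intro add_mono mult_right_mono) auto
    also have "\<dots> \<le> d * N" unfolding N_def using \<open>d > 0\<close> by (simp add: algebra_simps)
    also have "\<dots> = r / 2"
      unfolding d_def using pos by simp
    also have "\<dots> < r" using r by simp
    finally have "norm (p + s *\<^sub>R v + t *\<^sub>R w - p) < r" by (simp add: add.assoc)
    then have "norm (p - (p + s *\<^sub>R v + t *\<^sub>R w)) < r" by (subst norm_minus_commute)
    then have "p + s *\<^sub>R v + t *\<^sub>R w \<in> ball p r" by (simp only: mem_ball dist_norm)
    then show ?thesis using r by blast
  qed
  have line_s: "((\<lambda>s. h (p + s *\<^sub>R v + t *\<^sub>R w)) has_vector_derivative frechet_derivative h (at (p + s *\<^sub>R v + t *\<^sub>R w)) v) (at s within S)"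
    if "h differentiable at (p + s *\<^sub>R v + t *\<^sub>R w)" for h :: "'a \<Rightarrow> 'b" and s t S
  proof -
    have eq: "p + s *\<^sub>R v + t *\<^sub>R w = (p + t *\<^sub>R w) + s *\<^sub>R v" for s by (simp add: add_ac)
    show ?thesis using that unfolding eq by (rule has_vector_derivative_along_line)
  qed
  have hs: "((\<lambda>s. f (p + s *\<^sub>R v + t *\<^sub>R w)) has_vector_derivative ?D v (p + s *\<^sub>R v + t *\<^sub>R w)) (at s within S)"
    if "\<bar>s\<bar> \<le> d" "\<bar>t\<bar> \<le> d" for s t S
    by (rule line_s[OF d1[OF inU[OF that]]])
  have ht: "((\<lambda>t. f (p + s *\<^sub>R v + t *\<^sub>R w)) has_vector_derivative ?D w (p + s *\<^sub>R v + t *\<^sub>R w)) (at t within S)"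
    if "\<bar>s\<bar> \<le> d" "\<bar>t\<bar> \<le> d" for s t S
    by (rule has_vector_derivative_along_line[OF d1[OF inU[OF that]]])
  have Es: "((\<lambda>s. ?D w (p + s *\<^sub>R v + t *\<^sub>R w)) has_vector_derivative ?E (p + s *\<^sub>R v + t *\<^sub>R w)) (at s within S)"
    if "\<bar>s\<bar> \<le> d" "\<bar>t\<bar> \<le> d" for s t S
    by (rule line_s[OF d2[OF inU[OF that]]])
  let ?S = "{-d..d}"
  \<comment> \<open>the increment along \<open>w\<close> is an integral; both sides are differentiated in \<open>s\<close>\<close>
  have int: "?D v (p + t *\<^sub>R w) = ?D v p + integral {0..t} (\<lambda>\<tau>. ?E (p + \<tau> *\<^sub>R w))" if t: "t \<in> {0..d}" for t
  proof -
    have leib: "((\<lambda>s. integral (cbox 0 t) (\<lambda>\<tau>. ?D w (p + s *\<^sub>R v + \<tau> *\<^sub>R w))) has_vector_derivative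
        integral (cbox 0 t) (\<lambda>\<tau>. ?E (p + 0 *\<^sub>R v + \<tau> *\<^sub>R w))) (at 0 within ?S)"
    proof (rule leibniz_rule_vector_derivative)
      show "((\<lambda>s. ?D w (p + s *\<^sub>R v + \<tau> *\<^sub>R w)) has_vector_derivative ?E (p + s *\<^sub>R v + \<tau> *\<^sub>R w)) (at s within ?S)"
        if "s \<in> ?S" "\<tau> \<in> cbox 0 t" for s \<tau>
        using that t by (intro Es) auto
      show "(\<lambda>\<tau>. ?D w (p + s *\<^sub>R v + \<tau> *\<^sub>R w)) integrable_on cbox 0 t" if "s \<in> ?S" for s
        using that t by (intro integrable_continuous continuous_on_compose2[OF contD] continuous_intros) (auto intro!: inU)
      show "continuous_on (?S \<times> cbox 0 t) (\<lambda>(s, \<tau>). ?E (p + s *\<^sub>R v + \<tau> *\<^sub>R w))"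
        unfolding case_prod_unfold using t
        by (intro continuous_on_compose2[OF contE] continuous_intros) (auto intro!: inU)
    qed (use \<open>d > 0\<close> in auto)
    have ftc: "f (p + s *\<^sub>R v + 0 *\<^sub>R w) + integral (cbox 0 t) (\<lambda>\<tau>. ?D w (p + s *\<^sub>R v + \<tau> *\<^sub>R w)) = f (p + s *\<^sub>R v + t *\<^sub>R w)"
      if "s \<in> ?S" for s
    proof -
      have "((\<lambda>\<tau>. ?D w (p + s *\<^sub>R v + \<tau> *\<^sub>R w)) has_integral
          f (p + s *\<^sub>R v + t *\<^sub>R w) - f (p + s *\<^sub>R v + 0 *\<^sub>R w)) {0..t}"
        using t that by (intro fundamental_theorem_of_calculus ht) auto
      then show ?thesis by (simp add: integral_unique)
    qed
    have 1: "((\<lambda>s. f (p + s *\<^sub>R v + t *\<^sub>R w)) has_vector_derivative ?D v (p + 0 *\<^sub>R v + t *\<^sub>R w)) (at 0 within ?S)"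
      using t \<open>d > 0\<close> by (intro hs) auto
    have 2: "((\<lambda>s. f (p + s *\<^sub>R v + t *\<^sub>R w)) has_vector_derivative
        ?D v (p + 0 *\<^sub>R v + 0 *\<^sub>R w) + integral (cbox 0 t) (\<lambda>\<tau>. ?E (p + 0 *\<^sub>R v + \<tau> *\<^sub>R w))) (at 0 within ?S)"
      by (rule has_vector_derivative_transform[OF _ ftc[symmetric] has_vector_derivative_add[OF hs leib]])
        (use \<open>d > 0\<close> in auto)
    show ?thesis
      using vector_derivative_unique_within_closed_interval[of "-d" d 0, simplified, OF _ 1 2] \<open>d > 0\<close> by simp
  qed
  have cont: "continuous_on {0..d} (\<lambda>\<tau>. ?E (p + \<tau> *\<^sub>R w))"
  proof (rule continuous_on_compose2[OF contE])
    show "continuous_on {0..d} (\<lambda>\<tau>. p + \<tau> *\<^sub>R w)" by (intro continuous_intros)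
    show "(\<lambda>\<tau>. p + \<tau> *\<^sub>R w) ` {0..d} \<subseteq> U" using inU[of 0] \<open>d > 0\<close> by auto
  qed
  have "((\<lambda>t. ?D v p + integral {0..t} (\<lambda>\<tau>. ?E (p + \<tau> *\<^sub>R w))) has_vector_derivative 0 + ?E (p + 0 *\<^sub>R w)) (at 0 within {0..d})"
    using \<open>d > 0\<close>
    by (intro has_vector_derivative_add has_vector_derivative_const integral_has_vector_derivative[OF cont]) simp
  then have 1: "((\<lambda>t. ?D v (p + t *\<^sub>R w)) has_vector_derivative ?E p) (at 0 within {0..d})"
    using \<open>d > 0\<close> by (intro has_vector_derivative_transform[of 0 "{0..d}", OF _ int]) simp_all
  have 2: "((\<lambda>t. ?D v (p + t *\<^sub>R w)) has_vector_derivative frechet_derivative (?D v) (at p) w) (at 0 within {0..d})"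
    using has_vector_derivative_along_line[of "?D v" p 0 w "{0..d}"] d2[OF U(2), of v] by simp
  show ?thesis
    using vector_derivative_unique_within_closed_interval[of 0 d 0, simplified, OF _ 2 1] \<open>d > 0\<close> by simp
qed

section \<open>Autonomous ordinary differential equations\<close>

text \<open>
  The Picard operator is a contraction on bounded continuous functions with values in the ball.
  Integrals start at \<open>-e\<close> instead of 0, which avoids oriented integrals at the cost of a worse constant.
\<close>
lemma ode_solution_exists:
  fixes X :: "'e::banach \<Rightarrow> 'e"
  assumes r: "r > 0" and L: "L \<ge> 0"
    and lip: "\<And>x y. x \<in> cball u r \<Longrightarrow> y \<in> cball u r \<Longrightarrow> norm (X x - X y) \<le> L * norm (x - y)"
  obtains e \<phi> where "e > 0" "\<phi> 0 = u" "\<And>t. \<bar>t\<bar> < e \<Longrightarrow> \<phi> t \<in> cball u r"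
    "\<And>t. \<bar>t\<bar> < e \<Longrightarrow> (\<phi> has_vector_derivative X (\<phi> t)) (at t)"
proof -
  define K where "K = norm (X u) + L * r"
  have "K \<ge> 0" unfolding K_def using r L by simp
  have XK: "norm (X x) \<le> K" if "x \<in> cball u r" for x
  proof -
    have "norm (X x) \<le> norm (X u) + norm (X x - X u)" by (metis add.commute diff_add_cancel norm_triangle_ineq)
    also have "norm (X x - X u) \<le> L * norm (x - u)" using lip[OF that, of u] r by simp
    also have "\<dots> \<le> L * r" using that L by (intro mult_left_mono) (simp_all add: dist_norm norm_minus_commute)
    finally show ?thesis unfolding K_def by simp
  qed
  have contX: "continuous_on (cball u r) X"
    using lip L by (intro lipschitz_on_continuous_on[of L]) (auto intro!: lipschitz_onI simp: dist_norm)
  \<comment> \<open>the two bounds keep the values in the ball and make the operator a contraction with constant 1/2\<close>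
  define e where "e = min (r / (4 * (K + 1))) (1 / (8 * (L + 1)))"
  have e: "e > 0" unfolding e_def using r L \<open>K \<ge> 0\<close> by simp
  have eK: "3 * e * K \<le> r"
  proof -
    have "e * (4 * (K + 1)) \<le> r / (4 * (K + 1)) * (4 * (K + 1))"
      unfolding e_def using \<open>K \<ge> 0\<close> by (intro mult_right_mono) auto
    then have "e * (4 * (K + 1)) \<le> r" using \<open>K \<ge> 0\<close> by simp
    moreover have "3 * e * K \<le> e * (4 * (K + 1))" using e \<open>K \<ge> 0\<close> by (simp add: algebra_simps)
    ultimately show ?thesis by simp
  qed
  have eL: "3 * e * L \<le> 1 / 2"
  proof -
    have "e * (8 * (L + 1)) \<le> 1 / (8 * (L + 1)) * (8 * (L + 1))"
      unfolding e_def using L by (intro mult_right_mono) auto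
    then have "e * (8 * (L + 1)) \<le> 1" using L by simp
    moreover have "6 * e * L \<le> e * (8 * (L + 1))" using e L by (simp add: algebra_simps)
    ultimately show ?thesis by simp
  qed
  \<comment> \<open>bounded continuous functions live on all of \<open>real\<close>, so times are clamped to the interval\<close>
  define cl where "cl t = max (-e) (min e t)" for t :: real
  have cl: "cl t \<in> {-e..e}" "t \<in> {-e..e} \<Longrightarrow> cl t = t" for t unfolding cl_def using e by auto
  have contcl: "continuous_on UNIV cl" unfolding cl_def by (intro continuous_intros)
  define S :: "(real \<Rightarrow>\<^sub>C 'e) set" where "S = PiC UNIV (\<lambda>_. cball u r)"
  have S: "apply_bcontfun g t \<in> cball u r" if "g \<in> S" for g t
    using that unfolding S_def mem_PiC_iff by auto
  have contXg: "continuous_on A (\<lambda>s. X (apply_bcontfun g s))" if "g \<in> S" for g A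
    by (rule continuous_on_compose2[OF contX]) (use S[OF that] in auto)
  define P where "P g t = u + (integral {-e..cl t} (\<lambda>s. X (apply_bcontfun g s))
      - integral {-e..0} (\<lambda>s. X (apply_bcontfun g s)))" for g :: "real \<Rightarrow>\<^sub>C 'e" and t
  have contP: "continuous_on UNIV (P g)" if "g \<in> S" for g
  proof -
    have "continuous_on {-e..e} (\<lambda>t. integral {-e..t} (\<lambda>s. X (apply_bcontfun g s)))"
      by (intro indefinite_integral_continuous_1 integrable_continuous_real contXg that)
    then have "continuous_on UNIV (\<lambda>t. integral {-e..cl t} (\<lambda>s. X (apply_bcontfun g s)))"
      by (rule continuous_on_compose2[OF _ contcl]) (use cl in auto)
    then show ?thesis unfolding P_def by (intro continuous_intros)
  qed
  have int_le: "norm (integral {-e..t} f) \<le> 2 * e * C"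
    if "continuous_on {-e..t} f" "t \<in> {-e..e}" "C \<ge> 0" "\<And>s. norm (f s) \<le> C" for t C and f :: "real \<Rightarrow> 'e"
  proof -
    have "norm (integral {-e..t} f) \<le> C * (t - - e)"
      using that by (intro integral_bound) auto
    also have "\<dots> \<le> C * (2 * e)" using that by (intro mult_left_mono) auto
    finally show ?thesis by (simp add: mult_ac)
  qed
  have int_le0: "norm (integral {-e..0} f) \<le> e * C"
    if "continuous_on {-e..0} f" "C \<ge> 0" "\<And>s. norm (f s) \<le> C" for C and f :: "real \<Rightarrow> 'e"
    using integral_bound[of "-e" 0 f C] that e by (simp add: mult_ac)
  have PS: "P g t \<in> cball u r" if "g \<in> S" for g t
  proof -
    have "norm (P g t - u) \<le> norm (integral {-e..cl t} (\<lambda>s. X (apply_bcontfun g s)))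
      + norm (integral {-e..0} (\<lambda>s. X (apply_bcontfun g s)))"
      unfolding P_def using norm_triangle_ineq4 by simp
    also have "\<dots> \<le> 2 * e * K + e * K"
      by (intro add_mono int_le int_le0 contXg that cl XK S \<open>K \<ge> 0\<close>)
    also have "\<dots> = 3 * e * K" by (simp add: algebra_simps)
    also note eK
    finally show ?thesis by (simp add: dist_norm norm_minus_commute)
  qed
  define T where "T g = Bcontfun (P g)" for g
  have T: "apply_bcontfun (T g) = P g" if "g \<in> S" for g
  proof -
    have "bounded (range (P g))"
      using PS[OF that] bounded_cball[of u r] by (meson bounded_subset image_subsetI)
    then have "P g \<in> bcontfun" using contP[OF that] unfolding bcontfun_def by simp
    then show ?thesis unfolding T_def by (rule Bcontfun_inverse)
  qed
  have "\<exists>!g\<in>S. T g = g"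
  proof (rule Banach_fix[where c = "1/2"])
    show "complete S" unfolding S_def complete_eq_closed by (rule closed_PiC) simp
    have "const_bcontfun u \<in> S" unfolding S_def mem_PiC_iff using r by (simp add: Pi_def)
    then show "S \<noteq> {}" by blast
    show "T ` S \<subseteq> S"
      using PS T unfolding S_def by (auto simp: mem_PiC_iff Pi_def)
    show "dist (T g) (T h) \<le> 1/2 * dist g h" if g: "g \<in> S" and h: "h \<in> S" for g h
    proof (rule dist_bound)
      fix t
      let ?f = "\<lambda>s. X (apply_bcontfun g s) - X (apply_bcontfun h s)"
      have f: "norm (?f s) \<le> L * dist g h" for s
      proof -
        have "norm (?f s) \<le> L * dist (apply_bcontfun g s) (apply_bcontfun h s)"
          unfolding dist_norm by (rule lip[OF S[OF g] S[OF h]])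
        also have "\<dots> \<le> L * dist g h" by (intro mult_left_mono dist_bounded L)
        finally show ?thesis .
      qed
      have contf: "continuous_on A ?f" for A by (intro continuous_on_diff contXg g h)
      have split: "integral {-e..x} ?f
          = integral {-e..x} (\<lambda>s. X (apply_bcontfun g s)) - integral {-e..x} (\<lambda>s. X (apply_bcontfun h s))" for x
        by (intro integral_diff integrable_continuous_real contXg g h)
      have "P g t - P h t = integral {-e..cl t} ?f - integral {-e..0} ?f"
        unfolding P_def split by simp
      then have "norm (P g t - P h t) \<le> norm (integral {-e..cl t} ?f) + norm (integral {-e..0} ?f)"
        by (simp only: norm_triangle_ineq4)
      also have "\<dots> \<le> 2 * e * (L * dist g h) + e * (L * dist g h)"
        by (intro add_mono int_le int_le0 contf cl f mult_nonneg_nonneg L zero_le_dist)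
      also have "\<dots> = (3 * e * L) * dist g h" by (simp add: algebra_simps)
      also have "\<dots> \<le> 1/2 * dist g h" by (intro mult_right_mono eL) simp
      finally show "dist (apply_bcontfun (T g) t) (apply_bcontfun (T h) t) \<le> 1/2 * dist g h"
        by (simp only: T[OF g] T[OF h] dist_norm)
    qed
  qed simp_all
  then obtain g where g: "g \<in> S" "T g = g" by blast
  define \<phi> where "\<phi> = apply_bcontfun g"
  have \<phi>P: "\<phi> = P g" unfolding \<phi>_def using T[OF g(1)] g(2) by simp
  have "(\<phi> has_vector_derivative X (\<phi> t)) (at t)" if t: "\<bar>t\<bar> < e" for t
  proof -
    let ?I = "\<lambda>t. u + (integral {-e..t} (\<lambda>s. X (\<phi> s)) - integral {-e..0} (\<lambda>s. X (\<phi> s)))"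
    have t': "t \<in> {-e..e}" "t \<in> {-e<..<e}" using t by auto
    have "(?I has_vector_derivative 0 + (X (\<phi> t) - 0)) (at t within {-e..e})"
      unfolding \<phi>_def
      by (intro has_vector_derivative_add has_vector_derivative_diff has_vector_derivative_const
          integral_has_vector_derivative contXg g t')
    moreover have "at t within {-e..e} = at t"
      using t' by (intro at_within_interior) (simp add: interior_cbox[of "-e" e, simplified])
    ultimately have "(?I has_vector_derivative X (\<phi> t)) (at t)" by simp
    then show ?thesis
    proof (rule has_vector_derivative_transform_within_open[OF _ open_greaterThanLessThan t'(2)])
      show "?I s = \<phi> s" if "s \<in> {-e<..<e}" for s
      proof -
        have "\<phi> s = P g s" by (simp add: \<phi>P)
        also have "\<dots> = ?I s" using that cl(2)[of s] unfolding P_def \<phi>_def by simp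
        finally show ?thesis by simp
      qed
    qed
  qed
  moreover have "\<phi> 0 = u" unfolding \<phi>P P_def using cl(2)[of 0] e by simp
  moreover have "\<phi> t \<in> cball u r" for t unfolding \<phi>_def by (rule S[OF g(1)])
  ultimately show ?thesis using that e by blast
qed

text \<open>
  If \<open>m\<close> is a time of maximal distance between the solutions, then the distance at \<open>m\<close> is at most
  \<open>d * L < 1\<close> times itself.
\<close>
lemma ode_solution_unique:
  fixes X :: "'e::banach \<Rightarrow> 'e"
  assumes d: "d > 0" and L: "L \<ge> 0" "d * L < 1"
    and lip: "\<And>x y. x \<in> D \<Longrightarrow> y \<in> D \<Longrightarrow> norm (X x - X y) \<le> L * norm (x - y)"
    and \<phi>: "\<And>t. \<bar>t\<bar> \<le> d \<Longrightarrow> \<phi> t \<in> D" "\<And>t. \<bar>t\<bar> \<le> d \<Longrightarrow> (\<phi> has_vector_derivative X (\<phi> t)) (at t)"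
    and \<psi>: "\<And>t. \<bar>t\<bar> \<le> d \<Longrightarrow> \<psi> t \<in> D" "\<And>t. \<bar>t\<bar> \<le> d \<Longrightarrow> (\<psi> has_vector_derivative X (\<psi> t)) (at t)"
    and init: "\<phi> 0 = \<psi> 0" and t: "\<bar>t\<bar> \<le> d"
  shows "\<phi> t = \<psi> t"
proof -
  let ?h = "\<lambda>t. \<phi> t - \<psi> t"
  have h': "(?h has_vector_derivative X (\<phi> t) - X (\<psi> t)) (at t)" if "\<bar>t\<bar> \<le> d" for t
    using that \<phi> \<psi> by (intro has_vector_derivative_diff) auto
  have "continuous_on {-d..d} (\<lambda>t. norm (?h t))"
    using has_vector_derivative_continuous[OF h']
    by (intro continuous_on_norm continuous_at_imp_continuous_on) (metis abs_le_iff atLeastAtMost_iff minus_le_iff)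
  moreover have "{-d..d} \<noteq> {}" using d by auto
  ultimately obtain m where m: "m \<in> {-d..d}" "\<And>t. t \<in> {-d..d} \<Longrightarrow> norm (?h t) \<le> norm (?h m)"
    using continuous_attains_sup[OF compact_Icc] by blast
  have "norm (?h m - ?h 0) \<le> (L * norm (?h m)) * norm (m - 0)"
  proof (rule differentiable_bound[where S = "{-d..d}"])
    show "(?h has_derivative (\<lambda>s. s *\<^sub>R (X (\<phi> t) - X (\<psi> t)))) (at t within {-d..d})" if "t \<in> {-d..d}" for t
      using h'[of t] that by (auto simp: has_vector_derivative_def intro: has_derivative_at_withinI)
    show "onorm (\<lambda>s. s *\<^sub>R (X (\<phi> t) - X (\<psi> t))) \<le> L * norm (?h m)" if "t \<in> {-d..d}" for t
    proof -
      have "onorm (\<lambda>s. s *\<^sub>R (X (\<phi> t) - X (\<psi> t))) \<le> norm (X (\<phi> t) - X (\<psi> t))"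
        by (rule onorm_le) (simp add: mult.commute)
      also
      have "norm (X (\<phi> t) - X (\<psi> t)) \<le> L * norm (?h t)"
        using that \<phi>(1)[of t] \<psi>(1)[of t] by (intro lip) auto
      also have "\<dots> \<le> L * norm (?h m)" by (intro mult_left_mono m(2) that L)
      finally show ?thesis .
    qed
  qed (use m d in auto)
  also have "(L * norm (?h m)) * norm (m - 0) \<le> (L * norm (?h m)) * d"
    using m(1) L by (intro mult_left_mono) auto
  finally have "norm (?h m) \<le> d * L * norm (?h m)"
    using init by (simp add: mult_ac)
  then have "(1 - d * L) * norm (?h m) \<le> 0" by (simp add: algebra_simps)
  then have "norm (?h m) \<le> 0" using L by (simp add: mult_le_0_iff)
  moreover have "t \<in> {-d..d}" using t by auto
  then have "norm (?h t) \<le> norm (?h m)" by (rule m(2))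
  ultimately show ?thesis by simp
qed

section \<open>Charts and differentiable maps\<close>

text \<open>
  The topological half of the manifold axioms. Separated from the smoothness of the transition maps, it
  is easily verified for products of charts, and it is what the chain rule in charts rests on.
\<close>
definition proper_chart :: "'p topology \<Rightarrow> ('p, 'e::real_normed_vector) chart \<Rightarrow> bool" where
  "proper_chart X c \<longleftrightarrow> openin X (fst c) \<and> open (snd c ` fst c) \<and>
     homeomorphic_map (subtopology X (fst c)) (top_of_set (snd c ` fst c)) (snd c)"

definition charted_space :: "('p, 'e::real_normed_vector) manifold \<Rightarrow> bool" where
  "charted_space M \<longleftrightarrow> (\<Union>c\<in>atlas M. fst c) = topspace (base M) \<and> (\<forall>c\<in>atlas M. proper_chart (base M) c)"

definition prod_chart :: "('p, 'e) chart \<Rightarrow> ('q, 'f) chart \<Rightarrow> ('p \<times> 'q, 'e \<times> 'f) chart" where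
  "prod_chart c d = (fst c \<times> fst d, map_prod (snd c) (snd d))"

abbreviation real_chart :: "(real, real) chart" where
  "real_chart \<equiv> (UNIV, id)"

lemma smooth_manifold_charted: "smooth_manifold M \<Longrightarrow> charted_space M"
  unfolding smooth_manifold_def charted_space_def proper_chart_def by blast

lemma smooth_manifold_finite_dim:
  "smooth_manifold (M :: ('p, 'e::real_normed_vector) manifold) \<Longrightarrow> finite_dim TYPE('e)"
  unfolding smooth_manifold_def finite_dim_def by blast

lemma proper_chart_inj: "proper_chart X c \<Longrightarrow> inj_on (snd c) (fst c)"
proof -
  assume c: "proper_chart X c"
  then have "inj_on (snd c) (topspace X \<inter> fst c)"
    using homeomorphic_imp_injective_map[of "subtopology X (fst c)"] unfolding proper_chart_def by fastforce
  moreover have "fst c \<subseteq> topspace X" using c openin_subset unfolding proper_chart_def by blast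
  ultimately show ?thesis by (simp add: inf_absorb2)
qed

lemma chart_inv_left: "proper_chart X c \<Longrightarrow> p \<in> fst c \<Longrightarrow> chart_inv c (snd c p) = p"
  unfolding chart_inv_def by (simp add: proper_chart_inj inv_into_f_f)

lemma chart_inv_right: "u \<in> snd c ` fst c \<Longrightarrow> snd c (chart_inv c u) = u"
  unfolding chart_inv_def by (simp add: f_inv_into_f)

lemma chart_inv_in: "u \<in> snd c ` fst c \<Longrightarrow> chart_inv c u \<in> fst c"
  unfolding chart_inv_def by (simp add: inv_into_into)

lemma charts_atD:
  assumes "charted_space M" "c \<in> charts_at M p"
  shows "proper_chart (base M) c" "p \<in> fst c" "openin (base M) (fst c)" "c \<in> atlas M" "p \<in> topspace (base M)"
    "chart_inv c (snd c p) = p"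
proof -
  show 1: "proper_chart (base M) c" and 2: "p \<in> fst c" and "c \<in> atlas M"
    using assms unfolding charts_at_def charted_space_def by blast+
  show "openin (base M) (fst c)" using 1 unfolding proper_chart_def by blast
  then show "p \<in> topspace (base M)" using 2 openin_subset by blast
  show "chart_inv c (snd c p) = p" by (rule chart_inv_left[OF 1 2])
qed

lemma charts_at_nonempty: "charted_space M \<Longrightarrow> p \<in> topspace (base M) \<Longrightarrow> \<exists>c. c \<in> charts_at M p"
  unfolding charts_at_def charted_space_def by blast

lemma chart_image_open:
  assumes c: "proper_chart X c" and V: "openin X V"
  shows "open (snd c ` (fst c \<inter> V))"
proof -
  have "openin (subtopology X (fst c)) (fst c \<inter> V)"
    using V by (auto simp: openin_subtopology)
  then have "openin (top_of_set (snd c ` fst c)) (snd c ` (fst c \<inter> V))"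
    using c homeomorphic_map_openness_eq unfolding proper_chart_def by blast
  then show ?thesis using c unfolding proper_chart_def by (simp add: openin_open_eq)
qed

lemma chart_preimage_open:
  assumes c: "proper_chart X c" and O: "open U"
  shows "openin X {p \<in> fst c. snd c p \<in> U}"
proof -
  have "continuous_map (subtopology X (fst c)) (top_of_set (snd c ` fst c)) (snd c)"
    using c homeomorphic_imp_continuous_map unfolding proper_chart_def by blast
  moreover have "openin (top_of_set (snd c ` fst c)) (snd c ` fst c \<inter> U)" using O by (simp add: openin_open_Int)
  ultimately have "openin (subtopology X (fst c)) {p \<in> topspace (subtopology X (fst c)). snd c p \<in> snd c ` fst c \<inter> U}"
    by (rule openin_continuous_map_preimage)
  moreover have "openin X (fst c)" using c unfolding proper_chart_def by blast
  moreover have "{p \<in> topspace (subtopology X (fst c)). snd c p \<in> snd c ` fst c \<inter> U} = {p \<in> fst c. snd c p \<in> U}"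
    using openin_subset[OF \<open>openin X (fst c)\<close>] by auto
  ultimately show ?thesis by (simp add: openin_open_subtopology)
qed

lemma real_line_charted: "charted_space real_line"
  unfolding charted_space_def proper_chart_def real_line_def by (simp add: homeomorphic_map_id)

lemma charts_at_real_line [simp]: "charts_at real_line t = {real_chart}"
  unfolding charts_at_def real_line_def by auto

lemma base_real_line [simp]: "base real_line = euclideanreal"
  unfolding real_line_def by simp

lemma chart_inv_real [simp]: "chart_inv real_chart = (\<lambda>t. t)"
  unfolding chart_inv_def by (auto simp: inv_into_def)

lemma charts_at_prod:
  "charts_at (prod_manifold M N) (p, q) = {prod_chart c d |c d. c \<in> charts_at M p \<and> d \<in> charts_at N q}"
proof (intro equalityI subsetI)
  fix k assume "k \<in> charts_at (prod_manifold M N) (p, q)"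
  then obtain c d where k: "k = prod_chart c d" and "c \<in> atlas M" "d \<in> atlas N" "(p, q) \<in> fst k"
    unfolding charts_at_def prod_manifold_def prod_chart_def by auto
  then have "c \<in> charts_at M p" "d \<in> charts_at N q"
    unfolding charts_at_def prod_chart_def by auto
  with k show "k \<in> {prod_chart c d |c d. c \<in> charts_at M p \<and> d \<in> charts_at N q}" by blast
next
  fix k assume "k \<in> {prod_chart c d |c d. c \<in> charts_at M p \<and> d \<in> charts_at N q}"
  then show "k \<in> charts_at (prod_manifold M N) (p, q)"
    unfolding charts_at_def prod_manifold_def prod_chart_def by auto
qed

lemma prod_chart_in_charts_at:
  "c \<in> charts_at M p \<Longrightarrow> d \<in> charts_at N q \<Longrightarrow> prod_chart c d \<in> charts_at (prod_manifold M N) (p, q)"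
  unfolding charts_at_prod by blast

lemma prod_chart_proper:
  assumes c: "proper_chart X c" and d: "proper_chart Y d"
  shows "proper_chart (prod_topology X Y) (prod_chart c d)"
proof -
  obtain c' d' where "homeomorphic_maps (subtopology X (fst c)) (top_of_set (snd c ` fst c)) (snd c) c'"
    and "homeomorphic_maps (subtopology Y (fst d)) (top_of_set (snd d ` fst d)) (snd d) d'"
    using c d unfolding proper_chart_def homeomorphic_map_maps by blast
  then have "homeomorphic_maps (prod_topology (subtopology X (fst c)) (subtopology Y (fst d)))
     (prod_topology (top_of_set (snd c ` fst c)) (top_of_set (snd d ` fst d)))
     (\<lambda>(x, y). (snd c x, snd d y)) (\<lambda>(x, y). (c' x, d' y))"
    unfolding homeomorphic_maps_prod by blast
  then have "homeomorphic_map (subtopology (prod_topology X Y) (fst c \<times> fst d))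
     (top_of_set (snd c ` fst c \<times> snd d ` fst d)) (\<lambda>(x, y). (snd c x, snd d y))"
    unfolding homeomorphic_map_maps subtopology_Times by auto
  moreover have "(\<lambda>(x, y). (snd c x, snd d y)) = map_prod (snd c) (snd d)" by (auto simp: fun_eq_iff)
  moreover have "map_prod (snd c) (snd d) ` (fst c \<times> fst d) = snd c ` fst c \<times> snd d ` fst d"
    by (rule map_prod_surj_on) simp_all
  ultimately show ?thesis
    using c d unfolding proper_chart_def prod_chart_def by (simp add: openin_prod_Times_iff open_Times)
qed

lemma prod_chart_simps [simp]: "fst (prod_chart c d) = fst c \<times> fst d" "snd (prod_chart c d) (p, q) = (snd c p, snd d q)"
  unfolding prod_chart_def by simp_all

lemma prod_manifold_charted:
  assumes "charted_space M" "charted_space N"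
  shows "charted_space (prod_manifold M N)"
proof -
  let ?A = "{prod_chart c d |c d. c \<in> atlas M \<and> d \<in> atlas N}"
  have atlas: "atlas (prod_manifold M N) = ?A"
    unfolding prod_manifold_def prod_chart_def by simp
  have base: "base (prod_manifold M N) = prod_topology (base M) (base N)" by (simp add: prod_manifold_def)
  have top: "topspace (base M) = (\<Union>c\<in>atlas M. fst c)" "topspace (base N) = (\<Union>c\<in>atlas N. fst c)"
    using assms unfolding charted_space_def by simp_all
  have cover: "(\<Union>k\<in>?A. fst k) = topspace (base M) \<times> topspace (base N)"
  proof (intro equalityI subsetI)
    fix z assume "z \<in> (\<Union>k\<in>?A. fst k)"
    then obtain c d where "c \<in> atlas M" "d \<in> atlas N" "z \<in> fst (prod_chart c d)" by blast
    then show "z \<in> topspace (base M) \<times> topspace (base N)"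
      unfolding top prod_chart_simps mem_Times_iff by blast
  next
    fix z assume "z \<in> topspace (base M) \<times> topspace (base N)"
    then obtain c d where "c \<in> atlas M" "d \<in> atlas N" "z \<in> fst (prod_chart c d)"
      unfolding top prod_chart_simps mem_Times_iff by blast
    then show "z \<in> (\<Union>k\<in>?A. fst k)" by blast
  qed
  have "proper_chart (prod_topology (base M) (base N)) k" if k: "k \<in> ?A" for k
  proof -
    obtain c d where "k = prod_chart c d" "c \<in> atlas M" "d \<in> atlas N" using k by blast
    then show ?thesis using assms unfolding charted_space_def by (simp add: prod_chart_proper)
  qed
  then show ?thesis unfolding charted_space_def atlas base topspace_prod_topology using cover by blast
qed

lemma chart_inv_prod:
  assumes "proper_chart X c" "proper_chart Y d" "u \<in> snd c ` fst c" "w \<in> snd d ` fst d"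
  shows "chart_inv (prod_chart c d) (u, w) = (chart_inv c u, chart_inv d w)"
proof -
  have "snd (prod_chart c d) (chart_inv c u, chart_inv d w) = (u, w)"
    using assms by (simp add: chart_inv_right)
  moreover have "(chart_inv c u, chart_inv d w) \<in> fst (prod_chart c d)"
    using assms by (simp add: chart_inv_in)
  ultimately show ?thesis using chart_inv_left[OF prod_chart_proper[OF assms(1,2)]] by metis
qed

text \<open>
  Differentiability at a point, as opposed to smoothness, is preserved by composition and pairing
  through the chain rule alone. The derivative is represented by its expression in a pair of charts.
\<close>
definition mdiff_at ::
  "('p, 'e::real_normed_vector) manifold \<Rightarrow> ('q, 'f::real_normed_vector) manifold \<Rightarrow> ('p \<Rightarrow> 'q) \<Rightarrow> 'p \<Rightarrow> bool" where
  "mdiff_at M N f p \<longleftrightarrow> topcontinuous_at (base M) (base N) f p \<and>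
     (\<forall>c\<in>charts_at M p. \<forall>d\<in>charts_at N (f p). (snd d \<circ> f \<circ> chart_inv c) differentiable at (snd c p))"

definition mderiv ::
  "('p, 'e::real_normed_vector) chart \<Rightarrow> ('q, 'f::real_normed_vector) chart \<Rightarrow> ('p \<Rightarrow> 'q) \<Rightarrow> 'p \<Rightarrow> 'e \<Rightarrow> 'f" where
  "mderiv c d f p = frechet_derivative (snd d \<circ> f \<circ> chart_inv c) (at (snd c p))"

lemma mdiff_atD:
  assumes "mdiff_at M N f p" "c \<in> charts_at M p" "d \<in> charts_at N (f p)"
  shows "((snd d \<circ> f \<circ> chart_inv c) has_derivative mderiv c d f p) (at (snd c p))"
  using assms unfolding mdiff_at_def mderiv_def by (auto intro: has_derivative_frechet)

lemma mdiff_at_in_topspace: "mdiff_at M N f p \<Longrightarrow> p \<in> topspace (base M)" "mdiff_at M N f p \<Longrightarrow> f p \<in> topspace (base N)"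
  unfolding mdiff_at_def topcontinuous_at_def by auto

lemma mderiv_bounded_linear:
  assumes "mdiff_at M N f p" "c \<in> charts_at M p" "d \<in> charts_at N (f p)"
  shows "bounded_linear (mderiv c d f p)"
  using mdiff_atD[OF assms] by (rule has_derivative_bounded_linear)

lemma continuous_at_in_chart:
  assumes M: "charted_space M" and f: "topcontinuous_at (base M) (base N) f p"
    and c: "c \<in> charts_at M p" and V: "openin (base N) V" "f p \<in> V"
  obtains U where "open U" "snd c p \<in> U" "U \<subseteq> snd c ` fst c" "\<And>u. u \<in> U \<Longrightarrow> f (chart_inv c u) \<in> V"
proof -
  obtain W where W: "openin (base M) W" "p \<in> W" "\<And>q. q \<in> W \<Longrightarrow> f q \<in> V"
    using f V unfolding topcontinuous_at_def by metis
  note cD = charts_atD[OF M c]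
  have "f (chart_inv c u) \<in> V" if u: "u \<in> snd c ` (fst c \<inter> W)" for u
    using u W(3) chart_inv_left[OF cD(1)] by auto
  then show ?thesis using that[OF chart_image_open[OF cD(1) W(1)]] cD(2) W(2) by blast
qed

lemma mdiff_at_compose:
  assumes MN: "charted_space M" "charted_space N"
    and f: "mdiff_at M N f p" and g: "mdiff_at N P g (f p)"
  shows "mdiff_at M P (g \<circ> f) p"
    and "c \<in> charts_at M p \<Longrightarrow> d \<in> charts_at N (f p) \<Longrightarrow> k \<in> charts_at P (g (f p)) \<Longrightarrow>
      mderiv c k (g \<circ> f) p = mderiv d k g (f p) \<circ> mderiv c d f p"
proof -
  have D: "((snd k \<circ> (g \<circ> f) \<circ> chart_inv c) has_derivative mderiv d k g (f p) \<circ> mderiv c d f p) (at (snd c p))"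
    if c: "c \<in> charts_at M p" and d: "d \<in> charts_at N (f p)" and k: "k \<in> charts_at P (g (f p))" for c d k
  proof -
    note cD = charts_atD[OF MN(1) c] and dD = charts_atD[OF MN(2) d]
    obtain U where U: "open U" "snd c p \<in> U" "\<And>u. u \<in> U \<Longrightarrow> f (chart_inv c u) \<in> fst d"
      using continuous_at_in_chart[where N = N and f = f and p = p, OF MN(1) _ c dD(3) dD(2)] f unfolding mdiff_at_def by metis
    have fp: "(snd d \<circ> f \<circ> chart_inv c) (snd c p) = snd d (f p)" by (simp add: cD)
    have "((snd k \<circ> g \<circ> chart_inv d) \<circ> (snd d \<circ> f \<circ> chart_inv c) has_derivative
        mderiv d k g (f p) \<circ> mderiv c d f p) (at (snd c p))"
      by (rule diff_chain_at[OF mdiff_atD[OF f c d]]) (use mdiff_atD[OF g d k] fp in simp)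
    then show ?thesis
      by (rule has_derivative_transform_within_open[OF _ U(1,2)]) (simp add: chart_inv_left[OF dD(1) U(3)])
  qed
  obtain d0 where d0: "d0 \<in> charts_at N (f p)"
    using charts_at_nonempty[OF MN(2) mdiff_at_in_topspace(2)[OF f]] by blast
  have "topcontinuous_at (base M) (base P) (g \<circ> f) p"
    using f g unfolding mdiff_at_def topcontinuous_at_def Pi_iff o_def by (metis (no_types, lifting))
  then show "mdiff_at M P (g \<circ> f) p"
    using D d0 unfolding mdiff_at_def differentiable_def by (metis comp_apply)
  show "mderiv c k (g \<circ> f) p = mderiv d k g (f p) \<circ> mderiv c d f p"
    if "c \<in> charts_at M p" "d \<in> charts_at N (f p)" "k \<in> charts_at P (g (f p))"
    unfolding mderiv_def[of c k] by (rule frechetI[OF D[OF that]])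
qed

lemma mdiff_at_cong:
  assumes M: "charted_space M" and f: "mdiff_at M N f p" and eq: "\<And>q. q \<in> topspace (base M) \<Longrightarrow> f q = g q"
  shows "mdiff_at M N g p"
    and "c \<in> charts_at M p \<Longrightarrow> d \<in> charts_at N (f p) \<Longrightarrow> mderiv c d g p = mderiv c d f p"
proof -
  have p: "p \<in> topspace (base M)" using mdiff_at_in_topspace(1)[OF f] .
  have D: "((snd d \<circ> g \<circ> chart_inv c) has_derivative mderiv c d f p) (at (snd c p))"
    if c: "c \<in> charts_at M p" and d: "d \<in> charts_at N (f p)" for c d
  proof (rule has_derivative_transform_within_open[OF mdiff_atD[OF f c d]])
    note cD = charts_atD[OF M c]
    show "open (snd c ` fst c)" using cD(1) unfolding proper_chart_def by blast
    show "snd c p \<in> snd c ` fst c" using cD by blast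
    show "(snd d \<circ> f \<circ> chart_inv c) u = (snd d \<circ> g \<circ> chart_inv c) u" if "u \<in> snd c ` fst c" for u
      using eq chart_inv_in[OF that] openin_subset[OF cD(3)] by auto
  qed
  have "topcontinuous_at (base M) (base N) g p"
    unfolding topcontinuous_at_def
  proof (intro conjI allI impI p)
    show "g \<in> topspace (base M) \<rightarrow> topspace (base N)"
      using f eq unfolding mdiff_at_def topcontinuous_at_def by (metis Pi_cong)
    fix V assume "openin (base N) V \<and> g p \<in> V"
    then obtain U where "openin (base M) U" "p \<in> U" "\<forall>y\<in>U. f y \<in> V"
      using f eq[OF p] unfolding mdiff_at_def topcontinuous_at_def by metis
    then show "\<exists>U. openin (base M) U \<and> p \<in> U \<and> (\<forall>y\<in>U. g y \<in> V)"
      using eq openin_subset by (metis subsetD)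
  qed
  then show "mdiff_at M N g p"
    using D eq[OF p] unfolding mdiff_at_def differentiable_def by metis
  show "mderiv c d g p = mderiv c d f p" if "c \<in> charts_at M p" "d \<in> charts_at N (f p)"
    unfolding mderiv_def[of c d g] by (rule frechetI[OF D[OF that]])
qed

lemma mdiff_at_Pair:
  assumes M: "charted_space M" and N: "charted_space N" and P: "charted_space P"
    and f: "mdiff_at M N f p" and g: "mdiff_at M P g p"
  shows "mdiff_at M (prod_manifold N P) (\<lambda>q. (f q, g q)) p"
    and "c \<in> charts_at M p \<Longrightarrow> d \<in> charts_at N (f p) \<Longrightarrow> k \<in> charts_at P (g p) \<Longrightarrow>
      mderiv c (prod_chart d k) (\<lambda>q. (f q, g q)) p v = (mderiv c d f p v, mderiv c k g p v)"
proof -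
  have D: "((snd (prod_chart d k) \<circ> (\<lambda>q. (f q, g q)) \<circ> chart_inv c) has_derivative
      (\<lambda>v. (mderiv c d f p v, mderiv c k g p v))) (at (snd c p))"
    if "c \<in> charts_at M p" "d \<in> charts_at N (f p)" "k \<in> charts_at P (g p)" for c d k
    using has_derivative_Pair[OF mdiff_atD[OF f that(1,2)] mdiff_atD[OF g that(1,3)]] by (simp add: o_def)
  have "topcontinuous_at (base M) (prod_topology (base N) (base P)) (\<lambda>q. (f q, g q)) p"
    using f g unfolding mdiff_at_def topcontinuous_at_atin by (auto simp: limitin_pairwise o_def Pi_iff)
  then show "mdiff_at M (prod_manifold N P) (\<lambda>q. (f q, g q)) p"
    using D unfolding mdiff_at_def differentiable_def charts_at_prod
    by (fastforce simp: prod_manifold_def)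
  show "mderiv c (prod_chart d k) (\<lambda>q. (f q, g q)) p v = (mderiv c d f p v, mderiv c k g p v)"
    if "c \<in> charts_at M p" "d \<in> charts_at N (f p)" "k \<in> charts_at P (g p)"
    unfolding mderiv_def[of c "prod_chart d k"] by (subst frechetI[OF D[OF that]]) simp
qed

lemma mdiff_at_const:
  fixes M :: "('p, 'e::real_normed_vector) manifold" and N :: "('q, 'f::real_normed_vector) manifold"
    and c :: "('p, 'e) chart" and d :: "('q, 'f) chart"
  assumes M: "charted_space M" and "p \<in> topspace (base M)" "a \<in> topspace (base N)"
  shows "mdiff_at M N (\<lambda>_. a) p" and "mderiv c d (\<lambda>_. a) p = (\<lambda>_. 0)"
proof -
  have D: "(snd d \<circ> (\<lambda>_. a) \<circ> chart_inv c has_derivative (\<lambda>_. 0)) F" for c :: "('p, 'e) chart" and d :: "('q, 'f) chart" and F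
    by (simp add: o_def)
  then show "mdiff_at M N (\<lambda>_. a) p"
    using assms unfolding mdiff_at_def differentiable_def topcontinuous_at_def by (metis (no_types, lifting) Pi_I openin_topspace)
  show "mderiv c d (\<lambda>_. a) p = (\<lambda>_. 0)" unfolding mderiv_def by (rule frechetI[OF D])
qed

lemma mdiff_at_id:
  assumes M: "smooth_manifold M" and "p \<in> topspace (base M)"
  shows "mdiff_at M M (\<lambda>q. q) p" and "c \<in> charts_at M p \<Longrightarrow> mderiv c c (\<lambda>q. q) p = (\<lambda>v. v)"
proof -
  have ch: "charted_space M" by (rule smooth_manifold_charted[OF M])
  have "(snd d \<circ> (\<lambda>q. q) \<circ> chart_inv c) differentiable at (snd c p)"
    if c: "c \<in> charts_at M p" and d: "d \<in> charts_at M p" for c d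
  proof -
    have "smooth_on (snd c ` (fst c \<inter> fst d)) (snd d \<circ> chart_inv c)"
      using M charts_atD(4)[OF ch c] charts_atD(4)[OF ch d] unfolding smooth_manifold_def by blast
    then have "Ck_on (Suc 0) (snd c ` (fst c \<inter> fst d)) (snd d \<circ> chart_inv c)" unfolding smooth_on_def by blast
    then show ?thesis using charts_atD(2)[OF ch c] charts_atD(2)[OF ch d] by (auto simp: o_def)
  qed
  then show "mdiff_at M M (\<lambda>q. q) p"
    using assms unfolding mdiff_at_def topcontinuous_at_def by auto
  assume c: "c \<in> charts_at M p"
  have "((snd c \<circ> (\<lambda>q. q) \<circ> chart_inv c) has_derivative (\<lambda>v. v)) (at (snd c p))"
    by (rule has_derivative_transform_within_open[OF has_derivative_ident, of "snd c ` fst c"])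
      (use charts_atD[OF ch c] chart_inv_right[of _ c] in \<open>auto simp: proper_chart_def simp del: imageE\<close>)
  then show "mderiv c c (\<lambda>q. q) p = (\<lambda>v. v)" unfolding mderiv_def by (rule frechetI)
qed

lemma smooth_map_chart:
  assumes M: "charted_space M" and N: "charted_space N" and f: "smooth_map M N f"
    and c: "c \<in> atlas M" and d: "d \<in> atlas N"
  shows "open (snd c ` (fst c \<inter> f -` fst d))" and "smooth_on (snd c ` (fst c \<inter> f -` fst d)) (snd d \<circ> f \<circ> chart_inv c)"
proof -
  have pc: "proper_chart (base M) c" "openin (base N) (fst d)"
    using M N c d unfolding charted_space_def proper_chart_def by blast+
  have "openin (base M) {q \<in> topspace (base M). f q \<in> fst d}"
    using f pc unfolding smooth_map_def continuous_map_def by blast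
  from chart_image_open[OF pc(1) this]
  have "open (snd c ` (fst c \<inter> {q \<in> topspace (base M). f q \<in> fst d}))" .
  also have "fst c \<inter> {q \<in> topspace (base M). f q \<in> fst d} = fst c \<inter> f -` fst d"
  proof -
    have "fst c \<subseteq> topspace (base M)" using pc(1) openin_subset unfolding proper_chart_def by metis
    then show ?thesis by auto
  qed
  finally show "open (snd c ` (fst c \<inter> f -` fst d))" .
  show "smooth_on (snd c ` (fst c \<inter> f -` fst d)) (snd d \<circ> f \<circ> chart_inv c)"
    using f c d unfolding smooth_map_def by blast
qed

lemma smooth_map_imp_mdiff_at:
  assumes M: "charted_space M" and N: "charted_space N" and f: "smooth_map M N f" and p: "p \<in> topspace (base M)"
  shows "mdiff_at M N f p"
proof -
  have "topcontinuous_at (base M) (base N) f p"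
    using f p unfolding smooth_map_def continuous_map_eq_topcontinuous_at by blast
  moreover have "(snd d \<circ> f \<circ> chart_inv c) differentiable at (snd c p)"
    if c: "c \<in> charts_at M p" and d: "d \<in> charts_at N (f p)" for c d
  proof -
    have "Ck_on (Suc 0) (snd c ` (fst c \<inter> f -` fst d)) (snd d \<circ> f \<circ> chart_inv c)"
      using smooth_map_chart(2)[OF M N f charts_atD(4)[OF M c] charts_atD(4)[OF N d]]
      unfolding smooth_on_def by blast
    then show ?thesis using charts_atD(2)[OF M c] charts_atD(2)[OF N d] by auto
  qed
  ultimately show ?thesis unfolding mdiff_at_def by blast
qed

section \<open>Velocities of curves and tangent vectors\<close>

lemma curve_has_vector_derivative:
  assumes "mdiff_at real_line M \<gamma> t" "d \<in> charts_at M (\<gamma> t)"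
  shows "((snd d \<circ> \<gamma>) has_vector_derivative mderiv real_chart d \<gamma> t 1) (at t)"
proof -
  have D: "((snd d \<circ> \<gamma>) has_derivative mderiv real_chart d \<gamma> t) (at t)"
    using mdiff_atD[OF assms(1) _ assms(2), of real_chart] by (simp add: o_def)
  have "mderiv real_chart d \<gamma> t = (\<lambda>h. h *\<^sub>R mderiv real_chart d \<gamma> t 1)"
  proof
    fix h
    show "mderiv real_chart d \<gamma> t h = h *\<^sub>R mderiv real_chart d \<gamma> t 1"
      using linear_scale[OF has_derivative_linear[OF D], of h 1] by simp
  qed
  then show ?thesis unfolding has_vector_derivative_def by (rule has_derivative_eq_rhs[OF D])
qed

lemma curve_velocity_eq_mderiv:
  assumes "mdiff_at real_line M \<gamma> t" "d \<in> charts_at M (\<gamma> t)"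
  shows "curve_velocity M \<gamma> t d = mderiv real_chart d \<gamma> t 1"
  unfolding curve_velocity_def using assms(2)
  by (simp add: vector_derivative_at[OF curve_has_vector_derivative[OF assms]])

lemma curve_stays_in_open:
  assumes "topcontinuous_at euclideanreal (base M) \<gamma> t" "openin (base M) V" "\<gamma> t \<in> V"
  obtains T where "open T" "t \<in> T" "\<And>s. s \<in> T \<Longrightarrow> \<gamma> s \<in> V"
  using assms unfolding topcontinuous_at_def by (metis open_openin)

lemma curve_velocity_compose:
  assumes M: "charted_space M" and \<gamma>: "mdiff_at real_line M \<gamma> t" and f: "mdiff_at M N f (\<gamma> t)"
    and c: "c \<in> charts_at M (\<gamma> t)" and d: "d \<in> charts_at N (f (\<gamma> t))"
  shows "curve_velocity N (\<lambda>s. f (\<gamma> s)) t d = mderiv c d f (\<gamma> t) (curve_velocity M \<gamma> t c)"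
proof -
  note comp = mdiff_at_compose[OF real_line_charted M \<gamma> f, unfolded comp_def]
  have "curve_velocity N (\<lambda>s. f (\<gamma> s)) t d = mderiv real_chart d (\<lambda>s. f (\<gamma> s)) t 1"
    by (rule curve_velocity_eq_mderiv[OF comp(1) d])
  also have "\<dots> = mderiv c d f (\<gamma> t) (mderiv real_chart c \<gamma> t 1)"
    using comp(2)[OF _ c d, of real_chart] by simp
  finally show ?thesis by (simp add: curve_velocity_eq_mderiv[OF \<gamma> c])
qed

text \<open>
  First-order contact of curves at time 0. It is preserved by all operations on curves that are
  induced by differentiable maps, which makes it suitable for showing that a velocity does not depend
  on the curve chosen.
\<close>
definition same_velocity :: "('g, 'e::real_normed_vector) manifold \<Rightarrow> (real \<Rightarrow> 'g) \<Rightarrow> (real \<Rightarrow> 'g) \<Rightarrow> bool" where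
  "same_velocity M \<gamma> \<eta> \<longleftrightarrow> mdiff_at real_line M \<gamma> 0 \<and> mdiff_at real_line M \<eta> 0 \<and> \<gamma> 0 = \<eta> 0 \<and>
     curve_velocity M \<gamma> 0 = curve_velocity M \<eta> 0"

lemma same_velocity_compose:
  assumes M: "charted_space M" and s: "same_velocity M \<gamma> \<eta>" and f: "mdiff_at M N f (\<gamma> 0)"
  shows "same_velocity N (\<lambda>s. f (\<gamma> s)) (\<lambda>s. f (\<eta> s))"
proof -
  have \<gamma>: "mdiff_at real_line M \<gamma> 0" and \<eta>: "mdiff_at real_line M \<eta> 0" and eq: "\<eta> 0 = \<gamma> 0"
    and vel: "curve_velocity M \<gamma> 0 = curve_velocity M \<eta> 0"
    using s unfolding same_velocity_def by simp_all
  obtain c where c: "c \<in> charts_at M (\<gamma> 0)"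
    using charts_at_nonempty[OF M mdiff_at_in_topspace(2)[OF \<gamma>]] by blast
  have "curve_velocity N (\<lambda>s. f (\<gamma> s)) 0 d = curve_velocity N (\<lambda>s. f (\<eta> s)) 0 d" for d
  proof (cases "d \<in> charts_at N (f (\<gamma> 0))")
    case True
    then show ?thesis
      using curve_velocity_compose[OF M \<gamma> f c, of d] curve_velocity_compose[OF M \<eta>, of N f c d] f c eq vel by simp
  qed (simp add: curve_velocity_def eq)
  then show ?thesis
    using mdiff_at_compose(1)[OF real_line_charted M \<gamma> f] mdiff_at_compose(1)[OF real_line_charted M \<eta>, of N f] f eq
    unfolding same_velocity_def comp_def by auto
qed

lemma tangent_spaceD:
  assumes v: "v \<in> tangent_space M p" and c: "c \<in> charts_at M p" and d: "d \<in> charts_at M p"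
  shows "v d = mderiv c d (\<lambda>q. q) p (v c)"
proof -
  have "v d = frechet_derivative (snd d \<circ> chart_inv c) (at (snd c p)) (v c)"
    using assms unfolding tangent_space_def by blast
  then show ?thesis unfolding mderiv_def by (simp add: o_def)
qed

text \<open>
  \<open>tangent_map\<close> uses an arbitrary chart at \<open>p\<close>; by the transformation law of tangent vectors any other
  chart gives the same.
\<close>
lemma tangent_map_chart:
  assumes M: "smooth_manifold M" and f: "mdiff_at M N f p"
    and v: "v \<in> tangent_space M p" and c: "c \<in> charts_at M p" and d: "d \<in> charts_at N (f p)"
  shows "tangent_map M N f p v d = mderiv c d f p (v c)"
proof -
  note ch = smooth_manifold_charted[OF M]
  define c0 where "c0 = (SOME c. c \<in> charts_at M p)"
  have c0: "c0 \<in> charts_at M p" unfolding c0_def by (rule someI[of _ c]) (rule c)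
  have p: "p \<in> topspace (base M)" using mdiff_at_in_topspace(1)[OF f] .
  have "tangent_map M N f p v d = mderiv c0 d f p (v c0)"
    unfolding tangent_map_def mderiv_def using d by (simp add: c0_def Let_def)
  also have "v c0 = mderiv c c0 (\<lambda>q. q) p (v c)" by (rule tangent_spaceD[OF v c c0])
  also have "mderiv c0 d f p (mderiv c c0 (\<lambda>q. q) p (v c)) = mderiv c d f p (v c)"
    using mdiff_at_compose(2)[OF ch ch mdiff_at_id(1)[OF M p] f c c0 d] by (simp add: o_def fun_eq_iff)
  finally show ?thesis .
qed

lemma tangent_map_outside: "d \<notin> charts_at N (f p) \<Longrightarrow> tangent_map M N f p v d = 0"
  unfolding tangent_map_def by simp

lemma tangent_spaceI_curve:
  assumes M: "smooth_manifold M" and \<gamma>: "mdiff_at real_line M \<gamma> t"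
  shows "curve_velocity M \<gamma> t \<in> tangent_space M (\<gamma> t)"
proof -
  note ch = smooth_manifold_charted[OF M]
  have "curve_velocity M \<gamma> t d = mderiv c d (\<lambda>q. q) (\<gamma> t) (curve_velocity M \<gamma> t c)"
    if c: "c \<in> charts_at M (\<gamma> t)" and d: "d \<in> charts_at M (\<gamma> t)" for c d
    using mdiff_at_compose(2)[OF real_line_charted ch \<gamma> mdiff_at_id(1)[OF M mdiff_at_in_topspace(2)[OF \<gamma>]] _ c d, of real_chart]
    by (simp add: curve_velocity_eq_mderiv[OF \<gamma> c] curve_velocity_eq_mderiv[OF \<gamma> d] o_def fun_eq_iff)
  moreover have "curve_velocity M \<gamma> t d = 0" if "d \<notin> charts_at M (\<gamma> t)" for d
    using that by (simp add: curve_velocity_def)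
  ultimately show ?thesis
    unfolding tangent_space_def mderiv_def comp_def by blast
qed

lemma tangent_space_outside: "v \<in> tangent_space M p \<Longrightarrow> d \<notin> charts_at M p \<Longrightarrow> v d = 0"
  unfolding tangent_space_def by blast

lemma tangent_spaceI:
  assumes "\<And>c. c \<notin> charts_at M p \<Longrightarrow> v c = 0"
    and "\<And>c d. c \<in> charts_at M p \<Longrightarrow> d \<in> charts_at M p \<Longrightarrow> v d = mderiv c d (\<lambda>q. q) p (v c)"
  shows "v \<in> tangent_space M p"
  using assms unfolding tangent_space_def mderiv_def comp_def by blast

lemma tangent_vector_eqI:
  assumes "v \<in> tangent_space M p" "w \<in> tangent_space M p" "c \<in> charts_at M p" "v c = w c"
  shows "v = w"
proof
  fix d
  show "v d = w d"
  proof (cases "d \<in> charts_at M p")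
    case True
    then show ?thesis using tangent_spaceD[OF assms(1,3)] tangent_spaceD[OF assms(2,3)] assms(4) by simp
  next
    case False
    then show ?thesis using tangent_space_outside assms(1,2) by metis
  qed
qed

section \<open>Additive curves in groups\<close>

context group begin

lemma local_additive_pow:
  assumes \<gamma>: "\<And>s t. \<bar>s\<bar> \<le> \<delta> \<Longrightarrow> \<bar>t\<bar> \<le> \<delta> \<Longrightarrow> \<gamma> (s + t) = \<gamma> s \<otimes> \<gamma> t"
    and car: "\<And>t. \<bar>t\<bar> \<le> \<delta> \<Longrightarrow> \<gamma> t \<in> carrier G"
    and t: "real n * \<bar>t\<bar> \<le> \<delta>"
  shows "\<gamma> (real n * t) = \<gamma> t [^] n"
  using t
proof (induction n)
  case 0
  then have "\<gamma> 0 = \<gamma> 0 \<otimes> \<gamma> 0" "\<gamma> 0 \<in> carrier G" using \<gamma>[of 0 0] car[of 0] by simp_all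
  then show ?case by (simp add: l_cancel_one' )
next
  case (Suc n)
  have 1: "real n * \<bar>t\<bar> + \<bar>t\<bar> \<le> \<delta>" using Suc.prems by (simp add: algebra_simps)
  have 2: "\<bar>real n * t\<bar> \<le> \<delta>" "\<bar>t\<bar> \<le> \<delta>"
    using 1 by (simp_all add: abs_mult) (smt (verit) mult_nonneg_nonneg of_nat_0_le_iff abs_ge_zero)+
  have "\<gamma> (real (Suc n) * t) = \<gamma> (real n * t + t)" by (simp add: algebra_simps)
  also have "\<dots> = \<gamma> (real n * t) \<otimes> \<gamma> t" by (rule \<gamma>[OF 2])
  also have "\<gamma> (real n * t) = \<gamma> t [^] n" using 1 by (intro Suc.IH) simp
  finally show ?case by simp
qed

text \<open>
  The extension is \<open>\<Gamma> t = \<gamma> (t / n) ^ n\<close> for any \<open>n\<close> that is large enough. It does not depend on \<open>n\<close>,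
  as two subdivisions of \<open>t\<close> have a common refinement, and it is additive because the values of \<open>\<gamma>\<close> at
  short times commute.
\<close>
lemma local_additive_extends:
  assumes "\<delta> > 0"
    and \<gamma>: "\<And>s t. \<bar>s\<bar> \<le> \<delta> \<Longrightarrow> \<bar>t\<bar> \<le> \<delta> \<Longrightarrow> \<gamma> (s + t) = \<gamma> s \<otimes> \<gamma> t"
    and car: "\<And>t. \<bar>t\<bar> \<le> \<delta> \<Longrightarrow> \<gamma> t \<in> carrier G"
  obtains \<Gamma> :: "real \<Rightarrow> 'a" where "\<And>s t. \<Gamma> (s + t) = \<Gamma> s \<otimes> \<Gamma> t" "\<And>t. \<Gamma> t \<in> carrier G"
    "\<And>t. \<bar>t\<bar> \<le> \<delta> \<Longrightarrow> \<Gamma> t = \<gamma> t"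
proof -
  note pow = local_additive_pow[of \<delta> \<gamma>, OF \<gamma> car]
  define N where "N t = Suc (nat \<lceil>\<bar>t\<bar> / \<delta>\<rceil>)" for t :: real
  have fine: "\<bar>t / real n\<bar> \<le> \<delta>" if "N t \<le> n" for t n
  proof -
    have "\<bar>t\<bar> / \<delta> \<le> real (N t)" unfolding N_def by linarith
    also have "\<dots> \<le> real n" using that by simp
    finally have "\<bar>t\<bar> \<le> real n * \<delta>" using \<open>\<delta> > 0\<close> by (simp add: pos_divide_le_eq)
    moreover have "real n > 0" using that unfolding N_def by simp
    ultimately show ?thesis by (simp add: pos_divide_le_eq mult.commute)
  qed
  have Npos: "N t > 0" for t unfolding N_def by simp
  define \<Gamma> where "\<Gamma> t = \<gamma> (t / real (N t)) [^] N t" for t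
  have sub: "\<gamma> (t / real n) = \<gamma> (t / real (n * m)) [^] m" if "\<bar>t / real n\<bar> \<le> \<delta>" "m > 0" for t n m
  proof -
    have eq: "t / real n = real m * (t / real (n * m))" using that by simp
    have "\<gamma> (t / real n) = \<gamma> (real m * (t / real (n * m)))" by (rule arg_cong[OF eq])
    also have "\<dots> = \<gamma> (t / real (n * m)) [^] m"
    proof (rule pow)
      have "real m * \<bar>t / real (n * m)\<bar> = \<bar>real m * (t / real (n * m))\<bar>" by (simp add: abs_mult)
      then show "real m * \<bar>t / real (n * m)\<bar> \<le> \<delta>" using that(1) unfolding eq[symmetric] by simp
    qed
    finally show ?thesis .
  qed
  have \<Gamma>n: "\<Gamma> t = \<gamma> (t / real n) [^] n" if n: "n > 0" "\<bar>t / real n\<bar> \<le> \<delta>" for t n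
  proof -
    have le: "\<bar>t / real (N t * n)\<bar> \<le> \<delta>"
    proof -
      have "\<bar>t / real (N t * n)\<bar> = \<bar>t / real n\<bar> / real (N t)" by (simp add: mult.commute)
      also have "\<dots> \<le> \<bar>t / real n\<bar> / 1" using Npos[of t] by (intro divide_left_mono) auto
      finally show ?thesis using n by simp
    qed
    have "\<Gamma> t = (\<gamma> (t / real (N t * n)) [^] n) [^] N t"
      unfolding \<Gamma>_def using sub[OF fine[OF order_refl] n(1), of t] by simp
    also have "\<dots> = (\<gamma> (t / real (n * N t)) [^] N t) [^] n"
      using car[OF le] by (simp add: nat_pow_pow mult.commute)
    also have "\<dots> = \<gamma> (t / real n) [^] n"
      using sub[OF n(2) Npos[of t]] by simp
    finally show ?thesis .
  qed
  show ?thesis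
  proof (rule that[of \<Gamma>])
    fix s t
    define n where "n = N s + N t + N (s + t)"
    have n: "n > 0" unfolding n_def using Npos by simp
    have le: "\<bar>s / real n\<bar> \<le> \<delta>" "\<bar>t / real n\<bar> \<le> \<delta>" "\<bar>(s + t) / real n\<bar> \<le> \<delta>"
      by (rule fine; simp add: n_def)+
    have comm: "\<gamma> (s / real n) \<otimes> \<gamma> (t / real n) = \<gamma> (t / real n) \<otimes> \<gamma> (s / real n)"
      using \<gamma>[OF le(1,2)] \<gamma>[OF le(2,1)] by (simp add: add.commute)
    have "\<Gamma> (s + t) = \<gamma> (s / real n + t / real n) [^] n"
      using \<Gamma>n[OF n le(3)] by (simp add: add_divide_distrib)
    also have "\<dots> = \<gamma> (s / real n) [^] n \<otimes> \<gamma> (t / real n) [^] n"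
      unfolding \<gamma>[OF le(1,2)] by (rule pow_mult_distrib[OF comm car[OF le(1)] car[OF le(2)]])
    also have "\<dots> = \<Gamma> s \<otimes> \<Gamma> t" using \<Gamma>n[OF n le(1)] \<Gamma>n[OF n le(2)] by simp
    finally show "\<Gamma> (s + t) = \<Gamma> s \<otimes> \<Gamma> t" .
  next
    show "\<Gamma> t \<in> carrier G" for t unfolding \<Gamma>_def using car[OF fine[OF order_refl]] by simp
    show "\<Gamma> t = \<gamma> t" if "\<bar>t\<bar> \<le> \<delta>" for t using \<Gamma>n[of 1 t] car[OF that] that by simp
  qed
qed

lemma additive_eqI:
  fixes \<gamma> \<eta> :: "real \<Rightarrow> 'a"
  assumes "\<delta> > 0" and "\<And>s t. \<gamma> (s + t) = \<gamma> s \<otimes> \<gamma> t" "\<And>s t. \<eta> (s + t) = \<eta> s \<otimes> \<eta> t"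
    and "\<And>t. \<gamma> t \<in> carrier G" "\<And>t. \<eta> t \<in> carrier G" and eq: "\<And>t. \<bar>t\<bar> \<le> \<delta> \<Longrightarrow> \<gamma> t = \<eta> t"
  shows "\<gamma> = \<eta>"
proof
  fix t
  obtain n :: nat where n: "\<bar>t\<bar> / \<delta> < real n" using reals_Archimedean2 by blast
  moreover have "0 \<le> \<bar>t\<bar> / \<delta>" using assms(1) by simp
  ultimately have pos: "real n > 0" by linarith
  have "\<bar>t / real n\<bar> \<le> \<delta>" using n pos \<open>\<delta> > 0\<close> by (simp add: pos_divide_less_eq pos_divide_le_eq mult.commute)
  moreover have "\<gamma> (real n * (t / real n)) = \<gamma> (t / real n) [^] n"
    by (rule local_additive_pow[where \<delta> = "real n * \<bar>t / real n\<bar>"]) (use assms in auto)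
  moreover have "\<eta> (real n * (t / real n)) = \<eta> (t / real n) [^] n"
    by (rule local_additive_pow[where \<delta> = "real n * \<bar>t / real n\<bar>"]) (use assms in auto)
  ultimately show "\<gamma> t = \<eta> t" using eq pos by simp
qed

end

section \<open>Lie groups in a chart at the identity\<close>

locale lie_group_on =
  fixes G :: "('g, 'm) monoid_scheme" (structure) and M :: "('g, 'e::banach) manifold"
  assumes lie: "lie_group G M"

sublocale lie_group_on \<subseteq> group G
  using lie unfolding lie_group_def by blast

context lie_group_on begin

abbreviation mult_map :: "'g \<times> 'g \<Rightarrow> 'g" where "mult_map \<equiv> \<lambda>(a, b). a \<otimes> b"

lemma smooth_M: "smooth_manifold M" and topspace_M: "topspace (base M) = carrier G"
  and smooth_mult: "smooth_map (prod_manifold M M) M mult_map" and smooth_inv: "smooth_map M M (\<lambda>a. inv a)"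
  using lie unfolding lie_group_def by blast+

lemma charted: "charted_space M"
  by (rule smooth_manifold_charted[OF smooth_M])

lemma finite_dim_model: "finite_dim TYPE('e)"
  by (rule smooth_manifold_finite_dim[OF smooth_M])

lemma charted2: "charted_space (prod_manifold M M)"
  by (rule prod_manifold_charted[OF charted charted])

lemma ex_chart_at: "a \<in> carrier G \<Longrightarrow> \<exists>c. c \<in> charts_at M a"
  using charts_at_nonempty[OF charted] by (simp add: topspace_M)

lemma chart_carrier: "c \<in> charts_at M a \<Longrightarrow> q \<in> fst c \<Longrightarrow> q \<in> carrier G"
  using openin_subset[OF charts_atD(3)[OF charted, of c a]] topspace_M by blast

lemma mdiff_at_carrier: "mdiff_at N M f p \<Longrightarrow> f p \<in> carrier G"
  using mdiff_at_in_topspace(2)[of N M f p] topspace_M by simp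

lemma mdiff_mult_map:
  assumes "a \<in> carrier G" "b \<in> carrier G"
  shows "mdiff_at (prod_manifold M M) M mult_map (a, b)"
  by (rule smooth_map_imp_mdiff_at[OF charted2 charted smooth_mult])
    (use assms in \<open>simp add: prod_manifold_def topspace_M\<close>)

lemma mdiff_at_mult:
  assumes N: "charted_space N" and f: "mdiff_at N M f p" and g: "mdiff_at N M g p"
  shows "mdiff_at N M (\<lambda>q. f q \<otimes> g q) p"
    and "c \<in> charts_at N p \<Longrightarrow> d \<in> charts_at M (f p) \<Longrightarrow> d' \<in> charts_at M (g p) \<Longrightarrow> k \<in> charts_at M (f p \<otimes> g p) \<Longrightarrow>
      mderiv c k (\<lambda>q. f q \<otimes> g q) p v
        = mderiv (prod_chart d d') k mult_map (f p, g p) (mderiv c d f p v, mderiv c d' g p v)"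
proof -
  have eq: "mult_map \<circ> (\<lambda>q. (f q, g q)) = (\<lambda>q. f q \<otimes> g q)" by (simp add: o_def)
  note P = mdiff_at_Pair[OF N charted charted f g]
  note mm = mdiff_mult_map[OF mdiff_at_carrier[OF f] mdiff_at_carrier[OF g]]
  note comp = mdiff_at_compose[OF N charted2 P(1) mm, unfolded eq]
  show "mdiff_at N M (\<lambda>q. f q \<otimes> g q) p" by (rule comp(1))
  show "mderiv c k (\<lambda>q. f q \<otimes> g q) p v
        = mderiv (prod_chart d d') k mult_map (f p, g p) (mderiv c d f p v, mderiv c d' g p v)"
    if "c \<in> charts_at N p" "d \<in> charts_at M (f p)" "d' \<in> charts_at M (g p)" "k \<in> charts_at M (f p \<otimes> g p)"
    using comp(2)[OF that(1) prod_chart_in_charts_at[OF that(2,3)]] that P(2)[OF that(1-3)] by simp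
qed

lemma mdiff_at_inv:
  assumes N: "charted_space N" and f: "mdiff_at N M f p"
  shows "mdiff_at N M (\<lambda>q. inv (f q)) p"
proof -
  have "mdiff_at M M (\<lambda>a. inv a) (f p)"
    using smooth_map_imp_mdiff_at[OF charted charted smooth_inv] mdiff_at_in_topspace(2)[OF f] by blast
  from mdiff_at_compose(1)[OF N charted f this] show ?thesis by (simp add: o_def)
qed

end

text \<open>
  A chart at the identity turns the multiplication into a map \<open>mul\<close> that is defined and smooth on an
  open neighbourhood \<open>dom\<close> of \<open>(u0, u0)\<close>. All second-order calculations take place there.
\<close>
locale lie_group_chart = lie_group_on G M
  for G :: "('g, 'm) monoid_scheme" (structure) and M :: "('g, 'e::banach) manifold" +
  fixes c :: "('g, 'e) chart"
  assumes c: "c \<in> charts_at M \<one>"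
begin

abbreviation u0 :: 'e where "u0 \<equiv> snd c \<one>"
abbreviation ci :: "'e \<Rightarrow> 'g" where "ci \<equiv> chart_inv c"
abbreviation im :: "'e set" where "im \<equiv> snd c ` fst c"

definition dom :: "('e \<times> 'e) set" where
  "dom = {(u, w). u \<in> im \<and> w \<in> im \<and> ci u \<otimes> ci w \<in> fst c}"

definition mul :: "'e \<times> 'e \<Rightarrow> 'e" where
  "mul = (\<lambda>(u, w). snd c (ci u \<otimes> ci w))"

abbreviation Dmul :: "'e \<times> 'e \<Rightarrow> 'e \<times> 'e \<Rightarrow> 'e" where
  "Dmul p \<equiv> frechet_derivative mul (at p)"

definition left_field :: "'e \<Rightarrow> 'e \<Rightarrow> 'e" where
  "left_field x u = Dmul (u, u0) (0, x)"

lemma proper_c: "proper_chart (base M) c" and one_in_c: "\<one> \<in> fst c" and ci_u0: "ci u0 = \<one>"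
  using charts_atD[OF charted c] by blast+

lemma open_im: "open im" and u0_im: "u0 \<in> im"
  using proper_c one_in_c unfolding proper_chart_def by blast+

lemma ci_in: "u \<in> im \<Longrightarrow> ci u \<in> fst c"
  by (rule chart_inv_in)

lemma ci_carrier: "u \<in> im \<Longrightarrow> ci u \<in> carrier G"
  using ci_in chart_carrier[OF c] by blast

lemma c_ci: "u \<in> im \<Longrightarrow> snd c (ci u) = u"
  by (rule chart_inv_right)

lemma ci_c: "a \<in> fst c \<Longrightarrow> ci (snd c a) = a"
  by (rule chart_inv_left[OF proper_c])

lemma dom_smooth: "open dom" "smooth_on dom mul"
proof -
  let ?cc = "prod_chart c c"
  have atl: "?cc \<in> atlas (prod_manifold M M)" "c \<in> atlas M"
    using charts_atD(4)[OF charted2 prod_chart_in_charts_at[OF c c]] charts_atD(4)[OF charted c] by blast+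
  note sm = smooth_map_chart[OF charted2 charted smooth_mult atl]
  have im2: "snd ?cc ` (fst c \<times> fst c) = im \<times> im"
    unfolding prod_chart_def snd_conv by (rule map_prod_surj_on) simp_all
  have eq: "snd ?cc ` (fst ?cc \<inter> mult_map -` fst c) = dom"
  proof (intro equalityI subsetI)
    fix p assume "p \<in> snd ?cc ` (fst ?cc \<inter> mult_map -` fst c)"
    then obtain a b where "a \<in> fst c" "b \<in> fst c" "a \<otimes> b \<in> fst c" "p = (snd c a, snd c b)" by auto
    then show "p \<in> dom" unfolding dom_def by (simp add: ci_c)
  next
    fix p assume "p \<in> dom"
    then obtain u w where p: "p = (u, w)" and u: "u \<in> im" and w: "w \<in> im" and uw: "ci u \<otimes> ci w \<in> fst c"
      unfolding dom_def by blast
    have "p = snd ?cc (ci u, ci w)" using p u w by (simp add: c_ci)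
    moreover have "(ci u, ci w) \<in> fst ?cc \<inter> mult_map -` fst c" using u w uw by (simp add: ci_in)
    ultimately show "p \<in> snd ?cc ` (fst ?cc \<inter> mult_map -` fst c)" by blast
  qed
  show open_dom: "open dom" using sm(1) unfolding eq .
  have "(snd c \<circ> mult_map \<circ> chart_inv ?cc) p = mul p" if "p \<in> dom" for p
    using that chart_inv_prod[OF proper_c proper_c] unfolding dom_def mul_def by auto
  then show "smooth_on dom mul"
    using sm(2) Ck_on_cong[OF open_dom] unfolding eq smooth_on_def by metis
qed

lemma domD: "(u, w) \<in> dom \<Longrightarrow> u \<in> im" "(u, w) \<in> dom \<Longrightarrow> w \<in> im" "(u, w) \<in> dom \<Longrightarrow> ci u \<otimes> ci w \<in> fst c"
  unfolding dom_def by auto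

lemma ci_mul: "(u, w) \<in> dom \<Longrightarrow> ci (mul (u, w)) = ci u \<otimes> ci w"
  unfolding mul_def by (simp add: ci_c domD)

lemma mul_im: "(u, w) \<in> dom \<Longrightarrow> mul (u, w) \<in> im"
  unfolding mul_def by (simp add: domD)

lemma mul_one:
  assumes "u \<in> im"
  shows "(u, u0) \<in> dom" "(u0, u) \<in> dom" "mul (u, u0) = u" "mul (u0, u) = u"
  using assms u0_im ci_in[OF assms] ci_carrier[OF assms] unfolding dom_def mul_def
  by (simp_all add: ci_u0 c_ci)

lemma mul_differentiable: "p \<in> dom \<Longrightarrow> mul differentiable at p"
  and Dmul_differentiable: "p \<in> dom \<Longrightarrow> (\<lambda>q. Dmul q h) differentiable at p"
proof -
  have 1: "Ck_on (Suc (Suc 0)) dom mul" using dom_smooth(2) unfolding smooth_on_def by blast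
  show "mul differentiable at p" if "p \<in> dom" using 1 that by simp
  have "Ck_on (Suc 0) dom (\<lambda>q. Dmul q h)" using 1 unfolding Ck_on.simps(2)[of "Suc 0"] by blast
  then show "(\<lambda>q. Dmul q h) differentiable at p" if "p \<in> dom" using that by simp
qed

lemma mul_has_derivative: "p \<in> dom \<Longrightarrow> (mul has_derivative Dmul p) (at p)"
  by (rule has_derivative_frechet[OF mul_differentiable])

lemma Dmul_linear: "p \<in> dom \<Longrightarrow> linear (Dmul p)"
  using bounded_linear.linear[OF bounded_linear_frechet[OF mul_differentiable]] .

lemma Dmul_chain:
  assumes "(f has_derivative f') (at x)" "(g has_derivative g') (at x)" "(f x, g x) \<in> dom"
  shows "((\<lambda>y. mul (f y, g y)) has_derivative (\<lambda>h. Dmul (f x, g x) (f' h, g' h))) (at x)"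
  by (rule has_derivative_compose[where g = mul and f = "\<lambda>y. (f y, g y)" and f' = "\<lambda>h. (f' h, g' h)",
        OF has_derivative_Pair[OF assms(1,2)] mul_has_derivative[OF assms(3)]])

lemma Dmul_vector_chain:
  assumes "(f has_vector_derivative f') (at x)" "(g has_vector_derivative g') (at x)" "(f x, g x) \<in> dom"
  shows "((\<lambda>y. mul (f y, g y)) has_vector_derivative Dmul (f x, g x) (f', g')) (at x)"
proof -
  have "((\<lambda>y. mul (f y, g y)) has_derivative (\<lambda>h. Dmul (f x, g x) (h *\<^sub>R f', h *\<^sub>R g'))) (at x)"
    using assms unfolding has_vector_derivative_def by (intro Dmul_chain)
  moreover have "Dmul (f x, g x) (h *\<^sub>R f', h *\<^sub>R g') = h *\<^sub>R Dmul (f x, g x) (f', g')" for h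
    using linear_scale[OF Dmul_linear[OF assms(3)], of h "(f', g')"] by simp
  ultimately show ?thesis unfolding has_vector_derivative_def by simp
qed

text \<open>
  This is the derivative of the right translation by the identity, which is the identity map.
\<close>
lemma Dmul_right_one: "u \<in> im \<Longrightarrow> Dmul (u, u0) (x, 0) = x"
proof -
  assume u: "u \<in> im"
  have "((\<lambda>v. mul (v, u0)) has_derivative (\<lambda>h. Dmul (u, u0) (h, 0))) (at u)"
    by (rule Dmul_chain) (auto intro: mul_one u)
  moreover have "((\<lambda>v. mul (v, u0)) has_derivative (\<lambda>h. h)) (at u)"
    by (rule has_derivative_transform_within_open[OF has_derivative_ident open_im u]) (simp add: mul_one)
  ultimately have "(\<lambda>h. Dmul (u, u0) (h, 0)) = (\<lambda>h. h)" by (rule has_derivative_unique)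
  then show ?thesis by meson
qed

lemma Dmul_left_one: "u \<in> im \<Longrightarrow> Dmul (u0, u) (0, x) = x"
proof -
  assume u: "u \<in> im"
  have "((\<lambda>v. mul (u0, v)) has_derivative (\<lambda>h. Dmul (u0, u) (0, h))) (at u)"
    by (rule Dmul_chain) (auto intro: mul_one u)
  moreover have "((\<lambda>v. mul (u0, v)) has_derivative (\<lambda>h. h)) (at u)"
    by (rule has_derivative_transform_within_open[OF has_derivative_ident open_im u]) (simp add: mul_one)
  ultimately have "(\<lambda>h. Dmul (u0, u) (0, h)) = (\<lambda>h. h)" by (rule has_derivative_unique)
  then show ?thesis by meson
qed

lemma Dmul_one_one: "Dmul (u0, u0) (v, w) = v + w"
  using linear_add[OF Dmul_linear[OF mul_one(1)[OF u0_im]], of "(v, 0)" "(0, w)"]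
  by (simp add: Dmul_right_one Dmul_left_one u0_im)

lemma left_field_u0: "left_field x u0 = x"
  unfolding left_field_def by (rule Dmul_left_one[OF u0_im])

lemma mul_assoc:
  assumes "(u, v) \<in> dom" "(v, w) \<in> dom" "(u, mul (v, w)) \<in> dom" "(mul (u, v), w) \<in> dom"
  shows "mul (u, mul (v, w)) = mul (mul (u, v), w)"
proof -
  have "mul (u, mul (v, w)) = snd c (ci u \<otimes> ci (mul (v, w)))" by (simp add: mul_def)
  also have "\<dots> = snd c (ci (mul (u, v)) \<otimes> ci w)"
    using ci_carrier domD[OF assms(1)] domD[OF assms(2)] unfolding ci_mul[OF assms(1)] ci_mul[OF assms(2)]
    by (simp add: m_assoc)
  also have "\<dots> = mul (mul (u, v), w)" by (simp add: mul_def)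
  finally show ?thesis .
qed

text \<open>
  Left-invariance of the field in the chart: differentiate the associative law in its last argument at
  the identity.
\<close>
lemma left_field_invariant:
  assumes uv: "(u, v) \<in> dom"
  shows "Dmul (u, v) (0, left_field x v) = left_field x (mul (u, v))"
proof -
  note im = domD(1,2)[OF uv] mul_im[OF uv]
  have v0: "(v, u0) \<in> dom" "mul (v, u0) = v" and uv0: "(mul (u, v), u0) \<in> dom"
    using mul_one im by blast+
  have inner: "((\<lambda>w. mul (v, w)) has_derivative (\<lambda>h. Dmul (v, u0) (0, h))) (at u0)"
    by (rule Dmul_chain) (auto intro: v0)
  have "((\<lambda>w. mul (u, mul (v, w))) has_derivative (\<lambda>h. Dmul (u, mul (v, u0)) (0, Dmul (v, u0) (0, h)))) (at u0)"
    by (rule Dmul_chain[OF _ inner]) (auto simp: v0 uv)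
  then have l: "((\<lambda>w. mul (u, mul (v, w))) has_derivative (\<lambda>h. Dmul (u, v) (0, Dmul (v, u0) (0, h)))) (at u0)"
    by (simp add: v0)
  have r: "((\<lambda>w. mul (mul (u, v), w)) has_derivative (\<lambda>h. Dmul (mul (u, v), u0) (0, h))) (at u0)"
    by (rule Dmul_chain) (auto intro: uv0)
  have "((\<lambda>w. mul (mul (u, v), w)) has_derivative (\<lambda>h. Dmul (u, v) (0, Dmul (v, u0) (0, h)))) (at u0)"
  proof (rule has_derivative_transform_eventually[OF l])
    have cont: "isCont (\<lambda>w. (v, w)) u0" "isCont (\<lambda>w. (mul (u, v), w)) u0" "isCont (\<lambda>w. (u, mul (v, w))) u0"
      using has_derivative_continuous[OF inner] by (auto intro!: continuous_intros)
    have ev: "\<forall>\<^sub>F w in at u0. f w \<in> dom" if "isCont f u0" "f u0 \<in> dom" for f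
      using that dom_smooth(1) unfolding isCont_def by (metis topological_tendstoD)
    have "\<forall>\<^sub>F w in at u0. (v, w) \<in> dom \<and> (mul (u, v), w) \<in> dom \<and> (u, mul (v, w)) \<in> dom"
      using ev[OF cont(1)] ev[OF cont(2)] ev[OF cont(3)] v0 uv0 uv by (simp add: eventually_conj_iff)
    then show "\<forall>\<^sub>F w in at u0. mul (u, mul (v, w)) = mul (mul (u, v), w)"
      by (rule eventually_mono) (use mul_assoc[OF uv] in blast)
    show "mul (u, mul (v, u0)) = mul (mul (u, v), u0)" using mul_assoc[OF uv v0(1)] v0 uv uv0 by simp
  qed simp
  from has_derivative_unique[OF this r] show ?thesis unfolding left_field_def by meson
qed

lemma left_field_smooth: "Ck_on n im (left_field x)"
proof -
  have lin: "bounded_linear (\<lambda>u :: 'e. (u, 0 :: 'e))"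
    by (intro bounded_linear_Pair bounded_linear_ident bounded_linear_zero)
  have "Ck_on (Suc n) dom mul" using dom_smooth(2) unfolding smooth_on_def by blast
  then have "Ck_on n dom (\<lambda>p. Dmul p (0, x))" by simp
  then have "Ck_on n im (\<lambda>u. Dmul ((0, u0) + (u, 0)) (0, x))"
    by (rule Ck_on_compose_affine[OF open_im lin]) (simp add: mul_one)
  then show ?thesis unfolding left_field_def by simp
qed

end

section \<open>One-parameter subgroups and the exponential curve\<close>

context lie_group_on begin

lemma left_translation_chart:
  assumes a: "a \<in> carrier G" and c: "c \<in> charts_at M b" and d: "d \<in> charts_at M (a \<otimes> b)"
  obtains W where "open W" "snd c b \<in> W" "W \<subseteq> snd c ` fst c"
    "\<And>w. w \<in> W \<Longrightarrow> a \<otimes> chart_inv c w \<in> fst d" "smooth_on W (\<lambda>w. snd d (a \<otimes> chart_inv c w))"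
proof -
  obtain c' where c': "c' \<in> charts_at M a" using ex_chart_at[OF a] by blast
  note cD = charts_atD[OF charted c] and c'D = charts_atD[OF charted c'] and dD = charts_atD[OF charted d]
  let ?k = "prod_chart c' c"
  let ?O = "snd ?k ` (fst ?k \<inter> mult_map -` fst d)"
  let ?F = "snd d \<circ> mult_map \<circ> chart_inv ?k"
  note sm = smooth_map_chart[OF charted2 charted smooth_mult
      charts_atD(4)[OF charted2 prod_chart_in_charts_at[OF c' c]] dD(4)]
  define W where "W = {w. (snd c' a, w) \<in> ?O}"
  have W: "w \<in> snd c ` fst c" "a \<otimes> chart_inv c w \<in> fst d" if w: "w \<in> W" for w
  proof -
    obtain z where z: "z \<in> fst ?k \<inter> mult_map -` fst d" "(snd c' a, w) = snd ?k z"
      using w unfolding W_def by blast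
    obtain p q where zpq: "z = (p, q)" by (cases z)
    have pq: "p \<in> fst c'" "q \<in> fst c" "p \<otimes> q \<in> fst d"
      using z(1) unfolding zpq by simp_all
    have "(snd c' a, w) = (snd c' p, snd c q)" using z(2) unfolding zpq prod_chart_simps .
    then have pq': "snd c' a = snd c' p" "w = snd c q" by blast+
    have "p = chart_inv c' (snd c' a)" using chart_inv_left[OF c'D(1) pq(1)] unfolding pq'(1) by (rule sym)
    then have "p = a" unfolding c'D(6) .
    then show "w \<in> snd c ` fst c" "a \<otimes> chart_inv c w \<in> fst d"
      using pq unfolding pq'(2) chart_inv_left[OF cD(1) pq(2)] by simp_all
  qed
  have "open ((\<lambda>w. (snd c' a, w)) -` ?O)" by (intro open_vimage sm(1) continuous_intros)
  then have openW: "open W" unfolding W_def vimage_def .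
  have "(a, b) \<in> fst ?k \<inter> mult_map -` fst d" using cD c'D dD by simp
  from imageI[OF this, of "snd ?k"] have bW: "snd c b \<in> W" unfolding W_def by simp
  have lin: "bounded_linear (\<lambda>w :: 'e. (0 :: 'e, w))"
    by (intro bounded_linear_Pair bounded_linear_ident bounded_linear_zero)
  have "Ck_on n W (\<lambda>w. snd d (a \<otimes> chart_inv c w))" for n
  proof (rule Ck_on_cong[OF openW])
    show "Ck_on n W (\<lambda>w. ?F ((snd c' a, 0) + (0, w)))"
    proof (rule Ck_on_compose_affine[OF openW lin])
      show "Ck_on n ?O ?F" using sm(2) unfolding smooth_on_def by blast
      show "(snd c' a, 0) + (0, w) \<in> ?O" if "w \<in> W" for w
        using that unfolding W_def mem_Collect_eq by (simp only: add_Pair add_0_left add_0_right)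
    qed
    show "?F ((snd c' a, 0) + (0, w)) = snd d (a \<otimes> chart_inv c w)" if "w \<in> W" for w
    proof -
      have "snd c' a \<in> snd c' ` fst c'" using c'D(2) by blast
      from chart_inv_prod[OF c'D(1) cD(1) this W(1)[OF that]] show ?thesis by (simp add: c'D(6))
    qed
  qed
  then show ?thesis using that[OF openW bW] W unfolding smooth_on_def by blast
qed

lemma one_parameter_subgroupD:
  assumes "one_parameter_subgroup G M \<gamma>"
  shows "mdiff_at real_line M \<gamma> t" "\<gamma> t \<in> carrier G" "\<gamma> (s + t) = \<gamma> s \<otimes> \<gamma> t" "\<gamma> 0 = \<one>"
proof -
  show m: "mdiff_at real_line M \<gamma> t" for t
    using assms unfolding one_parameter_subgroup_def
    by (intro smooth_map_imp_mdiff_at real_line_charted charted) auto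
  show g: "\<gamma> t \<in> carrier G" for t by (rule mdiff_at_carrier[OF m])
  show a: "\<gamma> (s + t) = \<gamma> s \<otimes> \<gamma> t" for s t using assms unfolding one_parameter_subgroup_def by blast
  show "\<gamma> 0 = \<one>" using a[of 0 0] g[of 0] by (simp add: l_cancel_one')
qed

end

context lie_group_chart begin

text \<open>
  Near \<open>t\<close> the curve is the left translate by \<open>\<gamma> t\<close> of its germ at 0, and left translation maps the
  velocity \<open>x\<close> at the identity to the value of the left-invariant field.
\<close>
lemma one_parameter_subgroup_ode:
  assumes \<gamma>: "one_parameter_subgroup G M \<gamma>" and vel: "curve_velocity M \<gamma> 0 c = x" and t: "\<gamma> t \<in> fst c"
  shows "((snd c \<circ> \<gamma>) has_vector_derivative left_field x (snd c (\<gamma> t))) (at t)"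
proof -
  note D = one_parameter_subgroupD[OF \<gamma>]
  have open_c: "openin (base M) (fst c)" using proper_c unfolding proper_chart_def by blast
  obtain T where T: "open T" "t \<in> T" "\<And>s. s \<in> T \<Longrightarrow> \<gamma> s \<in> fst c"
    using curve_stays_in_open[of M \<gamma> t, OF _ open_c t] D(1)[of t] unfolding mdiff_at_def by auto
  obtain T0 where T0: "open T0" "0 \<in> T0" "\<And>s. s \<in> T0 \<Longrightarrow> \<gamma> s \<in> fst c"
    using curve_stays_in_open[of M \<gamma> 0, OF _ open_c] D(1)[of 0] D(4) one_in_c unfolding mdiff_at_def by auto
  have "((snd c \<circ> \<gamma>) has_vector_derivative x) (at 0)"
    using curve_has_vector_derivative[OF D(1)[of 0], of c] c D(4)
      curve_velocity_eq_mderiv[OF D(1)[of 0], of c] vel by simp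
  then have "((snd c \<circ> \<gamma>) has_vector_derivative x) (at (t - t))" by simp
  moreover have "((\<lambda>s. s - t) has_vector_derivative 1) (at t)"
    unfolding has_vector_derivative_def by (auto intro!: derivative_eq_intros)
  ultimately have sh: "((\<lambda>s. snd c (\<gamma> (s - t))) has_vector_derivative x) (at t)"
    using vector_diff_chain_at[of "\<lambda>s. s - t" 1 t "snd c \<circ> \<gamma>" x] by (simp add: o_def)
  have ct: "snd c (\<gamma> t) \<in> im" using t by blast
  have "((\<lambda>s. mul (snd c (\<gamma> t), snd c (\<gamma> (s - t)))) has_vector_derivative Dmul (snd c (\<gamma> t), snd c (\<gamma> (t - t))) (0, x)) (at t)"
    by (rule Dmul_vector_chain[OF has_vector_derivative_const sh]) (simp add: D(4) mul_one ct)
  then have "((\<lambda>s. mul (snd c (\<gamma> t), snd c (\<gamma> (s - t)))) has_vector_derivative left_field x (snd c (\<gamma> t))) (at t)"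
    by (simp add: D(4) left_field_def)
  then show ?thesis
  proof (rule has_vector_derivative_transform_within_open)
    let ?T = "T \<inter> (\<lambda>s. s - t) -` T0"
    show "open ?T" by (intro open_Int T open_vimage T0 continuous_intros)
    show "t \<in> ?T" using T T0 by simp
    fix s assume s: "s \<in> ?T"
    have "\<gamma> s = \<gamma> t \<otimes> \<gamma> (s - t)" using D(3)[of t "s - t"] by simp
    then show "mul (snd c (\<gamma> t), snd c (\<gamma> (s - t))) = (snd c \<circ> \<gamma>) s"
      unfolding mul_def using T0(3)[of "s - t"] s t by (simp add: ci_c)
  qed
qed

text \<open>
  Both curves solve the same differential equation near 0, and an additive curve is determined by its
  values near 0.
\<close>
lemma one_parameter_subgroup_unique:
  assumes \<gamma>: "one_parameter_subgroup G M \<gamma>" "curve_velocity M \<gamma> 0 = x"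
    and \<eta>: "one_parameter_subgroup G M \<eta>" "curve_velocity M \<eta> 0 = x"
  shows "\<gamma> = \<eta>"
proof -
  let ?X = "left_field (x c)"
  note D = one_parameter_subgroupD[OF \<gamma>(1)] and E = one_parameter_subgroupD[OF \<eta>(1)]
  obtain r L where r: "r > 0" "L \<ge> 0" "cball u0 r \<subseteq> im"
    "\<And>u v. u \<in> cball u0 r \<Longrightarrow> v \<in> cball u0 r \<Longrightarrow> norm (?X u - ?X v) \<le> L * norm (u - v)"
    using Ck_on_1_locally_Lipschitz[OF finite_dim_model open_im u0_im left_field_smooth] by metis
  let ?V = "{p \<in> fst c. snd c p \<in> ball u0 r}"
  have V: "openin (base M) ?V" "\<one> \<in> ?V"
    using chart_preimage_open[OF proper_c open_ball, of u0 r] one_in_c r(1) by simp_all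
  obtain S where S: "open S" "0 \<in> S" "\<And>s. s \<in> S \<Longrightarrow> \<gamma> s \<in> ?V"
    using curve_stays_in_open[of M \<gamma> 0, OF _ V(1)] D(1)[of 0] D(4) V(2) unfolding mdiff_at_def by auto
  obtain T where T: "open T" "0 \<in> T" "\<And>s. s \<in> T \<Longrightarrow> \<eta> s \<in> ?V"
    using curve_stays_in_open[of M \<eta> 0, OF _ V(1)] E(1)[of 0] E(4) V(2) unfolding mdiff_at_def by auto
  obtain e where e: "e > 0" "cball 0 e \<subseteq> S \<inter> T"
    using open_contains_cball[of "S \<inter> T"] S T by (metis IntI open_Int)
  define d where "d = min e (1 / (L + 1) / 2)"
  have d: "d > 0" unfolding d_def using e r by simp
  have "d * L \<le> 1 / (L + 1) / 2 * L" unfolding d_def using r by (intro mult_right_mono) auto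
  also have "\<dots> < 1" using r(2) by (simp add: divide_simps)
  finally have dL: "d * L < 1" .
  have near: "s \<in> S" "s \<in> T" if "\<bar>s\<bar> \<le> d" for s
    using that e(2) unfolding d_def by (auto simp: subset_iff)
  have "\<gamma> t = \<eta> t" if t: "\<bar>t\<bar> \<le> d" for t
  proof -
    have "(snd c \<circ> \<gamma>) t = (snd c \<circ> \<eta>) t"
    proof (rule ode_solution_unique[OF d r(2) dL r(4), where \<phi> = "snd c \<circ> \<gamma>" and \<psi> = "snd c \<circ> \<eta>"])
      show "(snd c \<circ> \<gamma>) s \<in> cball u0 r" "(snd c \<circ> \<eta>) s \<in> cball u0 r" if "\<bar>s\<bar> \<le> d" for s
        using S(3)[OF near(1)[OF that]] T(3)[OF near(2)[OF that]] by simp_all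
      show "((snd c \<circ> \<gamma>) has_vector_derivative ?X ((snd c \<circ> \<gamma>) s)) (at s)"
        and "((snd c \<circ> \<eta>) has_vector_derivative ?X ((snd c \<circ> \<eta>) s)) (at s)" if "\<bar>s\<bar> \<le> d" for s
        using one_parameter_subgroup_ode[OF \<gamma>(1), of "x c" s] one_parameter_subgroup_ode[OF \<eta>(1), of "x c" s]
          S(3)[OF near(1)[OF that]] T(3)[OF near(2)[OF that]] \<gamma>(2) \<eta>(2) by simp_all
      show "(snd c \<circ> \<gamma>) 0 = (snd c \<circ> \<eta>) 0" using D(4) E(4) by simp
    qed (use t in auto)
    then have "ci (snd c (\<gamma> t)) = ci (snd c (\<eta> t))" by simp
    then show ?thesis using ci_c S(3)[OF near(1)[OF t]] T(3)[OF near(2)[OF t]] by simp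
  qed
  then show ?thesis by (rule additive_eqI[OF d D(3) E(3) D(2) E(2)])
qed

text \<open>
  A short integral curve \<open>\<phi>\<close> of the left-invariant field satisfies \<open>\<phi> (s + t) = \<phi> s \<phi> t\<close>, since both
  sides are, as functions of \<open>t\<close>, integral curves through \<open>\<phi> s\<close>. Its extension to an additive curve \<open>\<Gamma>\<close>
  is smooth, since near \<open>t0\<close> it is the left translate by \<open>\<Gamma> t0\<close> of \<open>\<phi>\<close>.
\<close>
lemma one_parameter_subgroup_exists:
  assumes x: "x \<in> lie_alg G M"
  obtains \<Gamma> where "one_parameter_subgroup G M \<Gamma>" "curve_velocity M \<Gamma> 0 = x"
proof -
  let ?X = "left_field (x c)"
  obtain r L where r: "r > 0" "L \<ge> 0" "cball u0 r \<subseteq> im"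
    "\<And>u v. u \<in> cball u0 r \<Longrightarrow> v \<in> cball u0 r \<Longrightarrow> norm (?X u - ?X v) \<le> L * norm (u - v)"
    using Ck_on_1_locally_Lipschitz[OF finite_dim_model open_im u0_im left_field_smooth] by metis
  obtain e \<phi> where e: "e > 0" and \<phi>0: "\<phi> 0 = u0" and \<phi>r: "\<And>t. \<bar>t\<bar> < e \<Longrightarrow> \<phi> t \<in> cball u0 r"
    and \<phi>': "\<And>t. \<bar>t\<bar> < e \<Longrightarrow> (\<phi> has_vector_derivative ?X (\<phi> t)) (at t)"
    using ode_solution_exists[OF r(1,2,4)] by metis
  have \<phi>im: "\<phi> t \<in> im" if "\<bar>t\<bar> < e" for t using \<phi>r[OF that] r(3) by blast
  have cont: "isCont \<phi> t" if "\<bar>t\<bar> < e" for t using \<phi>'[OF that] by (rule has_vector_derivative_continuous)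
  \<comment> \<open>times so short that products of two values of the solution stay in the ball\<close>
  have "isCont (\<lambda>p. mul p) (u0, u0)"
    using mul_has_derivative[OF mul_one(1)[OF u0_im]] by (rule has_derivative_continuous)
  then have "\<forall>\<^sub>F p in nhds (u0, u0). mul p \<in> ball u0 r"
    using topological_tendstoD[of mul u0 "at (u0, u0)" "ball u0 r"] r(1) mul_one(3)[OF u0_im]
    by (simp add: isCont_def eventually_nhds_conv_at)
  moreover have "\<forall>\<^sub>F p in nhds (u0, u0). p \<in> dom"
    using dom_smooth(1) mul_one(1)[OF u0_im] by (rule eventually_nhds_in_open)
  ultimately have "\<forall>\<^sub>F p in nhds (u0, u0). p \<in> dom \<and> mul p \<in> ball u0 r" by eventually_elim simp
  then obtain A B where AB: "open A" "open B" "u0 \<in> A" "u0 \<in> B" "\<And>a b. a \<in> A \<Longrightarrow> b \<in> B \<Longrightarrow> (a, b) \<in> dom \<and> mul (a, b) \<in> ball u0 r"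
    unfolding nhds_prod eventually_prod_filter eventually_nhds by metis
  have "\<forall>\<^sub>F t in nhds 0. \<phi> t \<in> A \<inter> B"
    using topological_tendstoD[of \<phi> u0 "at 0" "A \<inter> B"] cont[of 0] e AB \<phi>0
    by (auto simp: isCont_def eventually_nhds_conv_at)
  then obtain e1 where e1: "e1 > 0" "\<And>t. \<bar>t\<bar> < e1 \<Longrightarrow> \<phi> t \<in> A \<inter> B"
    unfolding eventually_nhds_metric by (auto simp: dist_real_def)
  \<comment> \<open>sums of two times stay below \<open>e\<close>, and the last bound is the one for uniqueness\<close>
  define d where "d = min (min (e1 / 2) (e / 3)) (1 / (L + 1) / 2)"
  have d: "d > 0" "d < e1" "2 * d < e" unfolding d_def using e e1 r by auto
  have "d * L \<le> 1 / (L + 1) / 2 * L" unfolding d_def using r by (intro mult_right_mono) auto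
  also have "\<dots> < 1" using r(2) by (simp add: divide_simps)
  finally have dL: "d * L < 1" .
  have pair: "(\<phi> s, \<phi> t) \<in> dom" "mul (\<phi> s, \<phi> t) \<in> cball u0 r" if "\<bar>s\<bar> \<le> d" "\<bar>t\<bar> \<le> d" for s t
    using AB(5)[of "\<phi> s" "\<phi> t"] e1(2)[of s] e1(2)[of t] that d(2) by auto
  have add: "\<phi> (s + t) = mul (\<phi> s, \<phi> t)" if s: "\<bar>s\<bar> \<le> d" and t: "\<bar>t\<bar> \<le> d" for s t
  proof (rule ode_solution_unique[OF d(1) r(2) dL r(4), where \<phi> = "\<lambda>t. \<phi> (s + t)" and \<psi> = "\<lambda>t. mul (\<phi> s, \<phi> t)"])
    fix t assume t: "\<bar>t\<bar> \<le> d"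
    have st: "\<bar>s + t\<bar> < e" and te: "\<bar>t\<bar> < e" using s t d by linarith+
    show "\<phi> (s + t) \<in> cball u0 r" by (rule \<phi>r[OF st])
    show "mul (\<phi> s, \<phi> t) \<in> cball u0 r" by (rule pair(2)[OF s t])
    have "((\<lambda>t. s + t) has_vector_derivative 1) (at t)"
      unfolding has_vector_derivative_def by (auto intro!: derivative_eq_intros)
    from vector_diff_chain_at[OF this \<phi>'[OF st]]
    show "((\<lambda>t. \<phi> (s + t)) has_vector_derivative ?X (\<phi> (s + t))) (at t)" by (simp add: o_def)
    have "((\<lambda>t. mul (\<phi> s, \<phi> t)) has_vector_derivative Dmul (\<phi> s, \<phi> t) (0, ?X (\<phi> t))) (at t)"
      by (rule Dmul_vector_chain[OF has_vector_derivative_const \<phi>'[OF te] pair(1)[OF s t]])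
    then show "((\<lambda>t. mul (\<phi> s, \<phi> t)) has_vector_derivative ?X (mul (\<phi> s, \<phi> t))) (at t)"
      by (simp add: left_field_invariant[OF pair(1)[OF s t]])
  next
    have "\<phi> s \<in> im" using s d by (intro \<phi>im) linarith
    then show "\<phi> (s + 0) = mul (\<phi> s, \<phi> 0)" by (simp add: \<phi>0 mul_one)
  qed (use t in auto)
  define \<gamma> where "\<gamma> t = ci (\<phi> t)" for t
  have \<gamma>add: "\<gamma> (s + t) = \<gamma> s \<otimes> \<gamma> t" if "\<bar>s\<bar> \<le> d" "\<bar>t\<bar> \<le> d" for s t
    unfolding \<gamma>_def add[OF that] by (rule ci_mul[OF pair(1)[OF that]])
  have \<gamma>car: "\<gamma> t \<in> carrier G" if "\<bar>t\<bar> \<le> d" for t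
    unfolding \<gamma>_def using that d by (intro ci_carrier \<phi>im) linarith
  obtain \<Gamma> where \<Gamma>: "\<And>s t. \<Gamma> (s + t) = \<Gamma> s \<otimes> \<Gamma> t" "\<And>t. \<Gamma> t \<in> carrier G" "\<And>t. \<bar>t\<bar> \<le> d \<Longrightarrow> \<Gamma> t = \<gamma> t"
    using local_additive_extends[OF d(1) \<gamma>add \<gamma>car] by metis
  have \<Gamma>0: "\<Gamma> 0 = \<one>" using \<Gamma>(3)[of 0] d(1) unfolding \<gamma>_def \<phi>0 ci_u0 by simp
  \<comment> \<open>bootstrapping: the right-hand side of the equation is as smooth as \<open>\<phi>\<close>\<close>
  have \<phi>smooth: "Ck_on n {-e<..<e} \<phi>" for n
  proof (induction n)
    case 0
    show ?case using cont by (auto intro!: continuous_at_imp_continuous_on)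
  next
    case (Suc n)
    have D: "(\<phi> has_derivative (\<lambda>h. h *\<^sub>R ?X (\<phi> t))) (at t)" if "t \<in> {-e<..<e}" for t
      using \<phi>'[of t] that by (auto simp: has_vector_derivative_def)
    have X: "Ck_on n {-e<..<e} (\<lambda>t. ?X (\<phi> t))"
      by (rule Ck_on_compose[OF finite_dim_model _ left_field_smooth Suc.IH]) (auto intro: \<phi>im)
    have "Ck_on n {-e<..<e} (\<lambda>t. frechet_derivative \<phi> (at t) h)" for h
      by (rule Ck_on_cong[OF _ Ck_on_scaleR[OF _ Ck_on_const X]]) (auto simp: frechetI[OF D])
    moreover have "\<phi> differentiable at t" if "t \<in> {-e<..<e}" for t
      using D[OF that] differentiable_def by blast
    ultimately show ?case by simp
  qed
  \<comment> \<open>left translation by \<open>\<Gamma> t0\<close> carries the smoothness of \<open>\<phi>\<close> at 0 to \<open>t0\<close>\<close>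
  have \<Gamma>near: "\<exists>T W F. open T \<and> t0 \<in> T \<and> (\<forall>n. Ck_on n T F) \<and> (\<forall>t\<in>T. \<Gamma> t \<in> fst k \<and> snd k (\<Gamma> t) = F t)"
    if k: "k \<in> charts_at M (\<Gamma> t0)" for t0 k
  proof -
    have k': "k \<in> charts_at M (\<Gamma> t0 \<otimes> \<one>)" using k \<Gamma>(2) by simp
    obtain W where W: "open W" "u0 \<in> W" "W \<subseteq> im" "\<And>w. w \<in> W \<Longrightarrow> \<Gamma> t0 \<otimes> ci w \<in> fst k"
      "smooth_on W (\<lambda>w. snd k (\<Gamma> t0 \<otimes> ci w))"
      using left_translation_chart[OF \<Gamma>(2) c k'] by metis
    let ?J = "{-d<..<d}"
    define T where "T = (\<lambda>t. - t0 + t) -` (?J \<inter> \<phi> -` W)"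
    have "continuous_on ?J \<phi>" using cont d by (auto intro!: continuous_at_imp_continuous_on)
    then have "open (?J \<inter> \<phi> -` W)" by (rule continuous_open_preimage[OF _ open_greaterThanLessThan W(1)])
    then have openT: "open T" unfolding T_def by (intro open_vimage continuous_intros)
    have "t0 \<in> T" unfolding T_def using d W(2) \<phi>0 by simp
    moreover have "Ck_on n T (\<lambda>t. snd k (\<Gamma> t0 \<otimes> ci (\<phi> (- t0 + t))))" for n
    proof (rule Ck_on_compose[where g = "\<lambda>w. snd k (\<Gamma> t0 \<otimes> ci w)" and f = "\<lambda>t. \<phi> (- t0 + t)" and T = W,
          OF finite_dim_model openT])
      show "Ck_on n W (\<lambda>w. snd k (\<Gamma> t0 \<otimes> ci w))" using W(5) unfolding smooth_on_def by blast
      show "Ck_on n T (\<lambda>t. \<phi> (- t0 + t))"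
        by (rule Ck_on_compose_affine[OF openT bounded_linear_ident \<phi>smooth]) (use d in \<open>auto simp: T_def\<close>)
    qed (auto simp: T_def)
    moreover have "\<Gamma> t = \<Gamma> t0 \<otimes> ci (\<phi> (- t0 + t))" "\<phi> (- t0 + t) \<in> W" if "t \<in> T" for t
      using \<Gamma>(1)[of t0 "- t0 + t"] \<Gamma>(3)[of "- t0 + t"] that unfolding T_def \<gamma>_def by auto
    ultimately show ?thesis using W(4) openT by metis
  qed
  have top: "topcontinuous_at euclideanreal (base M) \<Gamma> t0" for t0
    unfolding topcontinuous_at_def
  proof (intro conjI allI impI)
    show "\<Gamma> \<in> topspace euclideanreal \<rightarrow> topspace (base M)" using \<Gamma>(2) topspace_M by simp
    fix V assume V: "openin (base M) V \<and> \<Gamma> t0 \<in> V"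
    obtain k where k: "k \<in> charts_at M (\<Gamma> t0)" using ex_chart_at[OF \<Gamma>(2)] by blast
    note kD = charts_atD[OF charted k]
    obtain T F where T: "open T" "t0 \<in> T" "\<And>n. Ck_on n T F" "\<And>t. t \<in> T \<Longrightarrow> \<Gamma> t \<in> fst k \<and> snd k (\<Gamma> t) = F t"
      using \<Gamma>near[OF k] by metis
    let ?U = "snd k ` (fst k \<inter> V)"
    have "open ?U" using chart_image_open[OF kD(1)] V by blast
    then have "open (T \<inter> F -` ?U)"
      using Ck_on_imp_continuous_on[OF T(3)[of 0]] T(1) by (intro continuous_open_preimage)
    moreover have "t0 \<in> T \<inter> F -` ?U"
    proof -
      have "snd k (\<Gamma> t0) \<in> ?U" using kD(2) V by blast
      then show ?thesis using T(2) T(4)[OF T(2)] by simp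
    qed
    moreover have "\<Gamma> t \<in> V" if that': "t \<in> T \<inter> F -` ?U" for t
    proof -
      obtain p where "p \<in> fst k" "p \<in> V" "snd k (\<Gamma> t) = snd k p" "\<Gamma> t \<in> fst k"
      proof -
        have t: "t \<in> T" "F t \<in> ?U" using that' by simp_all
        then have "\<Gamma> t \<in> fst k" "snd k (\<Gamma> t) \<in> ?U" using T(4)[OF t(1)] by simp_all
        then show ?thesis using that by blast
      qed
      then show ?thesis using chart_inv_left[OF kD(1)] by metis
    qed
    ultimately show "\<exists>U. openin euclideanreal U \<and> t0 \<in> U \<and> (\<forall>y\<in>U. \<Gamma> y \<in> V)"
      using open_openin by blast
  qed simp
  have "smooth_map real_line M \<Gamma>"
    unfolding smooth_map_def
  proof (intro conjI ballI)
    show "continuous_map (base real_line) (base M) \<Gamma>"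
      using top by (simp add: continuous_map_eq_topcontinuous_at)
    fix l k assume l: "l \<in> atlas real_line" and k: "k \<in> atlas M"
    have l: "l = real_chart" using l by (simp add: real_line_def)
    have "Ck_on n (\<Gamma> -` fst k) (\<lambda>t. snd k (\<Gamma> t))" for n
    proof (rule Ck_on_local)
      fix t0 assume "t0 \<in> \<Gamma> -` fst k"
      then have "k \<in> charts_at M (\<Gamma> t0)" using k unfolding charts_at_def by simp
      then obtain T F where T: "open T" "t0 \<in> T" "Ck_on n T F" "\<And>t. t \<in> T \<Longrightarrow> snd k (\<Gamma> t) = F t"
        using \<Gamma>near by metis
      then show "\<exists>T. open T \<and> t0 \<in> T \<and> Ck_on n T (\<lambda>t. snd k (\<Gamma> t))"
        using Ck_on_cong[OF T(1,3), of "\<lambda>t. snd k (\<Gamma> t)"] by auto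
    qed
    then show "smooth_on (snd l ` (fst l \<inter> \<Gamma> -` fst k)) (snd k \<circ> \<Gamma> \<circ> chart_inv l)"
      unfolding smooth_on_def l by (simp add: o_def)
  qed
  then have one: "one_parameter_subgroup G M \<Gamma>"
    unfolding one_parameter_subgroup_def using \<Gamma>(1) by blast
  have "(\<phi> has_vector_derivative x c) (at 0)" using \<phi>'[of 0] e by (simp add: \<phi>0 left_field_u0)
  then have "((snd c \<circ> \<Gamma>) has_vector_derivative x c) (at 0)"
  proof (rule has_vector_derivative_transform_within_open)
    show "\<phi> t = (snd c \<circ> \<Gamma>) t" if "t \<in> {-d<..<d}" for t
    proof -
      have "\<bar>t\<bar> \<le> d" "\<bar>t\<bar> < e" using that d by auto
      then show ?thesis using \<Gamma>(3)[of t] c_ci[OF \<phi>im[of t]] unfolding \<gamma>_def by simp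
    qed
  qed (use d in auto)
  then have "curve_velocity M \<Gamma> 0 c = x c"
    unfolding curve_velocity_def using c by (simp add: \<Gamma>0 vector_derivative_at)
  moreover have "curve_velocity M \<Gamma> 0 \<in> tangent_space M \<one>"
    using tangent_spaceI_curve[OF smooth_M one_parameter_subgroupD(1)[OF one], of 0] by (simp add: \<Gamma>0)
  ultimately have "curve_velocity M \<Gamma> 0 = x"
    using tangent_vector_eqI[OF _ _ c] x unfolding lie_alg_def by blast
  with one show ?thesis by (rule that)
qed

end

context lie_group_on begin

lemma one_parameter_subgroup_scale:
  assumes \<gamma>: "one_parameter_subgroup G M \<gamma>"
  shows "one_parameter_subgroup G M (\<lambda>s. \<gamma> (r * s))"
    and "curve_velocity M (\<lambda>s. \<gamma> (r * s)) 0 = (\<lambda>c. r *\<^sub>R curve_velocity M \<gamma> 0 c)"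
proof -
  note D = one_parameter_subgroupD[OF \<gamma>]
  have smooth: "smooth_map real_line M \<gamma>" using \<gamma> unfolding one_parameter_subgroup_def by blast
  have "smooth_map real_line M (\<lambda>s. \<gamma> (r * s))"
    unfolding smooth_map_def
  proof (intro conjI ballI)
    have "continuous_map euclideanreal euclideanreal (\<lambda>s. r * s)" by (simp add: continuous_intros)
    moreover have "continuous_map euclideanreal (base M) \<gamma>" using smooth unfolding smooth_map_def by simp
    ultimately show "continuous_map (base real_line) (base M) (\<lambda>s. \<gamma> (r * s))"
      using continuous_map_compose[of euclideanreal euclideanreal "\<lambda>s. r * s" "base M" \<gamma>] by (simp add: o_def)
    fix l k assume l: "l \<in> atlas real_line" and k: "k \<in> atlas M"
    have l': "l = real_chart" using l by (simp add: real_line_def)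
    note sm = smooth_map_chart[OF real_line_charted charted smooth l k]
    have op: "open (\<gamma> -` fst k)" using sm(1) unfolding l' by simp
    have "open ((\<lambda>s. r * s) -` (\<gamma> -` fst k))" by (intro open_vimage op continuous_intros)
    then have op2: "open ((\<lambda>s. \<gamma> (r * s)) -` fst k)" by (simp add: vimage_def)
    have "Ck_on n ((\<lambda>s. \<gamma> (r * s)) -` fst k) (\<lambda>s. snd k (\<gamma> (0 + r * s)))" for n
      using sm(2) unfolding smooth_on_def l'
      by (intro Ck_on_compose_affine[OF op2 bounded_linear_mult_right]) (auto simp: o_def)
    then show "smooth_on (snd l ` (fst l \<inter> (\<lambda>s. \<gamma> (r * s)) -` fst k)) (snd k \<circ> (\<lambda>s. \<gamma> (r * s)) \<circ> chart_inv l)"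
      unfolding smooth_on_def l' by (simp add: o_def)
  qed
  then show one: "one_parameter_subgroup G M (\<lambda>s. \<gamma> (r * s))"
    unfolding one_parameter_subgroup_def using D(3) by (simp add: distrib_left)
  show "curve_velocity M (\<lambda>s. \<gamma> (r * s)) 0 = (\<lambda>c. r *\<^sub>R curve_velocity M \<gamma> 0 c)"
  proof
    fix c
    show "curve_velocity M (\<lambda>s. \<gamma> (r * s)) 0 c = r *\<^sub>R curve_velocity M \<gamma> 0 c"
    proof (cases "c \<in> charts_at M \<one>")
      case True
      then have c: "c \<in> charts_at M (\<gamma> 0)" by (simp add: D(4))
      have "((snd c \<circ> \<gamma>) has_vector_derivative curve_velocity M \<gamma> 0 c) (at (r * 0))"
        using curve_has_vector_derivative[OF D(1) c] curve_velocity_eq_mderiv[OF D(1) c] by simp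
      moreover have "((\<lambda>s. r * s) has_vector_derivative r) (at 0)"
        unfolding has_vector_derivative_def by (auto intro!: derivative_eq_intros)
      ultimately have "((snd c \<circ> (\<lambda>s. \<gamma> (r * s))) has_vector_derivative r *\<^sub>R curve_velocity M \<gamma> 0 c) (at 0)"
        using vector_diff_chain_at[of "\<lambda>s. r * s" r 0 "snd c \<circ> \<gamma>"] by (simp add: o_def)
      then show ?thesis
        unfolding curve_velocity_def[of M "\<lambda>s. \<gamma> (r * s)"] using True by (simp add: D(4) vector_derivative_at)
    next
      case False
      then show ?thesis by (simp add: curve_velocity_def D(4))
    qed
  qed
qed

text \<open>
  \<open>exp (t x)\<close> is the value at 1 of the one-parameter subgroup with velocity \<open>t x\<close>, which is the one with
  velocity \<open>x\<close> run at speed \<open>t\<close>.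
\<close>
lemma exp_curve_one_parameter_subgroup:
  assumes x: "x \<in> lie_alg G M"
  shows "one_parameter_subgroup G M (exp_curve G M x)" and "curve_velocity M (exp_curve G M x) 0 = x"
proof -
  obtain c where "c \<in> charts_at M \<one>" using ex_chart_at[OF one_closed] by blast
  then interpret lie_group_chart G M c by unfold_locales
  obtain \<Gamma> where \<Gamma>: "one_parameter_subgroup G M \<Gamma>" "curve_velocity M \<Gamma> 0 = x"
    using one_parameter_subgroup_exists[OF x] by metis
  have "exp_curve G M x t = \<Gamma> t" for t
  proof -
    have "(THE \<gamma>. one_parameter_subgroup G M \<gamma> \<and> curve_velocity M \<gamma> 0 = (\<lambda>c. t *\<^sub>R x c)) = (\<lambda>s. \<Gamma> (t * s))"
    proof (rule the_equality)
      show "one_parameter_subgroup G M (\<lambda>s. \<Gamma> (t * s)) \<and> curve_velocity M (\<lambda>s. \<Gamma> (t * s)) 0 = (\<lambda>c. t *\<^sub>R x c)"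
        using one_parameter_subgroup_scale[OF \<Gamma>(1), of t] \<Gamma>(2) by simp
      then show "\<eta> = (\<lambda>s. \<Gamma> (t * s))"
        if "one_parameter_subgroup G M \<eta> \<and> curve_velocity M \<eta> 0 = (\<lambda>c. t *\<^sub>R x c)" for \<eta>
        using that one_parameter_subgroup_unique by blast
    qed
    then show ?thesis unfolding exp_curve_def lie_exp_def by simp
  qed
  then have "exp_curve G M x = \<Gamma>" by blast
  with \<Gamma> show "one_parameter_subgroup G M (exp_curve G M x)" "curve_velocity M (exp_curve G M x) 0 = x" by simp_all
qed

end

section \<open>Rota-Baxter operators on groups\<close>

context group begin

lemma Ad_closed: "a \<in> carrier G \<Longrightarrow> b \<in> carrier G \<Longrightarrow> Ad G a b \<in> carrier G"
  unfolding Ad_def by simp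

context
  fixes \<B> :: "'a \<Rightarrow> 'a"
  assumes rb: "rota_baxter_operator G \<B>"
begin

lemma rb_closed: "a \<in> carrier G \<Longrightarrow> \<B> a \<in> carrier G"
  using rb unfolding rota_baxter_operator_def by blast

lemma rb_mult: "a \<in> carrier G \<Longrightarrow> b \<in> carrier G \<Longrightarrow> \<B> a \<otimes> \<B> b = \<B> (Ad G (\<B> a) b \<otimes> a)"
  using rb unfolding rota_baxter_operator_def by blast

lemma rb_one: "\<B> \<one> = \<one>"
proof -
  have "\<B> \<one> \<otimes> \<B> \<one> = \<B> (Ad G (\<B> \<one>) \<one> \<otimes> \<one>)" by (rule rb_mult) simp_all
  also have "Ad G (\<B> \<one>) \<one> \<otimes> \<one> = \<one>" unfolding Ad_def using rb_closed by simp
  finally show ?thesis using rb_closed[of \<one>] by (simp add: l_cancel_one')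
qed

lemma tilde_closed: "a \<in> carrier G \<Longrightarrow> grp_tilde G \<B> a \<in> carrier G"
  unfolding grp_tilde_def by (simp add: rb_closed)

lemma tilde_one: "grp_tilde G \<B> \<one> = \<one>"
  unfolding grp_tilde_def by (simp add: rb_one)

lemma tilde_tilde: "a \<in> carrier G \<Longrightarrow> grp_tilde G (grp_tilde G \<B>) a = \<B> a"
  unfolding grp_tilde_def by (simp add: rb_closed m_assoc[symmetric])

text \<open>
  With \<open>\<beta> = \<B> (a\<^sup>-\<^sup>1)\<close> one has \<open>\<B>~ a = a \<beta>\<close>, and the claim becomes the Rota-Baxter identity of \<open>\<B>\<close> for
  \<open>a\<^sup>-\<^sup>1\<close> and \<open>b\<^sup>-\<^sup>1\<close>.
\<close>
lemma tilde_rota_baxter: "rota_baxter_operator G (grp_tilde G \<B>)"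
  unfolding rota_baxter_operator_def
proof (intro conjI ballI)
  show "grp_tilde G \<B> \<in> carrier G \<rightarrow> carrier G" using tilde_closed by blast
  fix a b assume a: "a \<in> carrier G" and b: "b \<in> carrier G"
  define \<beta> where "\<beta> = \<B> (inv a)"
  have \<beta>: "\<beta> \<in> carrier G" unfolding \<beta>_def using a by (simp add: rb_closed)
  have ta: "grp_tilde G \<B> a = a \<otimes> \<beta>" unfolding grp_tilde_def \<beta>_def ..
  have 1: "Ad G (grp_tilde G \<B> a) b \<otimes> a = a \<otimes> \<beta> \<otimes> b \<otimes> inv \<beta>"
    unfolding Ad_def ta using a b \<beta> by (simp add: inv_mult_group m_assoc)
  have 2: "inv (a \<otimes> \<beta> \<otimes> b \<otimes> inv \<beta>) = Ad G \<beta> (inv b) \<otimes> inv a"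
    unfolding Ad_def using a b \<beta> by (simp add: inv_mult_group m_assoc)
  have 3: "\<B> (Ad G \<beta> (inv b) \<otimes> inv a) = \<beta> \<otimes> \<B> (inv b)"
    using rb_mult[of "inv a" "inv b"] a b unfolding \<beta>_def by simp
  have "grp_tilde G \<B> (Ad G (grp_tilde G \<B> a) b \<otimes> a) = a \<otimes> \<beta> \<otimes> b \<otimes> inv \<beta> \<otimes> (\<beta> \<otimes> \<B> (inv b))"
    unfolding 1 grp_tilde_def[of G \<B> "a \<otimes> \<beta> \<otimes> b \<otimes> inv \<beta>"] 2 3 ..
  also have "\<dots> = grp_tilde G \<B> a \<otimes> grp_tilde G \<B> b"
    unfolding ta unfolding grp_tilde_def using a b \<beta> rb_closed
    by (simp add: m_assoc) (simp add: m_assoc[symmetric])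
  finally show "grp_tilde G \<B> a \<otimes> grp_tilde G \<B> b = grp_tilde G \<B> (Ad G (grp_tilde G \<B> a) b \<otimes> a)" by simp
qed

end

text \<open>
  The right-hand side involves \<open>b\<close> only through \<open>v = \<B>~ b\<close>. It results from applying the Rota-Baxter
  identity of \<open>\<B>~\<close> twice: with \<open>p = \<B>(a)\<^sup>-\<^sup>1 a \<B>(a)\<close> first \<open>v \<B>~ (v\<^sup>-\<^sup>1 p v) = \<B>~ (p b)\<close>, then
  \<open>\<B>~ (a\<^sup>-\<^sup>1) \<B>~ (p b) = \<B>~ (\<B>(a) b \<B>(a)\<^sup>-\<^sup>1)\<close>, using that \<open>\<B>~ (a\<^sup>-\<^sup>1) = a\<^sup>-\<^sup>1 \<B>(a)\<close>.
\<close>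
lemma tilde_Ad:
  assumes rb: "rota_baxter_operator G \<B>" and a: "a \<in> carrier G" and b: "b \<in> carrier G"
  shows "grp_tilde G \<B> (Ad G (\<B> a) b) = grp_tilde G \<B> (inv a) \<otimes> (grp_tilde G \<B> b \<otimes>
    grp_tilde G \<B> (inv (grp_tilde G \<B> b) \<otimes> (inv (\<B> a) \<otimes> a \<otimes> \<B> a) \<otimes> grp_tilde G \<B> b))"
proof -
  note tr = tilde_rota_baxter[OF rb]
  let ?t = "grp_tilde G \<B>"
  define v where "v = ?t b"
  define \<beta> where "\<beta> = \<B> a"
  have v: "v \<in> carrier G" and \<beta>: "\<beta> \<in> carrier G"
    unfolding v_def \<beta>_def using a b by (simp_all add: rb_closed[OF rb] rb_closed[OF tr])
  have ta: "?t (inv a) = inv a \<otimes> \<beta>" unfolding grp_tilde_def \<beta>_def using a by simp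
  define p where "p = inv \<beta> \<otimes> a \<otimes> \<beta>"
  have p: "p \<in> carrier G" unfolding p_def using a \<beta> by simp
  have q: "inv v \<otimes> p \<otimes> v \<in> carrier G" using v p by simp
  have "v \<otimes> ?t (inv v \<otimes> p \<otimes> v) = ?t (Ad G v (inv v \<otimes> p \<otimes> v) \<otimes> b)"
    unfolding v_def by (rule rb_mult[OF tr b]) (use q in \<open>simp add: v_def\<close>)
  also have "Ad G v (inv v \<otimes> p \<otimes> v) = p"
    unfolding Ad_def using v p by (simp add: m_assoc) (simp add: m_assoc[symmetric])
  finally have 1: "v \<otimes> ?t (inv v \<otimes> p \<otimes> v) = ?t (p \<otimes> b)" .
  have "?t (inv a) \<otimes> ?t (p \<otimes> b) = ?t (Ad G (?t (inv a)) (p \<otimes> b) \<otimes> inv a)"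
    by (rule rb_mult[OF tr]) (use a b p in simp_all)
  also have "Ad G (?t (inv a)) (p \<otimes> b) \<otimes> inv a = Ad G \<beta> b"
    unfolding Ad_def ta p_def using a b \<beta>
    by (simp add: inv_mult_group m_assoc) (simp add: m_assoc[symmetric])
  finally show ?thesis
    unfolding 1[symmetric] unfolding v_def[symmetric] \<beta>_def[symmetric] p_def[symmetric] by simp
qed

lemma rb_rho_eq:
  assumes rb: "rota_baxter_operator G \<B>" and a: "a \<in> carrier G" and b: "b \<in> carrier G"
  shows "rb_rho G \<B> (\<B> a) (grp_tilde G \<B> b) = grp_tilde G \<B> (Ad G (\<B> a) b)"
  unfolding rb_rho_def
proof (rule the_equality)
  show "\<exists>a'\<in>carrier G. \<exists>b'\<in>carrier G. \<B> a = \<B> a' \<and> grp_tilde G \<B> b = grp_tilde G \<B> b' \<and>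
      grp_tilde G \<B> (Ad G (\<B> a) b) = grp_tilde G \<B> (Ad G (\<B> a') b')"
    using a b by blast
  fix w assume "\<exists>a'\<in>carrier G. \<exists>b'\<in>carrier G. \<B> a = \<B> a' \<and> grp_tilde G \<B> b = grp_tilde G \<B> b' \<and>
      w = grp_tilde G \<B> (Ad G (\<B> a') b')"
  then obtain a' b' where ab: "a' \<in> carrier G" "b' \<in> carrier G" "\<B> a = \<B> a'" "grp_tilde G \<B> b = grp_tilde G \<B> b'"
    and w: "w = grp_tilde G \<B> (Ad G (\<B> a) b')" by auto
  show "w = grp_tilde G \<B> (Ad G (\<B> a) b)"
    unfolding w tilde_Ad[OF rb a b] tilde_Ad[OF rb a ab(2)] ab(4) ..
qed

lemma rb_mu_eq_rho:
  assumes rb: "rota_baxter_operator G \<B>"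
  shows "rb_mu G \<B> v u = rb_rho G (grp_tilde G \<B>) v u"
proof -
  have "(\<exists>a\<in>carrier G. \<exists>b\<in>carrier G. v = grp_tilde G \<B> a \<and> u = \<B> b \<and> w = \<B> (Ad G (grp_tilde G \<B> a) b))
    \<longleftrightarrow> (\<exists>a\<in>carrier G. \<exists>b\<in>carrier G. v = grp_tilde G \<B> a \<and> u = grp_tilde G (grp_tilde G \<B>) b \<and>
        w = grp_tilde G (grp_tilde G \<B>) (Ad G (grp_tilde G \<B> a) b))" for w
    by (intro bex_cong refl) (simp add: tilde_tilde[OF rb] Ad_closed tilde_closed[OF rb])
  then show ?thesis unfolding rb_mu_def rb_rho_def by simp
qed

end

section \<open>The adjoint action and the bracket\<close>

context lie_group_chart begin

lemma mderiv_mult_map: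
  assumes pq: "p \<in> fst c" "q \<in> fst c" "p \<otimes> q \<in> fst c"
  shows "mderiv (prod_chart c c) c mult_map (p, q) = Dmul (snd c p, snd c q)"
proof -
  have d: "(snd c p, snd c q) \<in> dom" unfolding dom_def using pq by (simp add: ci_c)
  have "((snd c \<circ> mult_map \<circ> chart_inv (prod_chart c c)) has_derivative Dmul (snd c p, snd c q)) (at (snd c p, snd c q))"
  proof (rule has_derivative_transform_within_open[OF mul_has_derivative[OF d] dom_smooth(1) d])
    fix z assume z: "z \<in> dom"
    obtain u w where uw: "z = (u, w)" by (cases z)
    show "mul z = (snd c \<circ> mult_map \<circ> chart_inv (prod_chart c c)) z"
      using chart_inv_prod[OF proper_c proper_c domD(1,2)[OF z[unfolded uw]]] unfolding uw mul_def by simp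
  qed
  then show ?thesis unfolding mderiv_def prod_chart_simps by (rule frechetI)
qed

text \<open>
  Differentiate \<open>a a\<^sup>-\<^sup>1 = e\<close>.
\<close>
lemma mderiv_inv: "mderiv c c (\<lambda>a. inv a) \<one> v = - v"
proof -
  have one: "\<one> \<in> topspace (base M)" by (simp add: topspace_M)
  note id = mdiff_at_id[OF smooth_M one] and iv = smooth_map_imp_mdiff_at[OF charted charted smooth_inv one]
  note pr = mdiff_at_mult[OF charted id(1) iv]
  have "mderiv c c (\<lambda>q. q \<otimes> inv q) \<one> = mderiv c c (\<lambda>_. \<one>) \<one>"
    by (rule mdiff_at_cong(2)[OF charted mdiff_at_const(1)[OF charted one one]]) (use c topspace_M in auto)
  also have "\<dots> = (\<lambda>_. 0)" by (rule mdiff_at_const(2)[OF charted one one])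
  finally have "mderiv c c (\<lambda>q. q \<otimes> inv q) \<one> v = 0" by simp
  moreover have "mderiv c c (\<lambda>q. q \<otimes> inv q) \<one> v
      = mderiv (prod_chart c c) c mult_map (\<one>, inv \<one>) (mderiv c c (\<lambda>q. q) \<one> v, mderiv c c (\<lambda>a. inv a) \<one> v)"
    by (rule pr(2)) (use c in simp_all)
  ultimately show ?thesis
    using one_in_c by (simp add: mderiv_mult_map Dmul_one_one id(2)[OF c] add_eq_0_iff)
qed

lemma left_invariant_field_chart:
  assumes x: "x \<in> lie_alg G M" and u: "u \<in> im"
  shows "left_invariant_field G M x (ci u) c = left_field (x c) u"
proof -
  have a: "ci u \<in> carrier G" by (rule ci_carrier[OF u])
  have one: "\<one> \<in> topspace (base M)" by (simp add: topspace_M)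
  have m: "mdiff_at M M (\<lambda>h. ci u \<otimes> h) \<one>"
    by (rule mdiff_at_mult(1)[OF charted mdiff_at_const(1)[OF charted one] mdiff_at_id(1)[OF smooth_M one]])
      (use a topspace_M in simp)
  have cu: "c \<in> charts_at M (ci u \<otimes> \<one>)"
    using c ci_in[OF u] a unfolding charts_at_def by simp
  have "left_invariant_field G M x (ci u) c = mderiv c c (\<lambda>h. ci u \<otimes> h) \<one> (x c)"
    unfolding left_invariant_field_def
    by (rule tangent_map_chart[OF smooth_M m _ c cu]) (use x in \<open>simp add: lie_alg_def\<close>)
  also have "mderiv c c (\<lambda>h. ci u \<otimes> h) \<one> = (\<lambda>h. Dmul (u, u0) (0, h))"
  proof -
    have "((\<lambda>w. mul (u, w)) has_derivative (\<lambda>h. Dmul (u, u0) (0, h))) (at u0)"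
      by (rule Dmul_chain) (auto intro: mul_one u)
    then show ?thesis unfolding mderiv_def mul_def by (intro frechetI) (simp add: o_def)
  qed
  finally show ?thesis unfolding left_field_def .
qed

lemma left_field_has_derivative:
  "u \<in> im \<Longrightarrow> (left_field x has_derivative frechet_derivative (left_field x) (at u)) (at u)"
  using left_field_smooth[of "Suc 0" x] by (auto intro: has_derivative_frechet)

text \<open>
  Both left-invariant fields become \<open>left_field\<close> in the chart, and their values at the identity are the
  given vectors.
\<close>
lemma lie_bracket_chart:
  assumes x: "x \<in> lie_alg G M" and y: "y \<in> lie_alg G M"
  shows "lie_bracket G M x y c =
    frechet_derivative (left_field (y c)) (at u0) (x c) - frechet_derivative (left_field (x c)) (at u0) (y c)"
proof -
  have D: "frechet_derivative (\<lambda>u. left_invariant_field G M z (ci u) c) (at u0) = frechet_derivative (left_field (z c)) (at u0)"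
    if z: "z \<in> lie_alg G M" for z
    by (rule frechetI, rule has_derivative_transform_within_open[OF left_field_has_derivative[OF u0_im] open_im u0_im])
      (simp add: left_invariant_field_chart[OF z])
  have V: "left_invariant_field G M z \<one> c = z c" if z: "z \<in> lie_alg G M" for z
    using left_invariant_field_chart[OF z u0_im] by (simp add: ci_u0 left_field_u0)
  show ?thesis
    unfolding lie_bracket_def vf_bracket_def using c by (simp add: D x y V)
qed

text \<open>
  The differentiated curve is the chart expression of the adjoint action on \<open>y\<close> of a curve \<open>a\<close> of group
  elements with velocity \<open>x\<close>, where \<open>j\<close> describes the inverse elements: \<open>left_field y\<close> translates \<open>y\<close> from
  the left by \<open>a\<close>, and the outer derivative of \<open>mul\<close> translates back from the right by \<open>j\<close>. The product
  rule has two terms. Moving the left translation gives the derivative of \<open>left_field y\<close> along \<open>x\<close>. Moving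
  the right translation gives the second derivative of \<open>mul\<close> in the directions \<open>(y, 0)\<close> and \<open>(x, -x)\<close>. Its
  part for \<open>(x, 0)\<close> vanishes, as right translation by the identity is trivial at all points; its part for
  \<open>(0, -x)\<close> is, by symmetry of the second derivative, minus the derivative of \<open>left_field x\<close> along \<open>y\<close>.
\<close>
lemma conjugation_derivative:
  assumes a: "(a has_vector_derivative x) (at 0)" "a 0 = u0"
    and j: "(j has_vector_derivative - x) (at 0)" "j 0 = u0"
  shows "((\<lambda>t. Dmul (a t, j t) (left_field y (a t), 0)) has_vector_derivative
    (frechet_derivative (left_field y) (at u0) x - frechet_derivative (left_field x) (at u0) y)) (at (0::real))"
proof -
  let ?E = "\<lambda>h. frechet_derivative (\<lambda>p. Dmul p h) (at (u0, u0))"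
  have d0: "(u0, u0) \<in> dom" by (rule mul_one(1)[OF u0_im])
  have E: "((\<lambda>p. Dmul p h) has_derivative ?E h) (at (u0, u0))" for h
    by (rule has_derivative_frechet[OF Dmul_differentiable[OF d0]])
  have C2: "Ck_on 2 dom mul" using dom_smooth(2) unfolding smooth_on_def by blast
  have sym: "?E h k = ?E k h" for h k
    by (rule second_derivative_symmetric[OF dom_smooth(1) d0 C2])
  have linE: "linear (?E h)" for h using has_derivative_linear[OF E] .
  have aj: "((\<lambda>t. (a t, j t)) has_vector_derivative (x, - x)) (at 0)"
    using has_derivative_Pair[OF a(1)[unfolded has_vector_derivative_def] j(1)[unfolded has_vector_derivative_def]]
    unfolding has_vector_derivative_def by simp
  have "((\<lambda>t. Dmul (a t, j t) (left_field y (a t), 0)) has_vector_derivative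
      ?E (left_field y (a 0), 0) (x, - x) + Dmul (a 0, j 0) (frechet_derivative (left_field y) (at u0) x, 0)) (at 0)"
  proof (rule has_vector_derivative_family_apply[OF finite_dim_model, where F = "\<lambda>t v. Dmul (a t, j t) (v, 0)" and F' = "\<lambda>v. ?E (v, 0) (x, - x)"])
    have emb: "linear (\<lambda>v :: 'e. (v, 0 :: 'e))" by (intro linearI) simp_all
    have "isCont (\<lambda>t. (a t, j t)) 0" using aj by (rule has_vector_derivative_continuous)
    then have "\<forall>\<^sub>F t in nhds 0. (a t, j t) \<in> dom"
      using topological_tendstoD[of "\<lambda>t. (a t, j t)" "(u0, u0)" "at 0" dom] dom_smooth(1) d0 a(2) j(2)
      by (simp add: isCont_def eventually_nhds_conv_at)
    then show "\<forall>\<^sub>F t in nhds 0. linear (\<lambda>v. Dmul (a t, j t) (v, 0))"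
      by eventually_elim (use linear_compose[OF emb Dmul_linear] in \<open>simp add: o_def\<close>)
    show "linear (\<lambda>v. ?E (v, 0) (x, - x))"
      unfolding sym[of "(_, 0)" "(x, - x)"] using linear_compose[OF emb linE] by (simp add: o_def)
    show "((\<lambda>t. Dmul (a t, j t) (v, 0)) has_vector_derivative ?E (v, 0) (x, - x)) (at 0)" for v
      using vector_derivative_diff_chain_within[OF aj, of "\<lambda>p. Dmul p (v, 0)" "?E (v, 0)"] E
      by (simp add: o_def a(2) j(2) has_derivative_at_withinI)
    show "((\<lambda>t. left_field y (a t)) has_vector_derivative frechet_derivative (left_field y) (at u0) x) (at 0)"
      using vector_derivative_diff_chain_within[OF a(1), of "left_field y"] left_field_has_derivative[OF u0_im]
      by (simp add: o_def a(2) has_derivative_at_withinI)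
  qed
  moreover have "?E (y, 0) (x, - x) = - frechet_derivative (left_field x) (at u0) y"
  proof -
    have first: "((\<lambda>u. (u, u0)) has_derivative (\<lambda>h. (h, 0))) (at u0)"
      by (intro has_derivative_Pair has_derivative_ident has_derivative_const)
    have slice: "((\<lambda>u. Dmul (u, u0) k) has_derivative (\<lambda>h. ?E k (h, 0))) (at u0)" for k
      by (rule has_derivative_compose[OF first E])
    have "((\<lambda>u. Dmul (u, u0) (y, 0)) has_derivative (\<lambda>h. 0)) (at u0)"
      by (rule has_derivative_transform_within_open[OF has_derivative_const open_im u0_im, of y]) (simp add: Dmul_right_one)
    from has_derivative_unique[OF slice this] have zero: "?E (y, 0) (x, 0) = 0" by meson
    have "(left_field x has_derivative (\<lambda>h. ?E (0, x) (h, 0))) (at u0)"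
      using slice[of "(0, x)"] unfolding left_field_def[abs_def] .
    then have "?E (0, x) (y, 0) = frechet_derivative (left_field x) (at u0) y"
      by (simp add: frechetI)
    moreover have "?E (y, 0) (x, - x) = ?E (y, 0) (x, 0) - ?E (y, 0) (0, x)"
      using linear_diff[OF linE[of "(y, 0)"], of "(x, 0)" "(0, x)"] by simp
    ultimately show ?thesis using zero sym[of "(y, 0)" "(0, x)"] by simp
  qed
  moreover have "Dmul (a 0, j 0) (frechet_derivative (left_field y) (at u0) x, 0) = frechet_derivative (left_field y) (at u0) x"
    by (simp add: a(2) j(2) Dmul_one_one)
  ultimately show ?thesis by (simp add: a(2) left_field_u0)
qed

lemma curve_eventually_in_chart:
  assumes "mdiff_at real_line M \<gamma> 0" "\<gamma> 0 = \<one>"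
  shows "\<forall>\<^sub>F t in nhds 0. \<gamma> t \<in> fst c"
proof -
  have "openin (base M) (fst c)" using proper_c unfolding proper_chart_def by blast
  then obtain T where "open T" "0 \<in> T" "\<And>s. s \<in> T \<Longrightarrow> \<gamma> s \<in> fst c"
    using curve_stays_in_open[of M \<gamma> 0 "fst c"] assms one_in_c unfolding mdiff_at_def by auto
  then show ?thesis unfolding eventually_nhds by blast
qed

lemma mdiff_Ad_curve:
  assumes "g \<in> carrier G" "mdiff_at real_line M \<beta> 0"
  shows "mdiff_at real_line M (\<lambda>s. Ad G g (\<beta> s)) 0"
  unfolding Ad_def using assms
  by (intro mdiff_at_mult(1) real_line_charted mdiff_at_const(1)) (simp_all add: topspace_M)

lemma Ad_curve_velocity:
  assumes g: "g \<in> fst c" "inv g \<in> fst c" and \<beta>: "mdiff_at real_line M \<beta> 0" "\<beta> 0 = \<one>"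
  shows "curve_velocity M (\<lambda>s. Ad G g (\<beta> s)) 0 c
    = Dmul (snd c g, snd c (inv g)) (left_field (curve_velocity M \<beta> 0 c) (snd c g), 0)"
proof -
  have gc: "g \<in> carrier G" using chart_carrier[OF c g(1)] .
  have top: "(0::real) \<in> topspace (base real_line)" "g \<in> topspace (base M)" "inv g \<in> topspace (base M)"
    using gc by (simp_all add: topspace_M)
  note kg = mdiff_at_const[OF real_line_charted top(1,2)] and ki = mdiff_at_const[OF real_line_charted top(1,3)]
  note m1 = mdiff_at_mult[OF real_line_charted kg(1) \<beta>(1)]
  note m2 = mdiff_at_mult[OF real_line_charted m1(1) ki(1)]
  have cg: "c \<in> charts_at M g" "c \<in> charts_at M (inv g)" using c g unfolding charts_at_def by simp_all
  have rl: "real_chart \<in> charts_at real_line 0" by simp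
  have "curve_velocity M (\<lambda>s. Ad G g (\<beta> s)) 0 c = mderiv real_chart c (\<lambda>s. g \<otimes> \<beta> s \<otimes> inv g) 0 1"
    unfolding Ad_def by (rule curve_velocity_eq_mderiv[OF m2(1)]) (use c gc in \<open>simp add: \<beta>(2)\<close>)
  also have "\<dots> = mderiv (prod_chart c c) c mult_map (g \<otimes> \<beta> 0, inv g)
      (mderiv real_chart c (\<lambda>s. g \<otimes> \<beta> s) 0 1, mderiv real_chart c (\<lambda>_. inv g) 0 1)"
    by (rule m2(2)[OF rl]) (use c cg gc in \<open>simp_all add: \<beta>(2)\<close>)
  also have "mderiv real_chart c (\<lambda>s. g \<otimes> \<beta> s) 0 1 = mderiv (prod_chart c c) c mult_map (g, \<beta> 0)
      (mderiv real_chart c (\<lambda>_. g) 0 1, mderiv real_chart c \<beta> 0 1)"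
    by (rule m1(2)[OF rl]) (use c cg gc in \<open>simp_all add: \<beta>(2)\<close>)
  finally show ?thesis
    using g gc one_in_c c
    by (simp add: \<beta>(2) kg(2) ki(2) mderiv_mult_map left_field_def curve_velocity_eq_mderiv[OF \<beta>(1)])
qed

text \<open>
  The derivative of the adjoint representation is the bracket.
\<close>
lemma Ad_velocity_has_derivative:
  assumes \<alpha>: "mdiff_at real_line M \<alpha> 0" "\<alpha> 0 = \<one>" and vel: "curve_velocity M \<alpha> 0 = x"
    and x: "x \<in> lie_alg G M" and y: "y \<in> lie_alg G M"
    and \<beta>: "mdiff_at real_line M \<beta> 0" "\<beta> 0 = \<one>" "curve_velocity M \<beta> 0 = y"
  shows "((\<lambda>t. curve_velocity M (\<lambda>s. Ad G (\<alpha> t) (\<beta> s)) 0 c) has_vector_derivative lie_bracket G M x y c) (at 0)"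
proof -
  have c\<alpha>: "c \<in> charts_at M (\<alpha> 0)" using c \<alpha>(2) by simp
  have one: "\<one> \<in> topspace (base M)" by (simp add: topspace_M)
  note iv = smooth_map_imp_mdiff_at[OF charted charted smooth_inv one]
  have i\<alpha>: "mdiff_at real_line M (\<lambda>t. inv (\<alpha> t)) 0" by (rule mdiff_at_inv[OF real_line_charted \<alpha>(1)])
  have a: "((\<lambda>t. snd c (\<alpha> t)) has_vector_derivative x c) (at 0)"
    using curve_has_vector_derivative[OF \<alpha>(1) c\<alpha>] curve_velocity_eq_mderiv[OF \<alpha>(1) c\<alpha>] vel by (simp add: o_def)
  have "mderiv real_chart c (\<lambda>t. inv (\<alpha> t)) 0 1 = - x c"
    using mdiff_at_compose(2)[OF real_line_charted charted \<alpha>(1), of M "\<lambda>a. inv a" real_chart c c] iv c \<alpha>(2)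
      curve_velocity_eq_mderiv[OF \<alpha>(1) c\<alpha>] vel by (simp add: o_def mderiv_inv)
  then have j: "((\<lambda>t. snd c (inv (\<alpha> t))) has_vector_derivative - x c) (at 0)"
    using curve_has_vector_derivative[OF i\<alpha>, of c] c \<alpha>(2) by (simp add: o_def)
  have D: "((\<lambda>t. Dmul (snd c (\<alpha> t), snd c (inv (\<alpha> t))) (left_field (y c) (snd c (\<alpha> t)), 0)) has_vector_derivative
      lie_bracket G M x y c) (at 0)"
    unfolding lie_bracket_chart[OF x y] by (rule conjugation_derivative[OF a _ j]) (simp_all add: \<alpha>(2))
  have "\<forall>\<^sub>F t in nhds 0. \<alpha> t \<in> fst c \<and> inv (\<alpha> t) \<in> fst c"
    using curve_eventually_in_chart[OF \<alpha>] curve_eventually_in_chart[OF i\<alpha>] \<alpha>(2) by (simp add: eventually_conj)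
  then obtain T where T: "open T" "0 \<in> T" "\<And>t. t \<in> T \<Longrightarrow> \<alpha> t \<in> fst c \<and> inv (\<alpha> t) \<in> fst c"
    unfolding eventually_nhds by blast
  show ?thesis
    by (rule has_vector_derivative_transform_within_open[OF D T(1,2)])
      (use Ad_curve_velocity[OF _ _ \<beta>(1,2)] T(3) \<beta>(3) in simp)
qed

end

section \<open>Differentiating the actions\<close>

context lie_group_on begin

lemma same_velocity_const: "a \<in> carrier G \<Longrightarrow> same_velocity M (\<lambda>_. a) (\<lambda>_. a)"
  unfolding same_velocity_def using mdiff_at_const(1)[OF real_line_charted, of 0 a M] topspace_M by simp

lemma same_velocity_mult:
  assumes 1: "same_velocity M \<gamma> \<eta>" and 2: "same_velocity M \<gamma>' \<eta>'"
  shows "same_velocity M (\<lambda>s. \<gamma> s \<otimes> \<gamma>' s) (\<lambda>s. \<eta> s \<otimes> \<eta>' s)"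
proof -
  have m: "mdiff_at real_line M \<gamma> 0" "mdiff_at real_line M \<eta> 0" "mdiff_at real_line M \<gamma>' 0" "mdiff_at real_line M \<eta>' 0"
    and eq: "\<eta> 0 = \<gamma> 0" "\<eta>' 0 = \<gamma>' 0"
    and vel: "curve_velocity M \<eta> 0 = curve_velocity M \<gamma> 0" "curve_velocity M \<eta>' 0 = curve_velocity M \<gamma>' 0"
    using 1 2 unfolding same_velocity_def by simp_all
  obtain c d where c: "c \<in> charts_at M (\<gamma> 0)" and d: "d \<in> charts_at M (\<gamma>' 0)"
    using ex_chart_at mdiff_at_carrier[OF m(1)] mdiff_at_carrier[OF m(3)] by blast
  note p = mdiff_at_mult[OF real_line_charted m(1,3)] and p' = mdiff_at_mult[OF real_line_charted m(2,4)]
  have "curve_velocity M (\<lambda>s. \<gamma> s \<otimes> \<gamma>' s) 0 k = curve_velocity M (\<lambda>s. \<eta> s \<otimes> \<eta>' s) 0 k" for k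
  proof (cases "k \<in> charts_at M (\<gamma> 0 \<otimes> \<gamma>' 0)")
    case True
    have rl: "real_chart \<in> charts_at real_line 0" by simp
    have v: "mderiv real_chart c \<gamma> 0 1 = mderiv real_chart c \<eta> 0 1"
      using curve_velocity_eq_mderiv[OF m(1) c] curve_velocity_eq_mderiv[OF m(2), of c] c eq vel by simp
    have w: "mderiv real_chart d \<gamma>' 0 1 = mderiv real_chart d \<eta>' 0 1"
      using curve_velocity_eq_mderiv[OF m(3) d] curve_velocity_eq_mderiv[OF m(4), of d] d eq vel by simp
    show ?thesis
      using p(2)[OF rl c d True, of 1] p'(2)[OF rl, of c d k 1] c d True eq v w
        curve_velocity_eq_mderiv[OF p(1) True] curve_velocity_eq_mderiv[OF p'(1), of k] by simp
  qed (simp add: curve_velocity_def eq)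
  then show ?thesis using p(1) p'(1) eq unfolding same_velocity_def by auto
qed

lemma same_velocity_inv:
  assumes "same_velocity M \<gamma> \<eta>"
  shows "same_velocity M (\<lambda>s. inv (\<gamma> s)) (\<lambda>s. inv (\<eta> s))"
proof (rule same_velocity_compose[OF charted assms])
  have "mdiff_at real_line M \<gamma> 0" using assms unfolding same_velocity_def by simp
  then have "\<gamma> 0 \<in> topspace (base M)" by (rule mdiff_at_in_topspace(2))
  then show "mdiff_at M M (\<lambda>a. inv a) (\<gamma> 0)"
    by (rule smooth_map_imp_mdiff_at[OF charted charted smooth_inv])
qed

lemma lie_group_chart_at_one: "c \<in> charts_at M \<one> \<Longrightarrow> lie_group_chart G M c"
  by unfold_locales

lemma exp_curveD:
  assumes "x \<in> lie_alg G M"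
  shows "mdiff_at real_line M (exp_curve G M x) t" "exp_curve G M x 0 = \<one>" "exp_curve G M x t \<in> carrier G"
    "curve_velocity M (exp_curve G M x) 0 = x"
  using one_parameter_subgroupD[OF exp_curve_one_parameter_subgroup(1)[OF assms]]
    exp_curve_one_parameter_subgroup(2)[OF assms] by auto

lemma Ad_curve_at_0: "g \<in> carrier G \<Longrightarrow> \<beta> 0 = \<one> \<Longrightarrow> Ad G g (\<beta> (0::real)) = \<one>"
  unfolding Ad_def by simp

text \<open>
  The transformation law of the bracket is inherited from the velocities of the conjugated curves, whose
  derivative it is by \<open>Ad_velocity_has_derivative\<close>.
\<close>
lemma lie_bracket_closed:
  assumes x: "x \<in> lie_alg G M" and y: "y \<in> lie_alg G M"
  shows "lie_bracket G M x y \<in> lie_alg G M"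
  unfolding lie_alg_def
proof (rule tangent_spaceI)
  show "lie_bracket G M x y c = 0" if "c \<notin> charts_at M \<one>" for c
    using that unfolding lie_bracket_def vf_bracket_def by simp
  fix c d assume c: "c \<in> charts_at M \<one>" and d: "d \<in> charts_at M \<one>"
  interpret C: lie_group_chart G M c by (rule lie_group_chart_at_one[OF c])
  interpret D: lie_group_chart G M d by (rule lie_group_chart_at_one[OF d])
  note X = exp_curveD[OF x] and Y = exp_curveD[OF y]
  let ?K = "\<lambda>t. curve_velocity M (\<lambda>s. Ad G (exp_curve G M x t) (exp_curve G M y s)) 0"
  have K: "?K t \<in> tangent_space M \<one>" for t
    using tangent_spaceI_curve[OF smooth_M C.mdiff_Ad_curve[OF X(3) Y(1)], of t] Ad_curve_at_0[of "exp_curve G M x t" "exp_curve G M y"] X(3)[of t] Y(2)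
    by simp
  have bl: "bounded_linear (mderiv c d (\<lambda>q. q) \<one>)"
    using mderiv_bounded_linear[OF mdiff_at_id(1)[OF smooth_M, of \<one>] c d] by (simp add: topspace_M)
  have "((\<lambda>t. mderiv c d (\<lambda>q. q) \<one> (?K t c)) has_vector_derivative mderiv c d (\<lambda>q. q) \<one> (lie_bracket G M x y c)) (at 0)"
    by (rule bounded_linear.has_vector_derivative[OF bl C.Ad_velocity_has_derivative[OF X(1,2,4) x y Y(1,2,4)]])
  then have "((\<lambda>t. ?K t d) has_vector_derivative mderiv c d (\<lambda>q. q) \<one> (lie_bracket G M x y c)) (at 0)"
    by (simp add: tangent_spaceD[OF K c d])
  moreover have "((\<lambda>t. ?K t d) has_vector_derivative lie_bracket G M x y d) (at 0)"
    by (rule D.Ad_velocity_has_derivative[OF X(1,2,4) x y Y(1,2,4)])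
  ultimately show "lie_bracket G M x y d = mderiv c d (\<lambda>q. q) \<one> (lie_bracket G M x y c)"
    using vector_derivative_unique_at by blast
qed

end

text \<open>
  Differentiability at all points is weaker than smoothness and passes to \<open>tilde\<close>, so this locale is
  closed under the duality that exchanges \<open>\<B>\<close> and \<open>tilde\<close>.
\<close>
locale rota_baxter_diff = lie_group_on G M
  for G :: "('g, 'm) monoid_scheme" (structure) and M :: "('g, 'e::banach) manifold" +
  fixes \<B> :: "'g \<Rightarrow> 'g"
  assumes rb: "rota_baxter_operator G \<B>" and rb_diff: "\<And>a. a \<in> carrier G \<Longrightarrow> mdiff_at M M \<B> a"
begin

abbreviation tilde :: "'g \<Rightarrow> 'g" where "tilde \<equiv> grp_tilde G \<B>"

lemma tilde_diff:
  assumes a: "a \<in> carrier G"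
  shows "mdiff_at M M tilde a"
proof -
  have "mdiff_at M M (\<lambda>q. q \<otimes> \<B> (inv q)) a"
    using mdiff_at_compose(1)[OF charted charted mdiff_at_inv[OF charted mdiff_at_id(1)[OF smooth_M]] rb_diff, of a]
      mdiff_at_id(1)[OF smooth_M, of a] a topspace_M
    by (intro mdiff_at_mult(1) charted) (simp_all add: o_def)
  then show ?thesis unfolding grp_tilde_def[abs_def] .
qed

lemma dual: "rota_baxter_diff G M tilde"
  by unfold_locales (rule tilde_rota_baxter[OF rb], rule tilde_diff)

lemma inf_rb_chart:
  assumes x: "x \<in> lie_alg G M" and c: "c \<in> charts_at M \<one>"
  shows "inf_rb G M \<B> x c = mderiv c c \<B> \<one> (x c)"
  unfolding inf_rb_def
  by (rule tangent_map_chart[OF smooth_M rb_diff _ c]) (use x c in \<open>simp_all add: lie_alg_def rb_one[OF rb]\<close>)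

lemma rb_exp_curve:
  assumes x: "x \<in> lie_alg G M"
  shows "mdiff_at real_line M (\<lambda>t. \<B> (exp_curve G M x t)) t" "\<B> (exp_curve G M x 0) = \<one>"
    "curve_velocity M (\<lambda>t. \<B> (exp_curve G M x t)) 0 = inf_rb G M \<B> x"
    "inf_rb G M \<B> x \<in> lie_alg G M"
proof -
  note X = exp_curveD[OF x]
  show m: "mdiff_at real_line M (\<lambda>t. \<B> (exp_curve G M x t)) t" for t
    using mdiff_at_compose(1)[OF real_line_charted charted X(1) rb_diff[OF X(3)]] by (simp add: o_def)
  show 0: "\<B> (exp_curve G M x 0) = \<one>" by (simp add: X(2) rb_one[OF rb])
  show vel: "curve_velocity M (\<lambda>t. \<B> (exp_curve G M x t)) 0 = inf_rb G M \<B> x"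
  proof
    fix c
    show "curve_velocity M (\<lambda>t. \<B> (exp_curve G M x t)) 0 c = inf_rb G M \<B> x c"
    proof (cases "c \<in> charts_at M \<one>")
      case True
      then show ?thesis
        using curve_velocity_compose[OF charted X(1) rb_diff[OF X(3)], of c 0 c]
        by (simp add: X(2,4) rb_one[OF rb] inf_rb_chart[OF x True])
    next
      case False
      then show ?thesis
        by (simp add: curve_velocity_def 0 inf_rb_def tangent_map_outside rb_one[OF rb])
    qed
  qed
  show "inf_rb G M \<B> x \<in> lie_alg G M"
    using tangent_spaceI_curve[OF smooth_M m[of 0]] unfolding vel 0 lie_alg_def .
qed

lemmas dual_inf_rb_chart = rota_baxter_diff.inf_rb_chart[OF dual]
lemmas dual_rb_exp_curve = rota_baxter_diff.rb_exp_curve[OF dual]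

text \<open>
  At the identity the derivative of the product is the sum, and inversion has derivative \<open>-id\<close>.
\<close>
lemma inf_rb_tilde:
  assumes x: "x \<in> lie_alg G M"
  shows "inf_rb G M tilde x = alg_tilde (inf_rb G M \<B>) x"
proof
  fix c
  show "inf_rb G M tilde x c = alg_tilde (inf_rb G M \<B>) x c"
  proof (cases "c \<in> charts_at M \<one>")
    case True
    interpret C: lie_group_chart G M c by (rule lie_group_chart_at_one[OF True])
    have one: "\<one> \<in> topspace (base M)" by (simp add: topspace_M)
    note id = mdiff_at_id[OF smooth_M one]
    note iv = smooth_map_imp_mdiff_at[OF charted charted smooth_inv one]
    have iv1: "c \<in> charts_at M (inv \<one>)" using True by simp
    have bi: "mdiff_at M M \<B> (inv \<one>)" by (rule rb_diff) simp
    note comp = mdiff_at_compose[OF charted charted iv bi, unfolded comp_def]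
    have "mderiv c c tilde \<one> (x c) = mderiv (prod_chart c c) c mult_map (\<one>, \<B> (inv \<one>))
        (mderiv c c (\<lambda>q. q) \<one> (x c), mderiv c c (\<lambda>q. \<B> (inv q)) \<one> (x c))"
      unfolding grp_tilde_def[abs_def]
      by (rule mdiff_at_mult(2)[OF charted id(1) comp(1) True]) (use True in \<open>simp_all add: rb_one[OF rb]\<close>)
    also have "mderiv c c (\<lambda>q. \<B> (inv q)) \<one> (x c) = mderiv c c \<B> \<one> (- x c)"
      using comp(2)[OF True iv1, of c] True by (simp add: rb_one[OF rb] C.mderiv_inv)
    also have "\<dots> = - mderiv c c \<B> \<one> (x c)"
      using linear_neg[OF bounded_linear.linear[OF mderiv_bounded_linear[OF rb_diff[OF one_closed] True, of c]]] True
      by (simp add: rb_one[OF rb])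
    finally show ?thesis
      using C.one_in_c
      by (simp add: dual_inf_rb_chart[OF x True] alg_tilde_def inf_rb_chart[OF x True] rb_one[OF rb] id(2)[OF True]
          C.mderiv_mult_map C.Dmul_one_one)
  next
    case False
    then show ?thesis
      using tangent_space_outside[OF x[unfolded lie_alg_def]]
      by (simp add: inf_rb_def tangent_map_outside rb_one[OF rb] tilde_one[OF rb] alg_tilde_def)
  qed
qed

text \<open>
  By \<open>tilde_Ad\<close>, both curves arise from the given ones by the same operations.
\<close>
lemma same_velocity_action:
  assumes a: "a \<in> carrier G" and \<beta>: "\<And>s. \<beta> s \<in> carrier G" and \<beta>': "\<And>s. \<beta>' s \<in> carrier G"
    and s: "same_velocity M (\<lambda>s. tilde (\<beta> s)) (\<lambda>s. tilde (\<beta>' s))"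
  shows "same_velocity M (\<lambda>s. tilde (Ad G (\<B> a) (\<beta> s))) (\<lambda>s. tilde (Ad G (\<B> a) (\<beta>' s)))"
proof -
  have t: "tilde b \<in> carrier G" if "b \<in> carrier G" for b by (rule tilde_closed[OF rb that])
  have Ba: "inv (\<B> a) \<otimes> a \<otimes> \<B> a \<in> carrier G" using a by (simp add: rb_closed[OF rb])
  show ?thesis
    unfolding tilde_Ad[OF rb a \<beta>] tilde_Ad[OF rb a \<beta>']
    by (intro same_velocity_mult same_velocity_const s same_velocity_compose[OF charted _ tilde_diff] same_velocity_inv)
      (use a Ba t[OF \<beta>] t in simp_all)
qed

text \<open>
  For each \<open>t\<close> the inner derivative is the image under the linear tangent map of \<open>tilde\<close> of the velocity
  of a conjugated curve, and the latter depends on \<open>t\<close> with derivative \<open>[B x, y]\<close>.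
\<close>
lemma iterated_velocity_action:
  assumes x: "x \<in> lie_alg G M" and y: "y \<in> lie_alg G M"
  shows "iterated_velocity M (\<lambda>t s. rb_rho G \<B> (\<B> (exp_curve G M x t)) (tilde (exp_curve G M y s)))
    = inf_rb G M tilde (lie_bracket G M (inf_rb G M \<B> x) y)" (is "?l = ?r")
proof
  fix c
  note X = exp_curveD[OF x] and Y = exp_curveD[OF y] and BX = rb_exp_curve[OF x]
  have Bc: "\<B> (exp_curve G M x t) \<in> carrier G" for t by (rule rb_closed[OF rb X(3)])
  have l: "?l c = vector_derivative
      (\<lambda>t. curve_velocity M (\<lambda>s. tilde (Ad G (\<B> (exp_curve G M x t)) (exp_curve G M y s))) 0 c) (at 0)"
    unfolding iterated_velocity_def rb_rho_eq[OF rb X(3) Y(3)] ..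
  have Ad0: "Ad G (\<B> (exp_curve G M x t)) (exp_curve G M y 0) = \<one>" for t
    using Ad_curve_at_0[of "\<B> (exp_curve G M x t)" "exp_curve G M y"] Bc Y(2) by simp
  show "?l c = ?r c"
  proof (cases "c \<in> charts_at M \<one>")
    case True
    interpret C: lie_group_chart G M c by (rule lie_group_chart_at_one[OF True])
    let ?K = "\<lambda>t. curve_velocity M (\<lambda>s. Ad G (\<B> (exp_curve G M x t)) (exp_curve G M y s)) 0 c"
    have "curve_velocity M (\<lambda>s. tilde (Ad G (\<B> (exp_curve G M x t)) (exp_curve G M y s))) 0 c = mderiv c c tilde \<one> (?K t)" for t
      using curve_velocity_compose[OF charted C.mdiff_Ad_curve[OF Bc Y(1)], of M tilde t c c]
        tilde_diff[OF one_closed] True Ad0[of t]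
      by (simp add: tilde_one[OF rb])
    moreover have "bounded_linear (mderiv c c tilde \<one>)"
      using mderiv_bounded_linear[OF tilde_diff[OF one_closed] True] True by (simp add: tilde_one[OF rb])
    then have "((\<lambda>t. mderiv c c tilde \<one> (?K t)) has_vector_derivative
        mderiv c c tilde \<one> (lie_bracket G M (inf_rb G M \<B> x) y c)) (at 0)"
      by (rule bounded_linear.has_vector_derivative)
        (rule C.Ad_velocity_has_derivative[OF BX y Y(1,2,4)])
    ultimately have "?l c = mderiv c c tilde \<one> (lie_bracket G M (inf_rb G M \<B> x) y c)"
      unfolding l by (simp add: vector_derivative_at)
    then show ?thesis
      by (simp add: dual_inf_rb_chart[OF lie_bracket_closed[OF BX(4) y] True])
  next
    case False
    then have "?l c = 0"
      unfolding l by (simp add: curve_velocity_def Ad0 tilde_one[OF rb])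
    with False show ?thesis by (simp add: inf_rb_def tangent_map_outside tilde_one[OF rb])
  qed
qed

lemma bracket_action_well_defined:
  assumes x: "x \<in> lie_alg G M" and y: "y \<in> lie_alg G M" and y': "y' \<in> lie_alg G M"
    and eq: "inf_rb G M tilde y = inf_rb G M tilde y'"
  shows "inf_rb G M tilde (lie_bracket G M (inf_rb G M \<B> x) y) = inf_rb G M tilde (lie_bracket G M (inf_rb G M \<B> x) y')"
proof -
  note X = exp_curveD[OF x] and Y = exp_curveD[OF y] and Y' = exp_curveD[OF y']
  have "same_velocity M (\<lambda>s. tilde (exp_curve G M y s)) (\<lambda>s. tilde (exp_curve G M y' s))"
    unfolding same_velocity_def using dual_rb_exp_curve[OF y] dual_rb_exp_curve[OF y'] eq by simp
  from same_velocity_action[OF X(3) Y(3) Y'(3) this]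
  have "curve_velocity M (\<lambda>s. tilde (Ad G (\<B> (exp_curve G M x t)) (exp_curve G M y s))) 0
      = curve_velocity M (\<lambda>s. tilde (Ad G (\<B> (exp_curve G M x t)) (exp_curve G M y' s))) 0" for t
    unfolding same_velocity_def by blast
  then show ?thesis
    unfolding iterated_velocity_action[OF x y, symmetric] iterated_velocity_action[OF x y', symmetric]
      iterated_velocity_def rb_rho_eq[OF rb X(3) Y(3)] rb_rho_eq[OF rb X(3) Y'(3)] by simp
qed

text \<open>
  Other preimages \<open>x'\<close> and \<open>y'\<close> lead to \<open>B~ [B x', y'] = B~ [B x, y']\<close>, and here \<open>y'\<close> may be replaced by
  \<open>y\<close> thanks to \<open>bracket_action_well_defined\<close>.
\<close>
theorem inf_rhd_eq:
  assumes x: "x \<in> lie_alg G M" and y: "y \<in> lie_alg G M"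
  shows "inf_rhd G M \<B> (inf_rb G M \<B> x) (alg_tilde (inf_rb G M \<B>) y)
    = alg_tilde (inf_rb G M \<B>) (lie_bracket G M (inf_rb G M \<B> x) y)"
  unfolding inf_rhd_def
proof (rule the_equality)
  let ?B = "inf_rb G M \<B>"
  note closed = lie_bracket_closed[OF rb_exp_curve(4)]
  have it: "iterated_velocity M (\<lambda>t s. rb_rho G \<B> (\<B> (exp_curve G M x t)) (tilde (exp_curve G M y s)))
      = alg_tilde ?B (lie_bracket G M (?B x) y)"
    unfolding iterated_velocity_action[OF x y] by (rule inf_rb_tilde[OF closed[OF x y]])
  then show "\<exists>x'\<in>lie_alg G M. \<exists>y'\<in>lie_alg G M. ?B x = ?B x' \<and> alg_tilde ?B y = alg_tilde ?B y' \<and>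
      alg_tilde ?B (lie_bracket G M (?B x) y)
        = iterated_velocity M (\<lambda>t s. rb_rho G \<B> (\<B> (exp_curve G M x' t)) (tilde (exp_curve G M y' s)))"
    using x y by metis
  fix w assume "\<exists>x'\<in>lie_alg G M. \<exists>y'\<in>lie_alg G M. ?B x = ?B x' \<and> alg_tilde ?B y = alg_tilde ?B y' \<and>
      w = iterated_velocity M (\<lambda>t s. rb_rho G \<B> (\<B> (exp_curve G M x' t)) (tilde (exp_curve G M y' s)))"
  then obtain x' y' where x': "x' \<in> lie_alg G M" and y': "y' \<in> lie_alg G M" and eq: "?B x' = ?B x" "alg_tilde ?B y = alg_tilde ?B y'"
    and w: "w = iterated_velocity M (\<lambda>t s. rb_rho G \<B> (\<B> (exp_curve G M x' t)) (tilde (exp_curve G M y' s)))"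
    by metis
  have "inf_rb G M tilde y = inf_rb G M tilde y'" using inf_rb_tilde[OF y] inf_rb_tilde[OF y'] eq(2) by simp
  from bracket_action_well_defined[OF x y y' this]
  have "w = inf_rb G M tilde (lie_bracket G M (?B x) y)"
    unfolding w iterated_velocity_action[OF x' y'] eq(1) by simp
  then show "w = alg_tilde ?B (lie_bracket G M (?B x) y)"
    by (simp add: inf_rb_tilde[OF closed[OF x y]])
qed

lemma alg_tilde_dual:
  "y \<in> lie_alg G M \<Longrightarrow> alg_tilde (inf_rb G M tilde) y = inf_rb G M \<B> y"
  by (simp add: inf_rb_tilde alg_tilde_def)

lemma inf_brhd_eq_rhd:
  "inf_brhd G M \<B> v u = inf_rhd G M tilde v u"
proof -
  have "(\<exists>x\<in>lie_alg G M. \<exists>y\<in>lie_alg G M. v = alg_tilde (inf_rb G M \<B>) x \<and> u = inf_rb G M \<B> y \<and>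
        w = iterated_velocity M (\<lambda>t s. rb_mu G \<B> (tilde (exp_curve G M x t)) (\<B> (exp_curve G M y s))))
    \<longleftrightarrow> (\<exists>x\<in>lie_alg G M. \<exists>y\<in>lie_alg G M. v = inf_rb G M tilde x \<and> u = alg_tilde (inf_rb G M tilde) y \<and>
        w = iterated_velocity M (\<lambda>t s. rb_rho G tilde (tilde (exp_curve G M x t)) (grp_tilde G tilde (exp_curve G M y s))))" for w
    by (intro bex_cong refl) (simp add: alg_tilde_dual inf_rb_tilde rb_mu_eq_rho[OF rb] tilde_tilde[OF rb] exp_curveD(3))
  then show ?thesis unfolding inf_brhd_def inf_rhd_def by simp
qed

theorem inf_brhd_eq:
  assumes x: "x \<in> lie_alg G M" and y: "y \<in> lie_alg G M"
  shows "inf_brhd G M \<B> (alg_tilde (inf_rb G M \<B>) x) (inf_rb G M \<B> y)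
    = inf_rb G M \<B> (lie_bracket G M (alg_tilde (inf_rb G M \<B>) x) y)"
proof -
  have "inf_rhd G M tilde (inf_rb G M tilde x) (alg_tilde (inf_rb G M tilde) y)
    = alg_tilde (inf_rb G M tilde) (lie_bracket G M (inf_rb G M tilde x) y)"
    by (rule rota_baxter_diff.inf_rhd_eq[OF dual x y])
  then show ?thesis
    unfolding inf_brhd_eq_rhd alg_tilde_dual[OF y] alg_tilde_dual[OF lie_bracket_closed[OF dual_rb_exp_curve(4)[OF x] y]]
    unfolding inf_rb_tilde[OF x] .
qed

end

theorem proposition4p9:
  fixes G :: "('g, 'm) monoid_scheme"
    and M :: "('g, 'e::banach) manifold"
    and \<B> :: "'g \<Rightarrow> 'g"
  assumes "rota_baxter_lie_group G M \<B>"
  shows "is_rb_lie_matched_pair (lie_alg G M) (lie_bracket G M) (inf_rb G M \<B>)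
           (inf_rb G M \<B> ` lie_alg G M) (alg_tilde (inf_rb G M \<B>) ` lie_alg G M)
           (inf_rhd G M \<B>) (inf_brhd G M \<B>)"
proof -
  have L: "lie_group G M" and R: "rota_baxter_operator G \<B>" and S: "smooth_map M M \<B>"
    using assms unfolding rota_baxter_lie_group_def by blast+
  interpret lie_group_on G M by (rule lie_group_on.intro[OF L])
  interpret rota_baxter_diff G M \<B>
    by unfold_locales (use R smooth_map_imp_mdiff_at[OF charted charted S] topspace_M in auto)
  have "inf_rb G M \<B> x \<in> lie_alg G M" "alg_tilde (inf_rb G M \<B>) x \<in> lie_alg G M" if "x \<in> lie_alg G M" for x
    using rb_exp_curve(4)[OF that] dual_rb_exp_curve(4)[OF that] inf_rb_tilde[OF that] by simp_all
  then show ?thesis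
    unfolding is_rb_lie_matched_pair_def by (auto simp: inf_rhd_eq inf_brhd_eq lie_bracket_closed)
qed

end
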